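(* Let $F$ be a field and let $z_1,\dots,z_m$ be non-zero $F$-linear combinations of the variables $x_1,\dots,x_n$. With $I=\operatorname{Ker}(h)\subseteq F[t_1,\dots,t_m]$, $K=\operatorname{Ker}(\psi)\subseteq\Xi$, $P_L$, $P_{L,S}$ and minimal relations as defined in the context, the ideals $I$ and $K$ are generated as follows: $$I=(P_L\mid L\text{ is a minimal relation}),$$ $$K=(P_{L,S}\mid L\text{ is a minimal relation and }S\subseteq|L|).$$
   Context: Let $\Omega=F[x_1,\dots,x_n]\otimes_F\Lambda_F[dx_1,\dots,dx_n]$, where $\Lambda$ denotes the exterior algebra. If $z_i=\sum_j c_{ij}x_j$, put $dz_i=\sum_j c_{ij}\,dx_j$. Let $R=F[x_1,\dots,x_n][z_1^{-1},\dots,z_m^{-1}]$ and let $T=z_1^{-1}\cdots z_m^{-1}\Omega$ be the localization of $\Omega$ obtained by inverting the central elements $z_1,\dots,z_m$. Let $h:F[t_1,\dots,t_m]\to R$ be the $F$-algebra homomorphism with $h(t_i)=z_i^{-1}$. Let $\Xi=F[t_1,\dots,t_m]\otimes_F\Lambda_F[u_1,\dots,u_m]$, and let $\psi:\Xi\to T$ be the ring homomorphism with $\psi(t_i)=z_i^{-1}$ and $\psi(u_i)=z_i^{-1}dz_i$. A (non-zero) linear relation $L$ among the $z_i$ is a formal expression $L=\sum_{i\in|L|}a_iz_i$ with $|L|=\{i_1<\dots<i_k\}\subseteq\{1,\dots,m\}$ non-empty and all $a_i\in F\setminus\{0\}$ ($i\in |L|$), such that $\sum_{i\in|L|}a_iz_i=0$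 in $F[x_1,\dots,x_n]$. Relations are added coefficientwise as formal expressions. A relation $L$ is called minimal if there do not exist relations $L_1,L_2$ such that $L_1+L_2=L$ and $|L_1|,|L_2|\subsetneq|L|$. Put $$P_L=\sum_{i\in|L|}a_i\prod_{q\in|L|\setminus\{i\}}t_q\in F[t_1,\dots,t_m].$$ For $S=\{j_1<\dots<j_l\}\subseteq|L|$, define, computing in the localization $t_1^{-1}\cdots t_m^{-1}\Xi$ with the notation $dz_i:=t_i^{-1}u_i$ and $dL:=\sum_{i\in|L|}a_i\,dz_i$, $$P_{L,S}=P_L\,dz_{j_1}\cdots dz_{j_l}-\sum_{s=1}^{l}\Big(\prod_{q\in|L|\setminus\{j_s\}}t_q\Big)\,dz_{j_1}\cdots dz_{j_{s-1}}\,dL\,dz_{j_{s+1}}\cdots dz_{j_l}$$ (in the $s$-th summand $dz_{j_s}$ is replaced by $dL$). This element lies in $\Xi\subseteq t_1^{-1}\cdots t_m^{-1}\Xi$, and $P_{L,\emptyset}=P_L$. *)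

theory Defs
  imports
    "HOL-Library.Poly_Mapping"
    "HOL-Computational_Algebra.Polynomial_Factorial"
    "HOL-Algebra.RingHom"
begin

section \<open>Exterior algebras\<close>

text \<open>
  \<open>'a ext\<close> is the exterior algebra over the commutative ring \<open>'a\<close> on generators
  \<open>e\<^sub>0, e\<^sub>1, e\<^sub>2, \<dots>\<close>, given by its standard basis: \<open>ext_coeff \<omega> S\<close> is the coefficient of
  \<open>e\<^bsub>s\<^sub>1\<^esub> \<and> \<dots> \<and> e\<^bsub>s\<^sub>k\<^esub>\<close> in \<open>\<omega>\<close>, where \<open>S = {s\<^sub>1 < \<dots> < s\<^sub>k}\<close>.
\<close>

typedef (overloaded) 'a ext =
  "{f :: nat set \<Rightarrow> 'a::zero. finite {S. f S \<noteq> 0} \<and> (\<forall>S. f S \<noteq> 0 \<longrightarrow> finite S)}"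
  morphisms ext_coeff Abs_ext
  by (rule exI[of _ "\<lambda>_. 0"]) simp

setup_lifting type_definition_ext

lemma ext_eqI: "(\<And>S. ext_coeff x S = ext_coeff y S) \<Longrightarrow> x = y"
  by (metis ext ext_coeff_inject)

lemma ext_coeff_infinite: "infinite S \<Longrightarrow> ext_coeff x S = 0"
  using ext_coeff[of x] by auto

lemma finite_ext_support: "finite {S. ext_coeff x S \<noteq> 0}"
  using ext_coeff[of x] by auto

text \<open>For disjoint \<open>A\<close> and \<open>B\<close>, the sign with \<open>e\<^sub>A \<and> e\<^sub>B = \<plusminus> e\<^bsub>A \<union> B\<^esub>\<close>.\<close>

definition ext_sign :: "nat set \<Rightarrow> nat set \<Rightarrow> 'a::comm_ring_1" where
  "ext_sign A B = (-1) ^ card {(a, b). a \<in> A \<and> b \<in> B \<and> b < a}"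

lemma ext_sign_empty [simp]: "ext_sign {} B = 1" "ext_sign A {} = 1"
  by (simp_all add: ext_sign_def)

lemma ext_sign_Un_left:
  assumes "finite A" "finite B" "finite C" "A \<inter> B = {}"
  shows "ext_sign (A \<union> B) C = ext_sign A C * ext_sign B C"
proof -
  have "{(a, b). a \<in> A \<union> B \<and> b \<in> C \<and> b < a} =
      {(a, b). a \<in> A \<and> b \<in> C \<and> b < a} \<union> {(a, b). a \<in> B \<and> b \<in> C \<and> b < a}" by auto
  moreover have "finite {(a, b). a \<in> A \<and> b \<in> C \<and> b < a}"
    by (rule finite_subset[of _ "A \<times> C"]) (use assms in auto)
  moreover have "finite {(a, b). a \<in> B \<and> b \<in> C \<and> b < a}"
    by (rule finite_subset[of _ "B \<times> C"]) (use assms in auto)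
  moreover have "{(a, b). a \<in> A \<and> b \<in> C \<and> b < a} \<inter> {(a, b). a \<in> B \<and> b \<in> C \<and> b < a} = {}"
    using assms by auto
  ultimately show ?thesis
    by (simp add: ext_sign_def card_Un_disjoint power_add)
qed

lemma ext_sign_Un_right:
  assumes "finite A" "finite B" "finite C" "B \<inter> C = {}"
  shows "ext_sign A (B \<union> C) = ext_sign A B * ext_sign A C"
proof -
  have "{(a, b). a \<in> A \<and> b \<in> B \<union> C \<and> b < a} =
      {(a, b). a \<in> A \<and> b \<in> B \<and> b < a} \<union> {(a, b). a \<in> A \<and> b \<in> C \<and> b < a}" by auto
  moreover have "finite {(a, b). a \<in> A \<and> b \<in> B \<and> b < a}"
    by (rule finite_subset[of _ "A \<times> B"]) (use assms in auto)
  moreover have "finite {(a, b). a \<in> A \<and> b \<in> C \<and> b < a}"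
    by (rule finite_subset[of _ "A \<times> C"]) (use assms in auto)
  moreover have "{(a, b). a \<in> A \<and> b \<in> B \<and> b < a} \<inter> {(a, b). a \<in> A \<and> b \<in> C \<and> b < a} = {}"
    using assms by auto
  ultimately show ?thesis
    by (simp add: ext_sign_def card_Un_disjoint power_add)
qed

instantiation ext :: (comm_ring_1) ring_1
begin

lift_definition zero_ext :: "'a ext" is "\<lambda>_. 0" by simp

lift_definition one_ext :: "'a ext" is "\<lambda>S. if S = {} then 1 else 0" by simp

lift_definition plus_ext :: "'a ext \<Rightarrow> 'a ext \<Rightarrow> 'a ext" is "\<lambda>f g S. f S + g S"
proof -
  fix f g :: "nat set \<Rightarrow> 'a"
  assume "finite {S. f S \<noteq> 0} \<and> (\<forall>S. f S \<noteq> 0 \<longrightarrow> finite S)"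
    "finite {S. g S \<noteq> 0} \<and> (\<forall>S. g S \<noteq> 0 \<longrightarrow> finite S)"
  moreover have "{S. f S + g S \<noteq> 0} \<subseteq> {S. f S \<noteq> 0} \<union> {S. g S \<noteq> 0}" by auto
  ultimately show "finite {S. f S + g S \<noteq> 0} \<and> (\<forall>S. f S + g S \<noteq> 0 \<longrightarrow> finite S)"
    by (metis (no_types, lifting) add.right_neutral finite_Un finite_subset)
qed

lift_definition uminus_ext :: "'a ext \<Rightarrow> 'a ext" is "\<lambda>f S. - f S" by simp

lift_definition minus_ext :: "'a ext \<Rightarrow> 'a ext \<Rightarrow> 'a ext" is "\<lambda>f g S. f S - g S"
proof -
  fix f g :: "nat set \<Rightarrow> 'a"
  assume "finite {S. f S \<noteq> 0} \<and> (\<forall>S. f S \<noteq> 0 \<longrightarrow> finite S)"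
    "finite {S. g S \<noteq> 0} \<and> (\<forall>S. g S \<noteq> 0 \<longrightarrow> finite S)"
  moreover have "{S. f S - g S \<noteq> 0} \<subseteq> {S. f S \<noteq> 0} \<union> {S. g S \<noteq> 0}" by auto
  ultimately show "finite {S. f S - g S \<noteq> 0} \<and> (\<forall>S. f S - g S \<noteq> 0 \<longrightarrow> finite S)"
    by (metis (no_types, lifting) diff_self finite_Un finite_subset)
qed

lift_definition times_ext :: "'a ext \<Rightarrow> 'a ext \<Rightarrow> 'a ext"
  is "\<lambda>f g S. \<Sum>A\<in>Pow S. ext_sign A (S - A) * f A * g (S - A)"
proof -
  fix f g :: "nat set \<Rightarrow> 'a"
  assume f: "finite {S. f S \<noteq> 0} \<and> (\<forall>S. f S \<noteq> 0 \<longrightarrow> finite S)"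
    and g: "finite {S. g S \<noteq> 0} \<and> (\<forall>S. g S \<noteq> 0 \<longrightarrow> finite S)"
  let ?h = "\<lambda>S. \<Sum>A\<in>Pow S. ext_sign A (S - A) * f A * g (S - A)"
  have *: "\<exists>A B. S = A \<union> B \<and> f A \<noteq> 0 \<and> g B \<noteq> 0" if h: "?h S \<noteq> 0" for S
  proof -
    obtain A where "A \<in> Pow S" "ext_sign A (S - A) * f A * g (S - A) \<noteq> 0"
      using h by (meson sum.neutral)
    then show ?thesis by (intro exI[of _ A] exI[of _ "S - A"]) auto
  qed
  have "{S. ?h S \<noteq> 0} \<subseteq> (\<lambda>(A, B). A \<union> B) ` ({S. f S \<noteq> 0} \<times> {S. g S \<noteq> 0})"
    using * by fastforce
  then have "finite {S. ?h S \<noteq> 0}"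
    by (rule finite_subset) (use f g in blast)
  moreover have "finite S" if "?h S \<noteq> 0" for S
    using *[OF that] f g by (metis finite_Un)
  ultimately show "finite {S. ?h S \<noteq> 0} \<and> (\<forall>S. ?h S \<noteq> 0 \<longrightarrow> finite S)" by blast
qed

lemma times_ext_assoc: "(x * y) * z = x * (y * z)" for x y z :: "'a ext"
proof (rule ext_eqI)
  fix S
  show "ext_coeff (x * y * z) S = ext_coeff (x * (y * z)) S"
  proof (cases "finite S")
    case False
    then show ?thesis by (simp add: ext_coeff_infinite)
  next
    case True
    let ?X = "ext_coeff x" and ?Y = "ext_coeff y" and ?Z = "ext_coeff z"
    have fin: "finite A" if "A \<subseteq> S" for A using True that finite_subset by blast
    have "ext_coeff (x * y * z) S =
        (\<Sum>A\<in>Pow S. \<Sum>B\<in>Pow A. ext_sign A (S - A) * (ext_sign B (A - B) * ?X B * ?Y (A - B)) * ?Z (S - A))"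
      by (simp add: times_ext.rep_eq sum_distrib_left sum_distrib_right)
    also have "\<dots> = (\<Sum>(A, B)\<in>(SIGMA A:Pow S. Pow A).
        ext_sign A (S - A) * (ext_sign B (A - B) * ?X B * ?Y (A - B)) * ?Z (S - A))"
      by (rule sum.Sigma) (use True fin in auto)
    also have "\<dots> = (\<Sum>(B, C)\<in>(SIGMA B:Pow S. Pow (S - B)).
        ext_sign B (S - B) * ?X B * (ext_sign C (S - B - C) * ?Y C * ?Z (S - B - C)))"
    proof (rule sum.reindex_bij_witness[where
        i = "\<lambda>(B, C). (B \<union> C, B)" and j = "\<lambda>(A, B). (B, A - B)"])
      fix p assume "p \<in> (SIGMA A:Pow S. Pow A)"
      then obtain A B where p: "p = (A, B)" "B \<subseteq> A" "A \<subseteq> S" by auto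
      define C D where "C = A - B" and "D = S - A"
      have eqs: "A = B \<union> C" "S - B = C \<union> D" "S - B - C = D" "A - B = C" "S - A = D"
        using p by (auto simp: C_def D_def)
      have disj: "B \<inter> C = {}" "C \<inter> D = {}" by (auto simp: C_def D_def)
      have fins: "finite B" "finite C" "finite D"
        using p fin by (auto simp: C_def D_def True)
      have "ext_sign (B \<union> C) D * (ext_sign B C :: 'a) = ext_sign B (C \<union> D) * ext_sign C D"
        using fins disj by (simp add: ext_sign_Un_left ext_sign_Un_right)
      then have sgn: "ext_sign A D * (ext_sign B C :: 'a) = ext_sign B (S - B) * ext_sign C D"
        using eqs by simp
      have "ext_sign A D * (ext_sign B C * ?X B * ?Y C) * ?Z D =
          (ext_sign A D * ext_sign B C) * (?X B * ?Y C * ?Z D)" by (simp add: ac_simps)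
      also have "\<dots> = ext_sign B (S - B) * ?X B * (ext_sign C D * ?Y C * ?Z D)"
        by (simp only: sgn) (simp add: ac_simps)
      finally show "(case (case p of (A, B) \<Rightarrow> (B, A - B)) of (B, C) \<Rightarrow>
            ext_sign B (S - B) * ?X B * (ext_sign C (S - B - C) * ?Y C * ?Z (S - B - C))) =
          (case p of (A, B) \<Rightarrow>
            ext_sign A (S - A) * (ext_sign B (A - B) * ?X B * ?Y (A - B)) * ?Z (S - A))"
        unfolding p(1) by (simp only: prod.case eqs(3,4,5))
    qed auto
    also have "\<dots> = (\<Sum>B\<in>Pow S. \<Sum>C\<in>Pow (S - B).
        ext_sign B (S - B) * ?X B * (ext_sign C (S - B - C) * ?Y C * ?Z (S - B - C)))"
      by (rule sum.Sigma[symmetric]) (use True in auto)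
    also have "\<dots> = ext_coeff (x * (y * z)) S"
      by (simp add: times_ext.rep_eq sum_distrib_left)
    finally show ?thesis .
  qed
qed

lemma ext_scalar_sum_left:
  assumes "finite S" "\<And>A. A \<noteq> {} \<Longrightarrow> f A = (0 :: 'a)"
  shows "(\<Sum>A\<in>Pow S. ext_sign A (S - A) * f A * g (S - A)) = f {} * g S"
proof -
  have "(\<Sum>A\<in>Pow S. ext_sign A (S - A) * f A * g (S - A)) =
      (\<Sum>A\<in>{{}}. ext_sign A (S - A) * f A * g (S - A))"
    by (rule sum.mono_neutral_right) (use assms in auto)
  then show ?thesis by simp
qed

lemma ext_scalar_sum_right:
  assumes "finite S" "\<And>A. A \<noteq> {} \<Longrightarrow> f A = (0 :: 'a)"
  shows "(\<Sum>A\<in>Pow S. ext_sign A (S - A) * g A * f (S - A)) = g S * f {}"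
proof -
  have "(\<Sum>A\<in>Pow S. ext_sign A (S - A) * g A * f (S - A)) =
      (\<Sum>A\<in>{S}. ext_sign A (S - A) * g A * f (S - A))"
  proof (rule sum.mono_neutral_right)
    show "\<forall>A\<in>Pow S - {S}. ext_sign A (S - A) * g A * f (S - A) = 0"
    proof
      fix A assume "A \<in> Pow S - {S}"
      then have "S - A \<noteq> {}" by auto
      then show "ext_sign A (S - A) * g A * f (S - A) = 0" by (simp add: assms(2))
    qed
  qed (use assms in auto)
  then show ?thesis by simp
qed

instance
proof
  fix a b c :: "'a ext"
  show "a * b * c = a * (b * c)" by (rule times_ext_assoc)
  show "1 * a = a"
  proof (rule ext_eqI)
    fix S show "ext_coeff (1 * a) S = ext_coeff a S"
      using ext_scalar_sum_left[of S "ext_coeff 1" "ext_coeff a"]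
      by (cases "finite S") (auto simp: ext_coeff_infinite times_ext.rep_eq one_ext.rep_eq)
  qed
  show "a * 1 = a"
  proof (rule ext_eqI)
    fix S show "ext_coeff (a * 1) S = ext_coeff a S"
      using ext_scalar_sum_right[of S "ext_coeff 1" "ext_coeff a"]
      by (cases "finite S") (auto simp: ext_coeff_infinite times_ext.rep_eq one_ext.rep_eq)
  qed
  show "a + b + c = a + (b + c)" by transfer (simp add: ac_simps)
  show "a + b = b + a" by transfer (simp add: ac_simps)
  show "0 + a = a" by transfer simp
  show "- a + a = 0" by transfer simp
  show "a - b = a + - b" by transfer simp
  show "(a + b) * c = a * c + b * c"
    by (rule ext_eqI) (simp add: times_ext.rep_eq plus_ext.rep_eq sum.distrib algebra_simps)
  show "a * (b + c) = a * b + a * c"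
    by (rule ext_eqI) (simp add: times_ext.rep_eq plus_ext.rep_eq sum.distrib algebra_simps)
  show "(0 :: 'a ext) \<noteq> 1"
    by transfer (metis zero_neq_one)
qed

end

lift_definition ext_scalar :: "'a::comm_ring_1 \<Rightarrow> 'a ext" is "\<lambda>a S. if S = {} then a else 0"
  by simp

lift_definition ext_gen :: "nat \<Rightarrow> 'a::comm_ring_1 ext" is "\<lambda>i S. if S = {i} then 1 else 0"
  by simp

text \<open>Extension of scalars from an integral domain to its field of fractions.\<close>

lift_definition ext_fract :: "'a::idom ext \<Rightarrow> 'a fract ext" is "\<lambda>f S. to_fract (f S)"
  by simp


section \<open>Polynomials, differential forms and localizations\<close>

text \<open>
  Polynomials in \<open>X\<^sub>0, X\<^sub>1, \<dots>\<close>.  The polynomial ring in the variables \<open>X\<^sub>i\<close>, \<open>i \<in> V\<close>, is the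
  subring with carrier \<open>poly_on V\<close>; the rings of forms over it are treated likewise.
\<close>

type_synonym 'f mpoly = "(nat \<Rightarrow>\<^sub>0 nat) \<Rightarrow>\<^sub>0 'f"

definition Cst :: "'f::field \<Rightarrow> 'f mpoly" where
  "Cst a = Poly_Mapping.single 0 a"

definition Var :: "nat \<Rightarrow> 'f::field mpoly" where
  "Var i = Poly_Mapping.single (Poly_Mapping.single i 1) 1"

definition poly_on :: "nat set \<Rightarrow> 'f::field mpoly set" where
  "poly_on V = {p. \<forall>\<mu>\<in>Poly_Mapping.keys p. Poly_Mapping.keys \<mu> \<subseteq> V}"

definition forms_on :: "nat set \<Rightarrow> 'f::field mpoly ext set" where
  "forms_on V = {\<omega>. \<forall>S. ext_coeff \<omega> S \<in> poly_on V \<and> (ext_coeff \<omega> S \<noteq> 0 \<longrightarrow> S \<subseteq> V)}"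

definition ring_on :: "'a::ring_1 set \<Rightarrow> 'a ring" where
  "ring_on A = \<lparr>carrier = A, mult = (*), one = 1, zero = 0, add = (+)\<rparr>"

definition poly_ring :: "nat set \<Rightarrow> 'f::field mpoly ring" where
  "poly_ring V = ring_on (poly_on V)"

text \<open>
  \<open>F[X\<^sub>i | i \<in> V] \<otimes> \<Lambda>[e\<^sub>i | i \<in> V]\<close>.  With \<open>e\<^sub>i = dx\<^sub>i\<close> and \<open>V = {1..n}\<close> this is \<open>\<Omega>\<close>; with
  \<open>X\<^sub>i = t\<^sub>i\<close>, \<open>e\<^sub>i = u\<^sub>i\<close> and \<open>V = {1..m}\<close> it is \<open>\<Xi>\<close>.
\<close>

definition form_ring :: "nat set \<Rightarrow> 'f::field mpoly ext ring" where
  "form_ring V = ring_on (forms_on V)"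

definition lin_form :: "nat \<Rightarrow> (nat \<Rightarrow> 'f::field) \<Rightarrow> 'f mpoly" where
  "lin_form n a = (\<Sum>j=1..n. Cst (a j) * Var j)"

definition d_lin_form :: "nat \<Rightarrow> (nat \<Rightarrow> 'f::field) \<Rightarrow> 'f mpoly ext" where
  "d_lin_form n a = (\<Sum>j=1..n. ext_scalar (Cst (a j)) * ext_gen j)"

text \<open>
  The localizations \<open>R\<close> and \<open>T\<close> at the multiplicative set generated by \<open>z\<^sub>i = lin_form n (c i)\<close>,
  \<open>1 \<le> i \<le> m\<close>, realized inside \<open>F(x)\<close> and \<open>F(x) \<otimes> \<Lambda>[dx]\<close>; this is legitimate for
  \<open>z\<^sub>i \<noteq> 0\<close> because \<open>\<Omega>\<close> is a free \<open>F[x]\<close>-module.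
\<close>

definition loc_poly_ring :: "nat \<Rightarrow> nat \<Rightarrow> (nat \<Rightarrow> nat \<Rightarrow> 'f::field) \<Rightarrow> 'f mpoly fract ring" where
  "loc_poly_ring n m c = ring_on
     {inverse (to_fract (\<Prod>i=1..m. lin_form n (c i) ^ k i)) * to_fract p | k p.
        p \<in> poly_on {1..n}}"

definition loc_form_ring :: "nat \<Rightarrow> nat \<Rightarrow> (nat \<Rightarrow> nat \<Rightarrow> 'f::field) \<Rightarrow> 'f mpoly fract ext ring" where
  "loc_form_ring n m c = ring_on
     {ext_scalar (inverse (to_fract (\<Prod>i=1..m. lin_form n (c i) ^ k i))) * ext_fract \<omega> | k \<omega>.
        \<omega> \<in> forms_on {1..n}}"


section \<open>Linear relations\<close>

text \<open>
  A formal expression \<open>L = \<Sum> a\<^sub>i z\<^sub>i\<close> with all \<open>a\<^sub>i \<noteq> 0\<close> is the finitely supported function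
  \<open>i \<mapsto> a\<^sub>i\<close>, so that \<open>|L| = supp L\<close> and relations are added by \<open>+\<close>.
\<close>

abbreviation supp :: "('a \<Rightarrow>\<^sub>0 'b::zero) \<Rightarrow> 'a set" where
  "supp \<equiv> Poly_Mapping.keys"

definition lin_relation ::
    "nat \<Rightarrow> nat \<Rightarrow> (nat \<Rightarrow> nat \<Rightarrow> 'f::field) \<Rightarrow> (nat \<Rightarrow>\<^sub>0 'f) \<Rightarrow> bool" where
  "lin_relation n m c L \<longleftrightarrow> supp L \<noteq> {} \<and> supp L \<subseteq> {1..m} \<and>
     (\<Sum>i\<in>supp L. Cst (Poly_Mapping.lookup L i) * lin_form n (c i)) = 0"

definition minimal_relation ::
    "nat \<Rightarrow> nat \<Rightarrow> (nat \<Rightarrow> nat \<Rightarrow> 'f::field) \<Rightarrow> (nat \<Rightarrow>\<^sub>0 'f) \<Rightarrow> bool" where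
  "minimal_relation n m c L \<longleftrightarrow> lin_relation n m c L \<and>
     \<not> (\<exists>L1 L2. lin_relation n m c L1 \<and> lin_relation n m c L2 \<and> L1 + L2 = L \<and>
          supp L1 \<subset> supp L \<and> supp L2 \<subset> supp L)"

definition P_rel :: "(nat \<Rightarrow>\<^sub>0 'f::field) \<Rightarrow> 'f mpoly" where
  "P_rel L = (\<Sum>i\<in>supp L. Cst (Poly_Mapping.lookup L i) * (\<Prod>q\<in>supp L - {i}. Var q))"

text \<open>The elements \<open>dz\<^sub>i = t\<^sub>i\<^sup>-\<^sup>1 u\<^sub>i\<close> and \<open>dL\<close> of the localization of \<open>\<Xi>\<close>.\<close>

definition dz_loc :: "nat \<Rightarrow> 'f::field mpoly fract ext" where
  "dz_loc i = ext_scalar (inverse (to_fract (Var i))) * ext_gen i"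

definition dL_loc :: "(nat \<Rightarrow>\<^sub>0 'f::field) \<Rightarrow> 'f mpoly fract ext" where
  "dL_loc L = (\<Sum>i\<in>supp L. ext_scalar (to_fract (Cst (Poly_Mapping.lookup L i))) * dz_loc i)"

definition P_form_loc :: "(nat \<Rightarrow>\<^sub>0 'f::field) \<Rightarrow> nat set \<Rightarrow> 'f mpoly fract ext" where
  "P_form_loc L S = (let js = sorted_list_of_set S in
     ext_scalar (to_fract (P_rel L)) * prod_list (map dz_loc js) -
     (\<Sum>s<length js. ext_scalar (to_fract (\<Prod>q\<in>supp L - {js ! s}. Var q)) *
        prod_list ((map dz_loc js)[s := dL_loc L])))"

text \<open>\<open>P\<^bsub>L,S\<^esub>\<close> as an element of \<open>\<Xi>\<close>; see \<open>ext_fract_P_form\<close> and \<open>P_form_in_forms_on\<close> below.\<close>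

definition P_form :: "(nat \<Rightarrow>\<^sub>0 'f::field) \<Rightarrow> nat set \<Rightarrow> 'f mpoly ext" where
  "P_form L S = (THE \<eta>. ext_fract \<eta> = P_form_loc L S)"


section \<open>The objects above are well defined\<close>

subsection \<open>Calculation rules for exterior algebras\<close>

lemma ext_coeff_scalar_mult [simp]: "ext_coeff (ext_scalar a * x) S = a * ext_coeff x S"
  using ext_scalar_sum_left[of S "ext_coeff (ext_scalar a)" "ext_coeff x"]
  by (cases "finite S") (auto simp: ext_coeff_infinite times_ext.rep_eq ext_scalar.rep_eq)

lemma ext_coeff_mult_scalar [simp]: "ext_coeff (x * ext_scalar a) S = ext_coeff x S * a"
  using ext_scalar_sum_right[of S "ext_coeff (ext_scalar a)" "ext_coeff x"]
  by (cases "finite S") (auto simp: ext_coeff_infinite times_ext.rep_eq ext_scalar.rep_eq)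

lemma ext_scalar_commute: "ext_scalar a * x = x * ext_scalar a"
  by (rule ext_eqI) (simp add: mult.commute)

lemma ext_scalar_left_commute: "x * (ext_scalar a * y) = ext_scalar a * (x * y)"
  by (metis ext_scalar_commute mult.assoc)

lemma ext_scalar_0 [simp]: "ext_scalar 0 = 0" by transfer auto
lemma ext_scalar_1 [simp]: "ext_scalar 1 = 1" by transfer auto
lemma ext_scalar_add: "ext_scalar (a + b) = ext_scalar a + ext_scalar b" by transfer auto
lemma ext_scalar_uminus: "ext_scalar (- a) = - ext_scalar a" by transfer auto
lemma ext_scalar_mult: "ext_scalar (a * b) = ext_scalar a * ext_scalar b"
  by (rule ext_eqI) (simp add: ext_scalar.rep_eq)
lemma ext_scalar_sum: "ext_scalar (sum f A) = (\<Sum>i\<in>A. ext_scalar (f i))"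
  by (induction A rule: infinite_finite_induct) (simp_all add: ext_scalar_add)

lemma ext_coeff_zero [simp]: "ext_coeff 0 S = 0" by transfer auto
lemma ext_coeff_add: "ext_coeff (x + y) S = ext_coeff x S + ext_coeff y S" by transfer auto
lemma ext_coeff_uminus: "ext_coeff (- x) S = - ext_coeff x S" by transfer auto

lemma ext_gen_mult_gen:
  "ext_coeff (ext_gen i * ext_gen j) S = (if S = {i, j} \<and> i \<noteq> j then ext_sign {i} {j} else 0)"
proof (cases "finite S")
  case True
  have "ext_coeff (ext_gen i * ext_gen j) S =
      (\<Sum>A\<in>Pow S. if A = {i} \<and> S - A = {j} then ext_sign {i} {j} else 0)"
    unfolding times_ext.rep_eq by (rule sum.cong) (auto simp: ext_gen.rep_eq)
  also have "\<dots> = (\<Sum>A\<in>Pow S. if A = {i} then (if S - {i} = {j} then ext_sign {i} {j} else 0) else 0)"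
    by (rule sum.cong) auto
  also have "\<dots> = (if i \<in> S \<and> S - {i} = {j} then ext_sign {i} {j} else 0)"
    using True by (simp add: sum.delta)
  also have "(i \<in> S \<and> S - {i} = {j}) = (S = {i, j} \<and> i \<noteq> j)" by auto
  finally show ?thesis .
qed (auto simp: ext_coeff_infinite)

lemma ext_gen_square: "ext_gen i * ext_gen i = 0"
  by (rule ext_eqI) (simp add: ext_gen_mult_gen)

lemma ext_sign_eq_1:
  assumes "\<And>a b. a \<in> A \<Longrightarrow> b \<in> B \<Longrightarrow> a \<le> b"
  shows "ext_sign A B = 1"
proof -
  have "{(a, b). a \<in> A \<and> b \<in> B \<and> b < a} = {}" using assms by (auto simp: not_less)
  then show ?thesis by (simp only: ext_sign_def card.empty power_0)
qed

lemma ext_sign_singleton: "ext_sign {i} {j} = (if j < i then -1 else 1)"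
proof -
  have "{(a, b). a \<in> {i} \<and> b \<in> {j} \<and> b < a} = (if j < i then {(i, j)} else {})" by auto
  then show ?thesis by (simp add: ext_sign_def)
qed

lemma ext_gen_anticommute: "ext_gen i * ext_gen j = - (ext_gen j * ext_gen i)"
  by (rule ext_eqI)
    (auto simp: ext_gen_mult_gen ext_coeff_uminus ext_sign_singleton insert_commute)

lemma ext_fract_zero [simp]: "ext_fract 0 = 0" by transfer auto
lemma ext_fract_one [simp]: "ext_fract 1 = 1" by transfer auto
lemma ext_fract_add: "ext_fract (x + y) = ext_fract x + ext_fract y" by transfer auto
lemma ext_fract_uminus: "ext_fract (- x) = - ext_fract x" by transfer auto
lemma ext_fract_diff: "ext_fract (x - y) = ext_fract x - ext_fract y" by transfer auto
lemma ext_fract_gen [simp]: "ext_fract (ext_gen i) = ext_gen i" by transfer auto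
lemma ext_fract_scalar: "ext_fract (ext_scalar a) = ext_scalar (to_fract a)" by transfer auto

lemma to_fract_sum: "to_fract (sum f A) = (\<Sum>i\<in>A. to_fract (f i))"
  by (induction A rule: infinite_finite_induct) simp_all

lemma to_fract_power: "to_fract (x ^ k) = to_fract x ^ k"
  by (induction k) simp_all

lemma to_fract_ext_sign: "to_fract (ext_sign A B) = ext_sign A B"
  by (simp add: ext_sign_def to_fract_power)

lemma ext_fract_mult: "ext_fract (x * y) = ext_fract x * ext_fract y"
  by (rule ext_eqI)
    (simp add: ext_fract.rep_eq times_ext.rep_eq to_fract_sum to_fract_ext_sign)

lemma ext_fract_inject: "ext_fract x = ext_fract y \<Longrightarrow> x = y"
  by (rule ext_eqI) (metis ext_fract.rep_eq to_fract_eq_iff)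

lemma ext_fract_sum: "ext_fract (sum f A) = (\<Sum>i\<in>A. ext_fract (f i))"
  by (induction A rule: infinite_finite_induct) (simp_all add: ext_fract_add)


subsection \<open>Rings given by their carriers\<close>

lemma ring_on_simps [simp]:
  "carrier (ring_on A) = A" "x \<otimes>\<^bsub>ring_on A\<^esub> y = x * y" "\<one>\<^bsub>ring_on A\<^esub> = 1"
  "x \<oplus>\<^bsub>ring_on A\<^esub> y = x + y" "\<zero>\<^bsub>ring_on A\<^esub> = 0"
  by (simp_all add: ring_on_def)

lemma ring_ring_on:
  fixes A :: "'a::ring_1 set"
  assumes "1 \<in> A" "\<And>x y. x \<in> A \<Longrightarrow> y \<in> A \<Longrightarrow> x + y \<in> A"
    "\<And>x y. x \<in> A \<Longrightarrow> y \<in> A \<Longrightarrow> x * y \<in> A" "\<And>x. x \<in> A \<Longrightarrow> - x \<in> A"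
  shows "ring (ring_on A)"
proof -
  have "0 \<in> A" using assms(1,2,4) by (metis add.right_inverse)
  show ?thesis
  proof (rule ringI)
    show "abelian_group (ring_on A)"
    proof (rule abelian_groupI)
      fix x assume "x \<in> carrier (ring_on A)"
      then show "\<exists>y\<in>carrier (ring_on A). y \<oplus>\<^bsub>ring_on A\<^esub> x = \<zero>\<^bsub>ring_on A\<^esub>"
        using assms(4) by (intro bexI[of _ "- x"]) auto
    qed (use assms \<open>0 \<in> A\<close> in \<open>auto simp: ac_simps\<close>)
    show "monoid (ring_on A)"
      by (rule monoidI) (use assms in \<open>auto simp: mult.assoc\<close>)
  qed (auto simp: distrib_left distrib_right)
qed

lemma poly_on_uminus: "p \<in> poly_on V \<Longrightarrow> - p \<in> poly_on V"
  by (simp add: poly_on_def)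

lemma poly_on_0 [simp]: "0 \<in> poly_on V"
  by (simp add: poly_on_def)

lemma poly_on_1 [simp]: "1 \<in> poly_on V"
  by (simp add: poly_on_def)

lemma poly_on_add: "p \<in> poly_on V \<Longrightarrow> q \<in> poly_on V \<Longrightarrow> p + q \<in> poly_on V"
  unfolding poly_on_def using Poly_Mapping.keys_add[of p q] by blast

lemma poly_on_mult: 
  assumes "p \<in> poly_on V" "q \<in> poly_on V"
  shows "p * q \<in> poly_on V"
  unfolding poly_on_def
proof safe
  fix \<mu> i assume "\<mu> \<in> supp (p * q)" "i \<in> supp \<mu>"
  then obtain \<alpha> \<beta> where "\<mu> = \<alpha> + \<beta>" "\<alpha> \<in> supp p" "\<beta> \<in> supp q"
    using keys_mult[of p q] by blast
  then show "i \<in> V"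
    using assms \<open>i \<in> supp \<mu>\<close> Poly_Mapping.keys_add[of \<alpha> \<beta>] unfolding poly_on_def by blast
qed

lemma poly_on_Cst [simp]: "Cst a \<in> poly_on V"
  by (simp add: poly_on_def Cst_def)

lemma poly_on_Var [simp]: "i \<in> V \<Longrightarrow> Var i \<in> poly_on V"
  by (simp add: poly_on_def Var_def)

lemma poly_on_sum: "(\<And>i. i \<in> A \<Longrightarrow> f i \<in> poly_on V) \<Longrightarrow> sum f A \<in> poly_on V"
  by (induction A rule: infinite_finite_induct) (auto intro: poly_on_add)

lemma poly_on_prod: "(\<And>i. i \<in> A \<Longrightarrow> f i \<in> poly_on V) \<Longrightarrow> prod f A \<in> poly_on V"
  by (induction A rule: infinite_finite_induct) (auto intro: poly_on_mult)

lemma poly_on_power: "p \<in> poly_on V \<Longrightarrow> p ^ k \<in> poly_on V"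
  by (induction k) (auto intro: poly_on_mult)

lemma poly_on_ext_sign_mult:
  assumes "p \<in> poly_on V" shows "ext_sign A B * p \<in> poly_on V"
proof -
  have "(-1 :: 'a mpoly) \<in> poly_on V" by (rule poly_on_uminus) simp
  then show ?thesis unfolding ext_sign_def by (intro poly_on_mult poly_on_power assms)
qed

lemma poly_on_mono: "V \<subseteq> W \<Longrightarrow> poly_on V \<subseteq> poly_on W"
  by (fastforce simp: poly_on_def)

lemma Cst_0 [simp]: "Cst 0 = 0" by (simp add: Cst_def)
lemma Cst_1 [simp]: "Cst 1 = 1" by (simp add: Cst_def)
lemma Cst_add: "Cst (a + b) = Cst a + Cst b" by (simp add: Cst_def single_add)
lemma Cst_mult: "Cst (a * b) = Cst a * Cst b" by (simp add: Cst_def mult_single)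

lemma Var_nonzero [simp]: "Var i \<noteq> 0"
  by (simp add: Var_def flip: keys_eq_empty)

lemma forms_on_scalar: "p \<in> poly_on V \<Longrightarrow> ext_scalar p \<in> forms_on V"
  by (auto simp: forms_on_def ext_scalar.rep_eq)

lemma forms_on_gen: "i \<in> V \<Longrightarrow> ext_gen i \<in> forms_on V"
  by (auto simp: forms_on_def ext_gen.rep_eq)

lemma forms_on_0 [simp]: "0 \<in> forms_on V"
  by (simp add: forms_on_def)

lemma forms_on_1 [simp]: "1 \<in> forms_on V"
  using forms_on_scalar[of 1 V] by simp

lemma forms_on_uminus: "x \<in> forms_on V \<Longrightarrow> - x \<in> forms_on V"
  by (auto simp: forms_on_def ext_coeff_uminus poly_on_uminus)

lemma forms_on_add: 
  assumes "x \<in> forms_on V" "y \<in> forms_on V"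
  shows "x + y \<in> forms_on V"
  unfolding forms_on_def
proof (intro CollectI allI conjI impI)
  fix S
  show "ext_coeff (x + y) S \<in> poly_on V"
    using assms by (simp add: forms_on_def ext_coeff_add poly_on_add)
  assume "ext_coeff (x + y) S \<noteq> 0"
  then have "ext_coeff x S \<noteq> 0 \<or> ext_coeff y S \<noteq> 0" by (auto simp: ext_coeff_add)
  then show "S \<subseteq> V" using assms by (auto simp: forms_on_def)
qed

lemma forms_on_mult: 
  assumes "x \<in> forms_on V" "y \<in> forms_on V"
  shows "x * y \<in> forms_on V"
  unfolding forms_on_def
proof (intro CollectI allI conjI impI)
  fix S
  show "ext_coeff (x * y) S \<in> poly_on V"
    unfolding times_ext.rep_eq mult.assoc
    using assms by (intro poly_on_sum poly_on_ext_sign_mult poly_on_mult) (auto simp: forms_on_def)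
  assume "ext_coeff (x * y) S \<noteq> 0"
  then obtain A where "A \<in> Pow S" "ext_sign A (S - A) * ext_coeff x A * ext_coeff y (S - A) \<noteq> 0"
    unfolding times_ext.rep_eq by (meson sum.neutral)
  then have "A \<subseteq> V" "S - A \<subseteq> V" using assms by (auto simp: forms_on_def)
  then show "S \<subseteq> V" by auto
qed

lemma forms_on_sum: "(\<And>i. i \<in> A \<Longrightarrow> f i \<in> forms_on V) \<Longrightarrow> sum f A \<in> forms_on V"
  by (induction A rule: infinite_finite_induct) (auto intro: forms_on_add)

lemma ring_poly_ring: "ring (poly_ring V)"
  unfolding poly_ring_def
  by (rule ring_ring_on) (auto intro: poly_on_add poly_on_mult poly_on_uminus)

lemma ring_form_ring: "ring (form_ring V)"
  unfolding form_ring_def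
  by (rule ring_ring_on) (auto intro: forms_on_add forms_on_mult forms_on_uminus)


subsection \<open>Products of anticommuting elements\<close>

locale anticommuting =
  fixes v :: "nat \<Rightarrow> 'b::comm_ring_1 ext"
  assumes anticommute: "v i * v j = - (v j * v i)"
    and square: "v i * v i = 0"
begin

lemma mult_prod_list_0: "i \<in> set is \<Longrightarrow> v i * prod_list (map v is) = 0"
proof (induction "is")
  case (Cons j js)
  show ?case
  proof (cases "i = j")
    case True
    then show ?thesis by (simp add: square flip: mult.assoc)
  next
    case False
    then have "v i * prod_list (map v js) = 0" using Cons by simp
    then show ?thesis by (simp add: anticommute[of i j] mult.assoc flip: mult.assoc[of "v i"])
  qed
qed simp

lemma prod_list_0: "\<not> distinct is \<Longrightarrow> prod_list (map v is) = 0"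
  by (induction "is") (auto simp: mult_prod_list_0)

definition w :: "nat set \<Rightarrow> 'b ext" where
  "w A = prod_list (map v (sorted_list_of_set A))"

lemma w_empty [simp]: "w {} = 1"
  by (simp add: w_def)

lemma w_insert_less:
  assumes "finite A" "\<And>b. b \<in> A \<Longrightarrow> a < b"
  shows "w (insert a A) = v a * w A"
proof -
  have "a \<notin> A" using assms by blast
  have "sorted_list_of_set (insert a A) = a # sorted_list_of_set A"
    using assms \<open>a \<notin> A\<close> by (subst sorted_list_of_set_insert) (auto intro!: insort_is_Cons less_imp_le)
  then show ?thesis by (simp add: w_def)
qed

lemma mult_w:
  assumes "finite B"
  shows "v a * w B = (if a \<in> B then 0 else ext_scalar (ext_sign {a} B) * w (insert a B))"
  using assms
proof (induction B rule: finite_linorder_min_induct)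
  case empty
  then show ?case using w_insert_less[of "{}" a] by simp
next
  case (insert b B)
  have wb: "w (insert b B) = v b * w B" using insert by (intro w_insert_less) auto
  have bB: "b \<notin> B" using insert by blast
  show ?case
  proof (cases a b rule: linorder_cases)
    case less
    have "ext_sign {a} (insert b B) = (1 :: 'b)"
      using less insert by (intro ext_sign_eq_1) fastforce
    moreover have "w (insert a (insert b B)) = v a * w (insert b B)"
      using less insert by (intro w_insert_less) fastforce+
    ultimately show ?thesis using less insert by fastforce
  next
    case equal
    then show ?thesis by (simp add: wb square flip: mult.assoc)
  next
    case greater
    have *: "v a * w (insert b B) = - (v b * (v a * w B))"
      by (simp add: wb anticommute[of a b] flip: mult.assoc)
    have "ext_sign {a} ({b} \<union> B) = ext_sign {a} {b} * (ext_sign {a} B :: 'b)"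
      using bB insert by (intro ext_sign_Un_right) auto
    then have sgn: "ext_sign {a} (insert b B) = - (ext_sign {a} B :: 'b)"
      using greater by (simp add: ext_sign_singleton)
    show ?thesis
    proof (cases "a \<in> B")
      case True
      then show ?thesis using * insert.IH by simp
    next
      case False
      have "w (insert b (insert a B)) = v b * w (insert a B)"
        using greater insert by (intro w_insert_less) auto
      then show ?thesis
        using * insert.IH False greater
        by (simp add: sgn ext_scalar_left_commute ext_scalar_uminus insert_commute)
    qed
  qed
qed

lemma w_mult:
  assumes "finite A" "finite B"
  shows "w A * w B = (if A \<inter> B = {} then ext_scalar (ext_sign A B) * w (A \<union> B) else 0)"
  using assms(1)
proof (induction A rule: finite_linorder_min_induct)
  case (insert a A)
  have "w (insert a A) = v a * w A" using insert by (intro w_insert_less) auto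
  then have *: "w (insert a A) * w B = v a * (w A * w B)" by (simp add: mult.assoc)
  have aA: "a \<notin> A" using insert by blast
  show ?case
  proof (cases "A \<inter> B = {}")
    case True
    then have **: "w (insert a A) * w B = ext_scalar (ext_sign A B) * (v a * w (A \<union> B))"
      by (simp add: * insert.IH ext_scalar_left_commute)
    show ?thesis
    proof (cases "a \<in> B")
      case True
      then show ?thesis using ** mult_w[of "A \<union> B" a] insert assms by simp
    next
      case False
      have "ext_sign {a} A = (1 :: 'b)"
        using insert by (intro ext_sign_eq_1) fastforce
      moreover have "ext_sign ({a} \<union> A) B = ext_sign {a} B * (ext_sign A B :: 'b)"
        using aA insert assms by (intro ext_sign_Un_left) auto
      moreover have "ext_sign {a} (A \<union> B) = ext_sign {a} A * (ext_sign {a} B :: 'b)"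
        using True insert assms by (intro ext_sign_Un_right) auto
      ultimately have "ext_sign A B * ext_sign {a} (A \<union> B) = (ext_sign (insert a A) B :: 'b)"
        by (simp add: mult.commute)
      then show ?thesis
        using ** mult_w[of "A \<union> B" a] insert assms False True aA
        by (auto simp flip: mult.assoc ext_scalar_mult)
    qed
  next
    case False
    then show ?thesis using * insert.IH by auto
  qed
qed simp

end

lemma anticommuting_gen_multiples:
  "anticommuting (\<lambda>i. \<Sum>j\<in>J i. ext_scalar (a i j) * ext_gen j)"
proof
  have swap: "ext_scalar (a i k) * ext_gen k * (ext_scalar (a j l) * ext_gen l) =
      - (ext_scalar (a j l) * ext_gen l * (ext_scalar (a i k) * ext_gen k))" for i j k l
  proof -
    have "ext_scalar (a i k) * ext_gen k * (ext_scalar (a j l) * ext_gen l) =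
        ext_scalar (a i k) * (ext_scalar (a j l) * (ext_gen k * ext_gen l))"
      by (simp only: mult.assoc ext_scalar_left_commute[of "ext_gen k"])
    also have "\<dots> = - (ext_scalar (a i k) * (ext_scalar (a j l) * (ext_gen l * ext_gen k)))"
      by (simp add: ext_gen_anticommute[of k l])
    also have "ext_scalar (a i k) * (ext_scalar (a j l) * (ext_gen l * ext_gen k)) =
        ext_scalar (a j l) * ext_gen l * (ext_scalar (a i k) * ext_gen k)"
      by (simp only: mult.assoc ext_scalar_left_commute[of "ext_gen l"])
        (simp only: ext_scalar_left_commute[of "ext_scalar (a i k)"])
    finally show ?thesis .
  qed
  show anti: "(\<Sum>j\<in>J i. ext_scalar (a i j) * ext_gen j) * (\<Sum>j\<in>J i'. ext_scalar (a i' j) * ext_gen j) =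
      - ((\<Sum>j\<in>J i'. ext_scalar (a i' j) * ext_gen j) * (\<Sum>j\<in>J i. ext_scalar (a i j) * ext_gen j))"
    for i i'
    unfolding sum_product sum_negf[symmetric]
    by (subst sum.swap) (intro sum.cong refl swap)
  have sq: "(\<Sum>j\<in>K. ext_scalar (a i j) * ext_gen j) * (\<Sum>j\<in>K. ext_scalar (a i j) * ext_gen j) = 0"
    for i K
  proof (induction K rule: infinite_finite_induct)
    case (insert k K)
    let ?x = "ext_scalar (a i k) * ext_gen k" and ?y = "\<Sum>j\<in>K. ext_scalar (a i j) * ext_gen j"
    have "?x * ?y = - (?y * ?x)"
      unfolding sum_distrib_left sum_distrib_right sum_negf[symmetric]
      by (intro sum.cong refl swap)
    moreover have "?x * ?x = 0"
      by (simp add: mult.assoc ext_scalar_left_commute[of "ext_gen k"] ext_gen_square)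
    ultimately show ?case using insert by (simp add: distrib_left distrib_right)
  qed simp_all
  show "(\<Sum>j\<in>J i. ext_scalar (a i j) * ext_gen j) * (\<Sum>j\<in>J i. ext_scalar (a i j) * ext_gen j) = 0"
    for i by (rule sq)
qed

subsection \<open>The element \<open>P\<^bsub>L,S\<^esub>\<close> lies in \<open>\<Xi>\<close>\<close>

interpretation dz: anticommuting "dz_loc :: nat \<Rightarrow> 'f::field mpoly fract ext"
proof -
  have eq: "dz_loc = (\<lambda>i. \<Sum>j\<in>{i}. ext_scalar (inverse (to_fract (Var j :: 'f mpoly))) * ext_gen j)"
    by (simp add: fun_eq_iff dz_loc_def)
  show "anticommuting (dz_loc :: nat \<Rightarrow> 'f mpoly fract ext)"
    using anticommuting_gen_multiples[of "\<lambda>i j. inverse (to_fract (Var j :: 'f mpoly))" "\<lambda>i. {i}"]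
    unfolding eq .
qed

lemma fract_forms_add:
  "x \<in> ext_fract ` forms_on V \<Longrightarrow> y \<in> ext_fract ` forms_on V \<Longrightarrow> x + y \<in> ext_fract ` forms_on V"
  by (elim imageE) (auto simp flip: ext_fract_add intro: imageI forms_on_add)

lemma fract_forms_uminus: "x \<in> ext_fract ` forms_on V \<Longrightarrow> - x \<in> ext_fract ` forms_on V"
  by (elim imageE) (auto simp flip: ext_fract_uminus intro: imageI forms_on_uminus)

lemma fract_forms_mult:
  "x \<in> ext_fract ` forms_on V \<Longrightarrow> y \<in> ext_fract ` forms_on V \<Longrightarrow> x * y \<in> ext_fract ` forms_on V"
  by (elim imageE) (auto simp flip: ext_fract_mult intro: imageI forms_on_mult)

lemma fract_forms_0: "0 \<in> ext_fract ` forms_on V"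
  using imageI[OF forms_on_0, of ext_fract V] by simp

lemma fract_forms_scalar: "p \<in> poly_on V \<Longrightarrow> ext_scalar (to_fract p) \<in> ext_fract ` forms_on V"
  using imageI[OF forms_on_scalar, of p V ext_fract] by (simp add: ext_fract_scalar)

lemma fract_forms_gen: "i \<in> V \<Longrightarrow> ext_gen i \<in> ext_fract ` forms_on V"
  using imageI[OF forms_on_gen, of i V ext_fract] by simp

lemma fract_forms_sum:
  "(\<And>i. i \<in> A \<Longrightarrow> f i \<in> ext_fract ` forms_on V) \<Longrightarrow> sum f A \<in> ext_fract ` forms_on V"
proof (induction A rule: infinite_finite_induct)
  case (insert x A)
  then show ?case by (simp add: fract_forms_add)
qed (simp_all add: fract_forms_0)

lemma dz_prod_in_forms:
  assumes "finite W" "W \<subseteq> V" "distinct ks" "set ks \<subseteq> W"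
  shows "ext_scalar (to_fract (\<Prod>q\<in>W. Var q :: 'a::field mpoly)) * prod_list (map dz_loc ks) \<in> ext_fract ` forms_on V"
  using assms
proof (induction ks arbitrary: W)
  case Nil
  then show ?case
    unfolding list.map prod_list.Nil mult_1_right
    by (intro fract_forms_scalar poly_on_prod poly_on_Var) auto
next
  case (Cons k ks)
  let ?P = "ext_scalar (to_fract (\<Prod>q\<in>W - {k}. Var q :: 'a mpoly)) * prod_list (map dz_loc ks)"
  have "?P \<in> ext_fract ` forms_on V"
    using Cons.prems by (intro Cons.IH) auto
  then have *: "ext_gen k * ?P \<in> ext_fract ` forms_on V"
    by (rule fract_forms_mult[OF fract_forms_gen, rotated]) (use Cons.prems in auto)
  have "(\<Prod>q\<in>W. Var q :: 'a mpoly) = Var k * (\<Prod>q\<in>W - {k}. Var q)"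
    using Cons.prems by (intro prod.remove) auto
  then have "ext_scalar (to_fract (\<Prod>q\<in>W. Var q :: 'a mpoly)) * dz_loc k =
      ext_gen k * ext_scalar (to_fract (\<Prod>q\<in>W - {k}. Var q))"
    by (intro ext_eqI) (simp add: dz_loc_def)
  then show ?case using * by (simp add: mult.assoc[symmetric])
qed

lemma prod_list_update:
  fixes xs :: "'a::monoid_mult list"
  assumes "s < length xs"
  shows "prod_list (xs[s := x]) = prod_list (take s xs) * x * prod_list (drop (Suc s) xs)"
  using assms by (simp add: upd_conv_take_nth_drop mult.assoc)

lemma P_form_loc_in_forms:
  fixes L :: "nat \<Rightarrow>\<^sub>0 'a::field"
  assumes "S \<subseteq> supp L" "supp L \<subseteq> V"
  shows "P_form_loc L S \<in> ext_fract ` forms_on V"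
proof -
  define js where "js = sorted_list_of_set S"
  have "finite S" by (rule finite_subset[OF assms(1) finite_keys])
  then have js: "set js = S" "distinct js" by (simp_all add: js_def)
  let ?Q = "supp L"
  let ?a = "\<lambda>i. ext_scalar (to_fract (Cst (Poly_Mapping.lookup L i)))"
  let ?t = "\<lambda>i. ext_scalar (to_fract (\<Prod>q\<in>?Q - {i}. Var q :: 'a mpoly))"
  let ?D = "prod_list (map dz_loc js) :: 'a mpoly fract ext"
  let ?U = "\<lambda>s i. prod_list (map dz_loc (js[s := i])) :: 'a mpoly fract ext"
  let ?J = "ext_fract ` forms_on V"
  have upd: "prod_list ((map dz_loc js)[s := dL_loc L]) = (\<Sum>i\<in>?Q. ?a i * ?U s i)"
    if "s < length js" for s
  proof -
    have "prod_list ((map dz_loc js)[s := dL_loc L]) =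
        (\<Sum>i\<in>?Q. prod_list (take s (map dz_loc js)) * (?a i * dz_loc i) *
          prod_list (drop (Suc s) (map dz_loc js)))"
      using that by (simp only: prod_list_update length_map dL_loc_def sum_distrib_left sum_distrib_right)
    also have "\<dots> = (\<Sum>i\<in>?Q. ?a i * ?U s i)"
      using that
      by (intro sum.cong refl)
        (simp only: map_update prod_list_update length_map mult.assoc ext_scalar_left_commute)
    finally show ?thesis .
  qed
  have comm: "?t j * (?a i * x) = ?a i * (?t j * x)" for i j x
    by (rule ext_scalar_left_commute)
  have summand_in: "?t (js ! s) * (?a i * ?U s i) \<in> ?J"
    if s: "s < length js" and i: "i \<in> ?Q - {js ! s}" for s i
  proof (cases "i \<in> S")
    case True
    then obtain r where r: "r < length js" "js ! r = i"
      using js(1) by (auto simp: in_set_conv_nth)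
    have "\<not> distinct (js[s := i])"
    proof
      assume "distinct (js[s := i])"
      moreover have "r \<noteq> s" using r i by auto
      moreover have "js[s := i] ! r = js[s := i] ! s" using r s \<open>r \<noteq> s\<close> by simp
      ultimately show False using nth_eq_iff_index_eq[of "js[s := i]" r s] r(1) s by simp
    qed
    then have "?U s i = 0" by (rule dz.prod_list_0)
    then show ?thesis by (simp add: fract_forms_0)
  next
    case False
    have "distinct (js[s := i])" using js False by (intro distinct_list_update) auto
    moreover have "set (js[s := i]) \<subseteq> ?Q - {js ! s}"
    proof
      fix x assume "x \<in> set (js[s := i])"
      then obtain r where r: "r < length js" "x = js[s := i] ! r"
        by (auto simp: in_set_conv_nth)
      show "x \<in> ?Q - {js ! s}"
      proof (cases "r = s")
        case False
        then have "x = js ! r" using r by simp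
        moreover have "js ! r \<noteq> js ! s" using nth_eq_iff_index_eq[OF js(2), of r s] r(1) s False by simp
        moreover have "js ! r \<in> S" using js(1) r by (metis nth_mem)
        ultimately show ?thesis using assms by auto
      qed (use r s i in auto)
    qed
    ultimately have "?t (js ! s) * ?U s i \<in> ?J"
      using assms by (intro dz_prod_in_forms) auto
    then show ?thesis
      unfolding comm by (rule fract_forms_mult[OF fract_forms_scalar[OF poly_on_Cst]])
  qed
  have summand: "?t (js ! s) * prod_list ((map dz_loc js)[s := dL_loc L]) =
      ?a (js ! s) * (?t (js ! s) * ?D) + (\<Sum>i\<in>?Q - {js ! s}. ?t (js ! s) * (?a i * ?U s i))"
    if s: "s < length js" for s
  proof -
    have "js ! s \<in> ?Q" using s js assms by (metis nth_mem subsetD)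
    then have "(\<Sum>i\<in>?Q. ?a i * ?U s i) =
        ?a (js ! s) * ?U s (js ! s) + (\<Sum>i\<in>?Q - {js ! s}. ?a i * ?U s i)"
      by (intro sum.remove) auto
    then have "?t (js ! s) * prod_list ((map dz_loc js)[s := dL_loc L]) =
        ?t (js ! s) * (?a (js ! s) * ?U s (js ! s)) +
        (\<Sum>i\<in>?Q - {js ! s}. ?t (js ! s) * (?a i * ?U s i))"
      by (simp only: upd[OF s] distrib_left sum_distrib_left)
    moreover have "?t (js ! s) * (?a (js ! s) * ?U s (js ! s)) = ?a (js ! s) * (?t (js ! s) * ?D)"
      unfolding list_update_id by (rule comm)
    ultimately show ?thesis by simp
  qed
  have P: "ext_scalar (to_fract (P_rel L)) = (\<Sum>i\<in>?Q. ?a i * ?t i)"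
    by (simp add: P_rel_def to_fract_sum ext_scalar_sum ext_scalar_mult)
  have "bij_betw ((!) js) {..<length js} S"
    by (rule bij_betw_nth) (use js in auto)
  then have S: "(\<Sum>s<length js. ?a (js ! s) * (?t (js ! s) * ?D)) = (\<Sum>i\<in>S. ?a i * (?t i * ?D))"
    by (rule sum.reindex_bij_betw)
  let ?E = "\<Sum>s<length js. \<Sum>i\<in>?Q - {js ! s}. ?t (js ! s) * (?a i * ?U s i)"
  have "P_form_loc L S = (\<Sum>i\<in>?Q. ?a i * (?t i * ?D)) - ((\<Sum>i\<in>S. ?a i * (?t i * ?D)) + ?E)"
  proof -
    have "ext_scalar (to_fract (P_rel L)) * ?D = (\<Sum>i\<in>?Q. ?a i * (?t i * ?D))"
      by (simp only: P sum_distrib_right mult.assoc)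
    moreover have "(\<Sum>s<length js. ?t (js ! s) * prod_list ((map dz_loc js)[s := dL_loc L])) =
        (\<Sum>i\<in>S. ?a i * (?t i * ?D)) + ?E"
      unfolding S[symmetric] sum.distrib[symmetric] by (intro sum.cong refl summand) auto
    ultimately show ?thesis
      by (simp only: P_form_loc_def Let_def js_def[symmetric])
  qed
  also have "\<dots> = (\<Sum>i\<in>?Q - S. ?a i * (?t i * ?D)) + - ?E"
    using assms by (simp add: sum_diff)
  also have "\<dots> \<in> ?J"
  proof (intro fract_forms_add fract_forms_uminus fract_forms_sum)
    fix i assume "i \<in> ?Q - S"
    then have "?t i * ?D \<in> ?J"
      using js assms by (intro dz_prod_in_forms) auto
    then show "?a i * (?t i * ?D) \<in> ?J"
      by (rule fract_forms_mult[OF fract_forms_scalar[OF poly_on_Cst]])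
  qed (use summand_in in auto)
  finally show ?thesis .
qed

lemma ext_fract_P_form:
  assumes "S \<subseteq> supp L"
  shows "ext_fract (P_form L S) = P_form_loc L S"
proof -
  obtain \<eta> where "ext_fract \<eta> = P_form_loc L S"
    using P_form_loc_in_forms[OF assms order_refl] by force
  then show ?thesis
    unfolding P_form_def by (rule theI) (metis \<open>ext_fract \<eta> = P_form_loc L S\<close> ext_fract_inject)
qed

lemma P_form_in_forms_on: "S \<subseteq> supp L \<Longrightarrow> supp L \<subseteq> V \<Longrightarrow> P_form L S \<in> forms_on V"
  using P_form_loc_in_forms[of S L V] ext_fract_P_form[of S L] by (auto dest: ext_fract_inject)

lemma P_form_empty: "P_form L {} = ext_scalar (P_rel L)"
  by (rule ext_fract_inject) (simp add: ext_fract_P_form P_form_loc_def ext_fract_scalar)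


subsection \<open>The localizations are rings\<close>

lemma lin_form_in_poly_on: "lin_form n a \<in> poly_on {1..n}"
  unfolding lin_form_def by (intro poly_on_sum poly_on_mult poly_on_Cst poly_on_Var)

lemma d_lin_form_in_forms_on: "d_lin_form n a \<in> forms_on {1..n}"
  unfolding d_lin_form_def by (intro forms_on_sum forms_on_mult forms_on_scalar forms_on_gen poly_on_Cst)

definition den :: "nat \<Rightarrow> nat \<Rightarrow> (nat \<Rightarrow> nat \<Rightarrow> 'f::field) \<Rightarrow> (nat \<Rightarrow> nat) \<Rightarrow> 'f mpoly" where
  "den n m c k = (\<Prod>i=1..m. lin_form n (c i) ^ k i)"

lemma den_in_poly_on: "den n m c k \<in> poly_on {1..n}"
  unfolding den_def by (intro poly_on_prod poly_on_power lin_form_in_poly_on)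

lemma den_0 [simp]: "den n m c (\<lambda>_. 0) = 1"
  by (simp add: den_def)

lemma den_add: "den n m c (\<lambda>i. k i + l i) = den n m c k * den n m c l"
  by (simp add: den_def power_add prod.distrib)

lemma den_single: "i \<in> {1..m} \<Longrightarrow> den n m c (\<lambda>j. if j = i then 1 else 0) = lin_form n (c i)"
  by (simp add: den_def if_distrib[of "\<lambda>k. _ ^ k"] cong: if_cong)

context
  fixes n m :: nat and c :: "nat \<Rightarrow> nat \<Rightarrow> 'f::field"
  assumes z_nonzero: "\<And>i. i \<in> {1..m} \<Longrightarrow> lin_form n (c i) \<noteq> 0"
begin

lemma den_nonzero [simp]: "den n m c k \<noteq> 0"
  using z_nonzero by (auto simp: den_def)

lemma carrier_loc_poly_ring:
  "carrier (loc_poly_ring n m c) =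
    {inverse (to_fract (den n m c k)) * to_fract p | k p. p \<in> poly_on {1..n}}"
  by (simp add: loc_poly_ring_def den_def)

lemma carrier_loc_form_ring:
  "carrier (loc_form_ring n m c) =
    {ext_scalar (inverse (to_fract (den n m c k))) * ext_fract \<omega> | k \<omega>. \<omega> \<in> forms_on {1..n}}"
  by (simp add: loc_form_ring_def den_def)

lemma loc_polyI:
  "p \<in> poly_on {1..n} \<Longrightarrow> x = inverse (to_fract (den n m c k)) * to_fract p \<Longrightarrow>
    x \<in> carrier (loc_poly_ring n m c)"
  unfolding carrier_loc_poly_ring by blast

lemma loc_formI:
  "\<omega> \<in> forms_on {1..n} \<Longrightarrow> x = ext_scalar (inverse (to_fract (den n m c k))) * ext_fract \<omega> \<Longrightarrow>
    x \<in> carrier (loc_form_ring n m c)"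
  unfolding carrier_loc_form_ring by blast

lemma loc_poly_of_poly: "p \<in> poly_on {1..n} \<Longrightarrow> to_fract p \<in> carrier (loc_poly_ring n m c)"
  by (rule loc_polyI[where k = "\<lambda>_. 0"]) simp_all

lemma loc_poly_add:
  assumes "x \<in> carrier (loc_poly_ring n m c)" "y \<in> carrier (loc_poly_ring n m c)"
  shows "x + y \<in> carrier (loc_poly_ring n m c)"
proof -
  obtain k p l q where x: "x = inverse (to_fract (den n m c k)) * to_fract p" "p \<in> poly_on {1..n}"
    and y: "y = inverse (to_fract (den n m c l)) * to_fract q" "q \<in> poly_on {1..n}"
    using assms unfolding carrier_loc_poly_ring by blast
  show ?thesis
  proof (rule loc_polyI)
    show "den n m c l * p + den n m c k * q \<in> poly_on {1..n}"
      by (intro poly_on_add poly_on_mult den_in_poly_on x y)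
    show "x + y = inverse (to_fract (den n m c (\<lambda>i. k i + l i))) *
        to_fract (den n m c l * p + den n m c k * q)"
      by (simp add: x y den_add field_simps)
  qed
qed

lemma loc_poly_mult:
  assumes "x \<in> carrier (loc_poly_ring n m c)" "y \<in> carrier (loc_poly_ring n m c)"
  shows "x * y \<in> carrier (loc_poly_ring n m c)"
proof -
  obtain k p l q where x: "x = inverse (to_fract (den n m c k)) * to_fract p" "p \<in> poly_on {1..n}"
    and y: "y = inverse (to_fract (den n m c l)) * to_fract q" "q \<in> poly_on {1..n}"
    using assms unfolding carrier_loc_poly_ring by blast
  show ?thesis
  proof (rule loc_polyI)
    show "p * q \<in> poly_on {1..n}" by (intro poly_on_mult x y)
    show "x * y = inverse (to_fract (den n m c (\<lambda>i. k i + l i))) * to_fract (p * q)"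
      by (simp add: x y den_add field_simps)
  qed
qed

lemma loc_poly_uminus:
  "x \<in> carrier (loc_poly_ring n m c) \<Longrightarrow> - x \<in> carrier (loc_poly_ring n m c)"
  using loc_poly_mult[OF loc_poly_of_poly[OF poly_on_uminus[OF poly_on_1]], of x] by simp

lemma loc_poly_inverse:
  "i \<in> {1..m} \<Longrightarrow> inverse (to_fract (lin_form n (c i))) \<in> carrier (loc_poly_ring n m c)"
  by (rule loc_polyI[where p = 1 and k = "\<lambda>j. if j = i then 1 else 0"]) (simp_all add: den_single)

lemma loc_poly_sum:
  "(\<And>i. i \<in> A \<Longrightarrow> f i \<in> carrier (loc_poly_ring n m c)) \<Longrightarrow> sum f A \<in> carrier (loc_poly_ring n m c)"
  using loc_poly_of_poly[OF poly_on_0]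
  by (induction A rule: infinite_finite_induct) (simp_all add: loc_poly_add)

lemma loc_poly_power:
  "x \<in> carrier (loc_poly_ring n m c) \<Longrightarrow> x ^ k \<in> carrier (loc_poly_ring n m c)"
  using loc_poly_of_poly[OF poly_on_1]
  by (induction k) (simp_all add: loc_poly_mult)

lemma loc_poly_prod:
  "(\<And>i. i \<in> A \<Longrightarrow> f i \<in> carrier (loc_poly_ring n m c)) \<Longrightarrow> prod f A \<in> carrier (loc_poly_ring n m c)"
  using loc_poly_of_poly[OF poly_on_1]
  by (induction A rule: infinite_finite_induct) (simp_all add: loc_poly_mult)

lemma loc_form_of_form: "\<omega> \<in> forms_on {1..n} \<Longrightarrow> ext_fract \<omega> \<in> carrier (loc_form_ring n m c)"
  by (rule loc_formI[where k = "\<lambda>_. 0"]) simp_all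

lemma loc_form_scalar:
  assumes "x \<in> carrier (loc_poly_ring n m c)"
  shows "ext_scalar x \<in> carrier (loc_form_ring n m c)"
proof -
  obtain k p where x: "x = inverse (to_fract (den n m c k)) * to_fract p" "p \<in> poly_on {1..n}"
    using assms unfolding carrier_loc_poly_ring by blast
  show ?thesis
    by (rule loc_formI[OF forms_on_scalar[OF x(2)]]) (simp add: x ext_scalar_mult ext_fract_scalar)
qed

lemma loc_form_add:
  assumes "x \<in> carrier (loc_form_ring n m c)" "y \<in> carrier (loc_form_ring n m c)"
  shows "x + y \<in> carrier (loc_form_ring n m c)"
proof -
  obtain k p l q where
    x: "x = ext_scalar (inverse (to_fract (den n m c k))) * ext_fract p" "p \<in> forms_on {1..n}" and
    y: "y = ext_scalar (inverse (to_fract (den n m c l))) * ext_fract q" "q \<in> forms_on {1..n}"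
    using assms unfolding carrier_loc_form_ring by blast
  show ?thesis
  proof (rule loc_formI)
    show "ext_scalar (den n m c l) * p + ext_scalar (den n m c k) * q \<in> forms_on {1..n}"
      by (intro forms_on_add forms_on_mult forms_on_scalar den_in_poly_on x y)
    show "x + y = ext_scalar (inverse (to_fract (den n m c (\<lambda>i. k i + l i)))) *
        ext_fract (ext_scalar (den n m c l) * p + ext_scalar (den n m c k) * q)"
      by (rule ext_eqI)
        (simp add: x y den_add ext_coeff_add ext_fract_add ext_fract_mult ext_fract_scalar field_simps)
  qed
qed

lemma loc_form_mult:
  assumes "x \<in> carrier (loc_form_ring n m c)" "y \<in> carrier (loc_form_ring n m c)"
  shows "x * y \<in> carrier (loc_form_ring n m c)"
proof -
  obtain k p l q where
    x: "x = ext_scalar (inverse (to_fract (den n m c k))) * ext_fract p" "p \<in> forms_on {1..n}" and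
    y: "y = ext_scalar (inverse (to_fract (den n m c l))) * ext_fract q" "q \<in> forms_on {1..n}"
    using assms unfolding carrier_loc_form_ring by blast
  show ?thesis
  proof (rule loc_formI)
    show "p * q \<in> forms_on {1..n}" by (intro forms_on_mult x y)
    have "x * y = ext_scalar (inverse (to_fract (den n m c k))) *
        (ext_fract p * (ext_scalar (inverse (to_fract (den n m c l))) * ext_fract q))"
      by (simp only: x y mult.assoc)
    also have "\<dots> = ext_scalar (inverse (to_fract (den n m c k))) *
        (ext_scalar (inverse (to_fract (den n m c l))) * ext_fract (p * q))"
      by (simp only: ext_scalar_left_commute[of "ext_fract p"] ext_fract_mult)
    also have "\<dots> = ext_scalar (inverse (to_fract (den n m c (\<lambda>i. k i + l i)))) * ext_fract (p * q)"
      by (rule ext_eqI) (simp add: den_add)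
    finally show "x * y =
        ext_scalar (inverse (to_fract (den n m c (\<lambda>i. k i + l i)))) * ext_fract (p * q)" .
  qed
qed

lemma loc_form_uminus:
  assumes "x \<in> carrier (loc_form_ring n m c)"
  shows "- x \<in> carrier (loc_form_ring n m c)"
  using loc_form_mult[OF loc_form_of_form[OF forms_on_uminus[OF forms_on_1]] assms]
  by (simp add: ext_fract_uminus)

lemma loc_form_sum:
  "(\<And>i. i \<in> A \<Longrightarrow> f i \<in> carrier (loc_form_ring n m c)) \<Longrightarrow> sum f A \<in> carrier (loc_form_ring n m c)"
  using loc_form_of_form[OF forms_on_0]
  by (induction A rule: infinite_finite_induct) (simp_all add: loc_form_add)

lemma loc_form_prod_list:
  "(\<And>x. x \<in> set xs \<Longrightarrow> x \<in> carrier (loc_form_ring n m c)) \<Longrightarrow>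
    prod_list xs \<in> carrier (loc_form_ring n m c)"
  using loc_form_of_form[OF forms_on_1]
  by (induction xs) (simp_all add: loc_form_mult)

lemma ring_loc_poly_ring: "ring (loc_poly_ring n m c)"
proof -
  have "loc_poly_ring n m c = ring_on (carrier (loc_poly_ring n m c))"
    by (simp add: loc_poly_ring_def)
  moreover have "ring (ring_on (carrier (loc_poly_ring n m c)))"
    using loc_poly_of_poly[OF poly_on_1]
    by (intro ring_ring_on loc_poly_add loc_poly_mult loc_poly_uminus) simp_all
  ultimately show ?thesis by simp
qed

lemma ring_loc_form_ring: "ring (loc_form_ring n m c)"
proof -
  have "loc_form_ring n m c = ring_on (carrier (loc_form_ring n m c))"
    by (simp add: loc_form_ring_def)
  moreover have "ring (ring_on (carrier (loc_form_ring n m c)))"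
    using loc_form_of_form[OF forms_on_1]
    by (intro ring_ring_on loc_form_add loc_form_mult loc_form_uminus) simp_all
  ultimately show ?thesis by simp
qed

end


subsection \<open>Existence of the homomorphisms \<open>h\<close> and \<open>\<psi>\<close>\<close>

definition mon_eval :: "(nat \<Rightarrow> 'g::comm_ring_1) \<Rightarrow> (nat \<Rightarrow>\<^sub>0 nat) \<Rightarrow> 'g" where
  "mon_eval y \<mu> = (\<Prod>i\<in>supp \<mu>. y i ^ Poly_Mapping.lookup \<mu> i)"

definition poly_eval :: "('f::field \<Rightarrow> 'g::comm_ring_1) \<Rightarrow> (nat \<Rightarrow> 'g) \<Rightarrow> 'f mpoly \<Rightarrow> 'g" where
  "poly_eval \<phi> y p = (\<Sum>\<mu>\<in>supp p. \<phi> (Poly_Mapping.lookup p \<mu>) * mon_eval y \<mu>)"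

lemma mon_eval_superset:
  assumes "finite A" "supp \<mu> \<subseteq> A"
  shows "mon_eval y \<mu> = (\<Prod>i\<in>A. y i ^ Poly_Mapping.lookup \<mu> i)"
  unfolding mon_eval_def
  by (rule prod.mono_neutral_left) (use assms in \<open>auto simp: in_keys_iff\<close>)

lemma mon_eval_add: "mon_eval y (\<mu> + \<nu>) = mon_eval y \<mu> * mon_eval y \<nu>"
proof -
  have "supp (\<mu> + \<nu>) \<subseteq> supp \<mu> \<union> supp \<nu>" by (rule Poly_Mapping.keys_add)
  then show ?thesis
    by (simp add: mon_eval_superset[of "supp \<mu> \<union> supp \<nu>"] lookup_add power_add prod.distrib)
qed

lemma mpoly_sum_monomials:
  fixes p :: "'f::field mpoly"
  shows "p = (\<Sum>\<mu>\<in>supp p. Poly_Mapping.single \<mu> (Poly_Mapping.lookup p \<mu>))"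
proof (rule poly_mapping_eqI)
  fix \<nu>
  show "Poly_Mapping.lookup p \<nu> =
      Poly_Mapping.lookup (\<Sum>\<mu>\<in>supp p. Poly_Mapping.single \<mu> (Poly_Mapping.lookup p \<mu>)) \<nu>"
    by (cases "\<nu> \<in> supp p") (auto simp: lookup_sum lookup_single when_def in_keys_iff)
qed

context
  fixes \<phi> :: "'f::field \<Rightarrow> 'g::comm_ring_1" and y :: "nat \<Rightarrow> 'g"
  assumes phi: "\<phi> 0 = 0" "\<phi> 1 = 1" "\<And>a b. \<phi> (a + b) = \<phi> a + \<phi> b" "\<And>a b. \<phi> (a * b) = \<phi> a * \<phi> b"
begin

lemma poly_eval_superset:
  assumes "finite A" "supp p \<subseteq> A"
  shows "poly_eval \<phi> y p = (\<Sum>\<mu>\<in>A. \<phi> (Poly_Mapping.lookup p \<mu>) * mon_eval y \<mu>)"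
  unfolding poly_eval_def
  by (rule sum.mono_neutral_left) (use assms phi in \<open>auto simp: in_keys_iff\<close>)

lemma poly_eval_add: "poly_eval \<phi> y (p + q) = poly_eval \<phi> y p + poly_eval \<phi> y q"
proof -
  have "supp (p + q) \<subseteq> supp p \<union> supp q" by (rule Poly_Mapping.keys_add)
  then show ?thesis
    by (simp add: poly_eval_superset[of "supp p \<union> supp q"] lookup_add phi distrib_right sum.distrib)
qed

lemma poly_eval_0: "poly_eval \<phi> y 0 = 0"
  by (simp add: poly_eval_def)

lemma poly_eval_sum: "poly_eval \<phi> y (sum f A) = (\<Sum>i\<in>A. poly_eval \<phi> y (f i))"
  by (induction A rule: infinite_finite_induct) (simp_all add: poly_eval_0 poly_eval_add)

lemma poly_eval_single: "poly_eval \<phi> y (Poly_Mapping.single \<mu> a) = \<phi> a * mon_eval y \<mu>"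
  by (cases "a = 0") (simp_all add: poly_eval_def phi)

lemma poly_eval_mult: "poly_eval \<phi> y (p * q) = poly_eval \<phi> y p * poly_eval \<phi> y q"
proof -
  let ?p = "\<lambda>\<mu>. Poly_Mapping.lookup p \<mu>" and ?q = "\<lambda>\<nu>. Poly_Mapping.lookup q \<nu>"
  have "p * q = (\<Sum>\<mu>\<in>supp p. Poly_Mapping.single \<mu> (?p \<mu>)) * (\<Sum>\<nu>\<in>supp q. Poly_Mapping.single \<nu> (?q \<nu>))"
    by (simp flip: mpoly_sum_monomials)
  also have "\<dots> = (\<Sum>\<mu>\<in>supp p. \<Sum>\<nu>\<in>supp q. Poly_Mapping.single (\<mu> + \<nu>) (?p \<mu> * ?q \<nu>))"
    by (simp add: sum_product mult_single)
  finally have "poly_eval \<phi> y (p * q) =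
      (\<Sum>\<mu>\<in>supp p. \<Sum>\<nu>\<in>supp q. (\<phi> (?p \<mu>) * mon_eval y \<mu>) * (\<phi> (?q \<nu>) * mon_eval y \<nu>))"
    by (simp add: poly_eval_sum poly_eval_single phi mon_eval_add ac_simps)
  then show ?thesis by (simp add: poly_eval_def sum_product)
qed

lemma poly_eval_Cst: "poly_eval \<phi> y (Cst a) = \<phi> a"
  by (simp add: Cst_def poly_eval_single mon_eval_def)

lemma poly_eval_Var: "poly_eval \<phi> y (Var i) = y i"
  by (simp add: Var_def poly_eval_single mon_eval_def phi)

lemma poly_eval_1: "poly_eval \<phi> y 1 = 1"
  using poly_eval_Cst[of 1] by (simp add: phi)

lemma poly_eval_uminus: "poly_eval \<phi> y (- p) = - poly_eval \<phi> y p"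
  using poly_eval_add[of p "- p"] by (simp add: poly_eval_0 eq_neg_iff_add_eq_0 add.commute)

lemma poly_eval_ext_sign: "poly_eval \<phi> y (ext_sign A B) = ext_sign A B"
proof -
  have "poly_eval \<phi> y ((- 1) ^ k) = (- 1) ^ k" for k
    by (induction k) (simp_all add: poly_eval_1 poly_eval_uminus)
  then show ?thesis by (simp add: ext_sign_def)
qed

end

context
  fixes n m :: nat and c :: "nat \<Rightarrow> nat \<Rightarrow> 'f::field"
  assumes z_nonzero: "\<And>i. i \<in> {1..m} \<Longrightarrow> lin_form n (c i) \<noteq> 0"
begin

definition h0 :: "'f mpoly \<Rightarrow> 'f mpoly fract" where
  "h0 = poly_eval (\<lambda>a. to_fract (Cst a)) (\<lambda>i. inverse (to_fract (lin_form n (c i))))"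

lemma h0_simps:
  "h0 (p + q) = h0 p + h0 q" "h0 (p * q) = h0 p * h0 q" "h0 0 = 0" "h0 1 = 1"
  "h0 (ext_sign A B) = ext_sign A B" "h0 (sum f C) = (\<Sum>i\<in>C. h0 (f i))"
  "h0 (Cst a) = to_fract (Cst a)" "h0 (Var i) = inverse (to_fract (lin_form n (c i)))"
  unfolding h0_def
  by (simp_all add: poly_eval_add poly_eval_mult poly_eval_0 poly_eval_1 poly_eval_ext_sign
      poly_eval_sum poly_eval_Cst poly_eval_Var Cst_add Cst_mult)

lemma h0_in_carrier:
  assumes "p \<in> poly_on {1..m}"
  shows "h0 p \<in> carrier (loc_poly_ring n m c)"
  unfolding h0_def poly_eval_def mon_eval_def
  using assms unfolding poly_on_def
  by (intro loc_poly_sum[OF z_nonzero] loc_poly_mult[OF z_nonzero] loc_poly_of_poly[OF z_nonzero]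
      loc_poly_prod[OF z_nonzero] loc_poly_power[OF z_nonzero] loc_poly_inverse[OF z_nonzero]
      poly_on_Cst) (auto dest!: bspec)

lemma exists_h:
  "\<exists>h. h \<in> ring_hom (poly_ring {1..m}) (loc_poly_ring n m c) \<and>
     (\<forall>a. h (Cst a) = to_fract (Cst a)) \<and>
     (\<forall>i\<in>{1..m}. h (Var i) = inverse (to_fract (lin_form n (c i))))"
proof (intro exI conjI)
  show "h0 \<in> ring_hom (poly_ring {1..m}) (loc_poly_ring n m c)"
  proof (rule ring_hom_memI)
    fix p :: "'f mpoly" assume "p \<in> carrier (poly_ring {1..m})"
    then show "h0 p \<in> carrier (loc_poly_ring n m c)"
      by (intro h0_in_carrier) (simp add: poly_ring_def)
  qed (simp_all add: poly_ring_def loc_poly_ring_def h0_simps)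
qed (simp_all add: h0_simps)

definition v0 :: "nat \<Rightarrow> 'f mpoly fract ext" where
  "v0 i = ext_scalar (inverse (to_fract (lin_form n (c i)))) * ext_fract (d_lin_form n (c i))"

lemma anticommuting_v0: "anticommuting v0"
proof -
  have eq: "v0 = (\<lambda>i. \<Sum>j\<in>{1..n}.
      ext_scalar (inverse (to_fract (lin_form n (c i))) * to_fract (Cst (c i j))) * ext_gen j)"
    by (simp add: fun_eq_iff v0_def d_lin_form_def ext_fract_sum ext_fract_mult ext_fract_scalar
        sum_distrib_left ext_scalar_mult mult.assoc)
  show ?thesis unfolding eq by (rule anticommuting_gen_multiples)
qed

interpretation v0: anticommuting v0 by (rule anticommuting_v0)

definition psi0 :: "'f mpoly ext \<Rightarrow> 'f mpoly fract ext" where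
  "psi0 \<omega> = (\<Sum>A\<in>Pow {1..m}. ext_scalar (h0 (ext_coeff \<omega> A)) * v0.w A)"

lemma psi0_add: "psi0 (x + y) = psi0 x + psi0 y"
  by (simp add: psi0_def ext_coeff_add h0_simps ext_scalar_add distrib_right sum.distrib)

lemma psi0_scalar: "psi0 (ext_scalar p) = ext_scalar (h0 p)"
proof -
  have "psi0 (ext_scalar p) = (\<Sum>A\<in>Pow {1..m}. if A = {} then ext_scalar (h0 p) else 0)"
    unfolding psi0_def by (rule sum.cong) (auto simp: ext_scalar.rep_eq h0_simps)
  then show ?thesis by simp
qed

lemma psi0_gen:
  assumes "i \<in> {1..m}"
  shows "psi0 (ext_gen i) = v0 i"
proof -
  have "psi0 (ext_gen i) = (\<Sum>A\<in>Pow {1..m}. if A = {i} then v0 i else 0)"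
    unfolding psi0_def
    by (rule sum.cong) (auto simp: ext_gen.rep_eq h0_simps v0.w_def)
  then show ?thesis using assms by simp
qed

lemma psi0_mult: "psi0 (x * y) = psi0 x * psi0 y"
proof -
  let ?V = "Pow {1..m}"
  let ?g = "\<lambda>A B. (ext_scalar (h0 (ext_coeff x A)) * v0.w A) * (ext_scalar (h0 (ext_coeff y B)) * v0.w B)"
  have fin: "finite A" if "A \<in> ?V" for A using that finite_subset by auto
  have g: "?g A B = ext_scalar (h0 (ext_coeff x A)) *
      (ext_scalar (h0 (ext_coeff y B)) * (v0.w A * v0.w B))" for A B
    by (simp only: mult.assoc ext_scalar_left_commute[of "v0.w A"])
  have "psi0 (x * y) = (\<Sum>S\<in>?V. \<Sum>A\<in>Pow S. ?g A (S - A))"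
    unfolding psi0_def
  proof (rule sum.cong[OF refl])
    fix S assume S: "S \<in> ?V"
    have "ext_scalar (h0 (ext_coeff (x * y) S)) * v0.w S =
        (\<Sum>A\<in>Pow S. ext_scalar (ext_sign A (S - A) * h0 (ext_coeff x A) * h0 (ext_coeff y (S - A))) * v0.w S)"
      by (simp only: times_ext.rep_eq h0_simps ext_scalar_sum sum_distrib_right)
    also have "\<dots> = (\<Sum>A\<in>Pow S. ?g A (S - A))"
    proof (rule sum.cong[OF refl])
      fix A assume "A \<in> Pow S"
      then have "v0.w A * v0.w (S - A) = ext_scalar (ext_sign A (S - A)) * v0.w S"
        using v0.w_mult[of A "S - A"] fin[OF S] finite_subset[of A S]
        by (auto simp: Un_absorb1)
      then show "ext_scalar (ext_sign A (S - A) * h0 (ext_coeff x A) * h0 (ext_coeff y (S - A))) * v0.w S =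
          ?g A (S - A)"
        unfolding g by (intro ext_eqI) (simp add: ac_simps)
    qed
    finally show "ext_scalar (h0 (ext_coeff (x * y) S)) * v0.w S = (\<Sum>A\<in>Pow S. ?g A (S - A))" .
  qed
  also have "\<dots> = (\<Sum>(S, A)\<in>(SIGMA S:?V. Pow S). ?g A (S - A))"
    by (rule sum.Sigma) (use fin in auto)
  also have "\<dots> = (\<Sum>(A, B)\<in>{(A, B). A \<in> ?V \<and> B \<in> ?V \<and> A \<inter> B = {}}. ?g A B)"
    by (rule sum.reindex_bij_witness[where
        i = "\<lambda>(A, B). (A \<union> B, A)" and j = "\<lambda>(S, A). (A, S - A)"]) auto
  also have "\<dots> = (\<Sum>(A, B)\<in>?V \<times> ?V. ?g A B)"
  proof (rule sum.mono_neutral_left)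
    show "\<forall>p\<in>?V \<times> ?V - {(A, B). A \<in> ?V \<and> B \<in> ?V \<and> A \<inter> B = {}}. (case p of (A, B) \<Rightarrow> ?g A B) = 0"
    proof
      fix p assume "p \<in> ?V \<times> ?V - {(A, B). A \<in> ?V \<and> B \<in> ?V \<and> A \<inter> B = {}}"
      then obtain A B where p: "p = (A, B)" "A \<in> ?V" "B \<in> ?V" "A \<inter> B \<noteq> {}" by auto
      then have "v0.w A * v0.w B = 0" using v0.w_mult[OF fin fin, of A B] by simp
      then show "(case p of (A, B) \<Rightarrow> ?g A B) = 0" unfolding p(1) prod.case g by simp
    qed
  qed auto
  also have "\<dots> = psi0 x * psi0 y"
    unfolding psi0_def sum_product by (rule sum.cartesian_product[symmetric])
  finally show ?thesis .
qed

lemma v0_in_carrier: "i \<in> {1..m} \<Longrightarrow> v0 i \<in> carrier (loc_form_ring n m c)"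
  unfolding v0_def
  by (intro loc_form_mult[OF z_nonzero] loc_form_scalar[OF z_nonzero] loc_poly_inverse[OF z_nonzero]
      loc_form_of_form[OF z_nonzero] d_lin_form_in_forms_on)

lemma psi0_in_carrier:
  assumes "\<omega> \<in> forms_on {1..m}"
  shows "psi0 \<omega> \<in> carrier (loc_form_ring n m c)"
  unfolding psi0_def
proof (rule loc_form_sum[OF z_nonzero])
  fix A assume A: "A \<in> Pow {1..m}"
  then have "finite A" using finite_subset by auto
  have "v0.w A \<in> carrier (loc_form_ring n m c)"
    unfolding v0.w_def
  proof (rule loc_form_prod_list[OF z_nonzero])
    fix x assume "x \<in> set (map v0 (sorted_list_of_set A))"
    then show "x \<in> carrier (loc_form_ring n m c)"
      using A \<open>finite A\<close> by (auto intro!: v0_in_carrier)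
  qed
  moreover have "ext_scalar (h0 (ext_coeff \<omega> A)) \<in> carrier (loc_form_ring n m c)"
    using assms unfolding forms_on_def
    by (intro loc_form_scalar[OF z_nonzero] h0_in_carrier) blast+
  ultimately show "ext_scalar (h0 (ext_coeff \<omega> A)) * v0.w A \<in> carrier (loc_form_ring n m c)"
    by (intro loc_form_mult[OF z_nonzero])
qed

lemma exists_psi:
  "\<exists>\<psi>. \<psi> \<in> ring_hom (form_ring {1..m}) (loc_form_ring n m c) \<and>
     (\<forall>a. \<psi> (ext_scalar (Cst a)) = ext_scalar (to_fract (Cst a))) \<and>
     (\<forall>i\<in>{1..m}. \<psi> (ext_scalar (Var i)) = ext_scalar (inverse (to_fract (lin_form n (c i))))) \<and>
     (\<forall>i\<in>{1..m}. \<psi> (ext_gen i) =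
        ext_scalar (inverse (to_fract (lin_form n (c i)))) * ext_fract (d_lin_form n (c i)))"
proof (intro exI conjI)
  show "psi0 \<in> ring_hom (form_ring {1..m}) (loc_form_ring n m c)"
  proof (rule ring_hom_memI)
    fix \<omega> :: "'f mpoly ext" assume "\<omega> \<in> carrier (form_ring {1..m})"
    then show "psi0 \<omega> \<in> carrier (loc_form_ring n m c)"
      by (intro psi0_in_carrier) (simp add: form_ring_def)
  next
    show "psi0 \<one>\<^bsub>form_ring {1..m}\<^esub> = \<one>\<^bsub>loc_form_ring n m c\<^esub>"
      using psi0_scalar[of 1] by (simp add: form_ring_def loc_form_ring_def h0_simps)
  qed (simp_all add: form_ring_def loc_form_ring_def psi0_add psi0_mult)
qed (simp_all add: psi0_scalar h0_simps psi0_gen v0_def)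

end

end

theory Submission
  imports Defs
begin

text \<open>
  Call \<open>N \<subseteq> {1..m}\<close> an nbc set if no \<open>z\<^sub>j\<close> lies in the span of the \<open>z\<^sub>i\<close> with \<open>i \<in> N\<close>, \<open>i < j\<close>;
  this means that \<open>N\<close> contains no \<open>|L| - {max |L|}\<close> for a minimal relation \<open>L\<close>.  Using \<open>P\<^bsub>L,S\<^esub>\<close>, a
  monomial \<open>t\<^sup>\<mu> u\<^sub>S\<close> for which \<open>S \<union> supp \<mu>\<close> contains such a set is congruent to a combination
  of monomials in which indices have been replaced by larger ones.  Hence modulo the \<open>P\<^bsub>L,S\<^esub>\<close> every
  element of \<open>\<Xi>\<close> is a combination of monomials with \<open>S \<union> supp \<mu>\<close> nbc.  The images
  \<open>z\<^sup>-\<^sup>\<beta> dz\<^sub>S\<close> of these, where \<open>S \<subseteq> supp \<beta>\<close> nbc, are linearly independent: by partial fractions the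
  coefficient of each \<open>z\<^sup>-\<^sup>\<beta>\<close> in \<open>\<Lambda>[dx]\<close> vanishes, and for a fixed \<open>\<beta>\<close> the \<open>dz\<^sub>S\<close> are independent
  because the \<open>z\<^sub>i\<close>, \<open>i \<in> supp \<beta>\<close>, are.  So the \<open>P\<^bsub>L,S\<^esub>\<close> generate \<open>K\<close>, and the projection of \<open>\<Xi>\<close> to
  its part of degree \<open>0\<close> in the \<open>u\<^sub>i\<close>, which kills \<open>P\<^bsub>L,S\<^esub>\<close> for \<open>S \<noteq> {}\<close>, gives the generators of \<open>I\<close>.
\<close>

section \<open>Partial fractions of products of linear forms\<close>

lemma Cst_eq_0_iff [simp]: "Cst a = 0 \<longleftrightarrow> a = 0"
  by (simp add: Cst_def flip: keys_eq_empty)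

lemma Cst_uminus: "Cst (- a) = - Cst a"
  by (simp add: Cst_def single_uminus)

lemma Cst_diff: "Cst (a - b) = Cst a - Cst b"
  using Cst_add[of a "- b"] by (simp add: Cst_uminus)

lemma Cst_sum: "Cst (sum f A) = (\<Sum>i\<in>A. Cst (f i))"
  by (induction A rule: infinite_finite_induct) (simp_all add: Cst_add)

text \<open>
  Nbc sets by spans rather than by circuits: this formulation survives the projection along a
  member of \<open>N\<close>.
\<close>

definition nbc :: "nat \<Rightarrow> (nat \<Rightarrow> nat \<Rightarrow> 'f::field) \<Rightarrow> nat set \<Rightarrow> nat set \<Rightarrow> bool" where
  "nbc n z I N \<longleftrightarrow>
     (\<forall>j\<in>I. \<forall>b. lin_form n (z j) \<noteq> (\<Sum>i | i \<in> N \<and> i < j. Cst (b i) * lin_form n (z i)))"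

lemma nbc_nonzero: "nbc n z I N \<Longrightarrow> j \<in> I \<Longrightarrow> lin_form n (z j) \<noteq> 0"
  unfolding nbc_def by (force dest: bspec spec[of _ "\<lambda>_. 0"])

lemma nbc_mono: "nbc n z I N \<Longrightarrow> J \<subseteq> I \<Longrightarrow> nbc n z J N"
  unfolding nbc_def by blast

text \<open>Projection along \<open>u\<close>: if \<open>u p \<noteq> 0\<close>, the multiple of
  \<open>u\<close> that cancels the \<open>p\<close>-th coordinate of \<open>b\<close> is
  subtracted; if \<open>u p = 0\<close>, division by zero leaves \<open>b\<close> unchanged.\<close>

definition proj :: "nat \<Rightarrow> (nat \<Rightarrow> 'f::field) \<Rightarrow> (nat \<Rightarrow> 'f) \<Rightarrow> nat \<Rightarrow> 'f" where
  "proj p u b = (\<lambda>k. b k - b p / u p * u k)"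

lemma lin_form_proj:
  "lin_form n (proj p u b) = lin_form n b - Cst (b p / u p) * lin_form n u"
  by (simp add: lin_form_def proj_def Cst_diff left_diff_distrib sum_subtractf sum_distrib_left
      flip: mult.assoc Cst_mult)

text \<open>A combination giving the projected z_j from projected z_i with i < j lifts to one for
  z_j that uses z_a in addition. As a < j for every j in \<open>J\<close>, the lift contradicts the
  nbc property of \<open>N\<close>.\<close>

lemma nbc_proj:
  fixes z :: "nat \<Rightarrow> nat \<Rightarrow> 'f::field"
  assumes "nbc n z I N" "a \<in> N" "J \<subseteq> {j\<in>I. a < j}"
  shows "nbc n (\<lambda>i. proj p (z a) (z i)) J (N - {a})"
  unfolding nbc_def
proof (intro ballI allI notI)
  fix j and b :: "nat \<Rightarrow> 'f"
  let ?g = "\<lambda>i. lin_form n (z i)"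
  define f where "f i = z i p / z a p" for i
  assume j: "j \<in> J" and eq: "lin_form n (proj p (z a) (z j)) =
    (\<Sum>i | i \<in> N - {a} \<and> i < j. Cst (b i) * lin_form n (proj p (z a) (z i)))"
  let ?N = "{i. i \<in> N - {a} \<and> i < j}"
  \<comment> \<open>The multiples of z_a removed by the projection are collected in
    \<open>s\<close>, the coefficient of z_a in the lifted combination.\<close>
  define s where "s = f j - (\<Sum>i\<in>?N. b i * f i)"
  have aj: "a < j" "j \<in> I" using j assms by auto
  have "?g j = Cst (f j) * ?g a + (\<Sum>i\<in>?N. Cst (b i) * (?g i - Cst (f i) * ?g a))"
    using eq unfolding lin_form_proj f_def[symmetric] by (simp add: algebra_simps)
  also have "\<dots> = Cst s * ?g a + (\<Sum>i\<in>?N. Cst (b i) * ?g i)"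
    by (simp add: s_def Cst_diff Cst_sum Cst_mult right_diff_distrib left_diff_distrib
        sum_subtractf sum_distrib_right mult.assoc)
  also have "\<dots> = Cst ((b(a := s)) a) * ?g a + (\<Sum>i\<in>?N. Cst ((b(a := s)) i) * ?g i)"
    by (intro arg_cong2[of _ _ _ _ "(+)"] sum.cong) auto
  also have "\<dots> = (\<Sum>i\<in>insert a ?N. Cst ((b(a := s)) i) * ?g i)"
    by (subst sum.insert) auto
  also have "insert a ?N = {i. i \<in> N \<and> i < j}" using aj assms by auto
  finally show False using assms(1) aj unfolding nbc_def by blast
qed

text \<open>The substitution for \<open>x\<^sub>p\<close> that restricts polynomials to the hyperplane \<open>u = 0\<close>.\<close>

definition eliminate :: "nat \<Rightarrow> nat \<Rightarrow> (nat \<Rightarrow> 'f::field) \<Rightarrow> 'f mpoly \<Rightarrow> 'f mpoly" where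
  "eliminate n p u =
     poly_eval Cst (\<lambda>k. Var k - (if k = p then Cst (inverse (u p)) * lin_form n u else 0))"

lemma eliminate_hom:
  "eliminate n p u (x + y) = eliminate n p u x + eliminate n p u y"
  "eliminate n p u (x * y) = eliminate n p u x * eliminate n p u y"
  "eliminate n p u 0 = 0" "eliminate n p u 1 = 1"
  "eliminate n p u (sum f A) = (\<Sum>i\<in>A. eliminate n p u (f i))"
  "eliminate n p u (Cst a) = Cst a"
  unfolding eliminate_def
  by (simp_all add: poly_eval_add poly_eval_mult poly_eval_0 poly_eval_1 poly_eval_sum
      poly_eval_Cst Cst_add Cst_mult)

lemma eliminate_power: "eliminate n p u (x ^ k) = eliminate n p u x ^ k"
  by (induction k) (simp_all add: eliminate_hom)

lemma eliminate_prod: "eliminate n p u (prod f A) = (\<Prod>i\<in>A. eliminate n p u (f i))"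
  by (induction A rule: infinite_finite_induct) (simp_all add: eliminate_hom)

text \<open>For u_p \<noteq> 0, replacing x_p by x_p - u/u_p subtracts (b_p/u_p) u from b, so
  restriction to the hyperplane u = 0 acts on linear forms as \<open>proj\<close>.\<close>

lemma eliminate_lin_form:
  assumes "p \<in> {1..n}"
  shows "eliminate n p u (lin_form n b) = lin_form n (proj p u b)"
proof -
  have var: "eliminate n p u (Var k) = Var k - (if k = p then Cst (inverse (u p)) * lin_form n u else 0)" for k
    unfolding eliminate_def by (simp add: poly_eval_Var Cst_add Cst_mult)
  have "eliminate n p u (lin_form n b) =
      lin_form n b - (\<Sum>k=1..n. if k = p then Cst (b k) * (Cst (inverse (u p)) * lin_form n u) else 0)"
    unfolding lin_form_def[of n b] eliminate_hom var sum_subtractf[symmetric]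
    by (intro sum.cong refl) (auto simp: right_diff_distrib)
  also have "\<dots> = lin_form n (proj p u b)"
    using assms by (simp add: lin_form_proj Cst_mult divide_inverse mult.assoc)
  finally show ?thesis .
qed

lemma lin_form_nonzero_coeff:
  assumes "lin_form n u \<noteq> 0"
  obtains p where "p \<in> {1..n}" "u p \<noteq> 0"
proof -
  have "lin_form n u = 0" if "\<forall>p\<in>{1..n}. u p = 0"
    using that unfolding lin_form_def by (intro sum.neutral) simp
  then show ?thesis using assms that by blast
qed

text \<open>
  Partial fractions: multiplying by the highest power of the first form \<open>z\<^sub>a\<close> that occurs as a
  pole and restricting to \<open>z\<^sub>a = 0\<close> leaves a relation of the same kind with fewer forms.
\<close>

lemma nbc_monomials_independent:
  fixes z :: "nat \<Rightarrow> nat \<Rightarrow> 'f::field" and e :: "'b \<Rightarrow> nat \<Rightarrow> nat"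
  assumes "finite I" "finite B"
    and "\<And>\<beta>. \<beta> \<in> B \<Longrightarrow> nbc n z I {i\<in>I. e \<beta> i \<noteq> 0}"
    and "\<And>\<beta> i. \<beta> \<in> B \<Longrightarrow> i \<in> I \<Longrightarrow> e \<beta> i \<le> K"
    and "\<And>\<beta> \<gamma>. \<beta> \<in> B \<Longrightarrow> \<gamma> \<in> B \<Longrightarrow> \<forall>i\<in>I. e \<beta> i = e \<gamma> i \<Longrightarrow> \<beta> = \<gamma>"
    and "(\<Sum>\<beta>\<in>B. Cst (c \<beta>) * (\<Prod>i\<in>I. lin_form n (z i) ^ (K - e \<beta> i))) = 0"
  shows "\<forall>\<beta>\<in>B. c \<beta> = 0"
  using assms
proof (induction I arbitrary: B z rule: finite_linorder_min_induct)
  case empty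
  show ?case
  proof
    fix \<beta> assume "\<beta> \<in> B"
    then have "B = {\<beta>}" using empty.prems(4) by blast
    then show "c \<beta> = 0" using empty.prems(5) by simp
  qed
next
  case (insert a I)
  define B' where "B' = {\<beta>\<in>B. c \<beta> \<noteq> 0}"
  have B': "finite B'" "B' \<subseteq> B" using insert.prems(1) by (auto simp: B'_def)
  have "B' = {}"
  proof (rule ccontr)
    assume ne: "B' \<noteq> {}"
    \<comment> \<open>\<open>K\<close> clears denominators: the given relation is one between the
      products of the z_i^(-e \<beta> i), multiplied by all z_i^K. So \<open>k\<close> is the
      highest pole order along z_a among the terms with non-zero coefficient.\<close>
    define k where "k = Max ((\<lambda>\<beta>. e \<beta> a) ` B')"
    have le_k: "e \<beta> a \<le> k" if "\<beta> \<in> B'" for \<beta>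
      using that B' unfolding k_def by (intro Max_ge) auto
    have "k \<in> (\<lambda>\<beta>. e \<beta> a) ` B'" unfolding k_def by (rule Max_in) (use B' ne in auto)
    then obtain \<beta>0 where \<beta>0: "\<beta>0 \<in> B'" "e \<beta>0 a = k" by auto
    let ?g = "\<lambda>i. lin_form n (z i)"
    let ?r = "\<lambda>\<beta>. \<Prod>i\<in>I. ?g i ^ (K - e \<beta> i)"
    have kK: "k \<le> K" using \<beta>0 insert.prems(3)[of \<beta>0 a] B' by auto
    have za: "?g a \<noteq> 0" using nbc_nonzero[OF insert.prems(2)[of \<beta>0], of a] \<beta>0 B' by auto
    have aI: "a \<notin> I" using insert.hyps by blast
    have "0 = (\<Sum>\<beta>\<in>B'. Cst (c \<beta>) * (\<Prod>i\<in>insert a I. ?g i ^ (K - e \<beta> i)))"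
      unfolding insert.prems(5)[symmetric]
      by (rule sum.mono_neutral_right) (use insert.prems(1) in \<open>auto simp: B'_def\<close>)
    also have "\<dots> = (\<Sum>\<beta>\<in>B'. ?g a ^ (K - k) * (Cst (c \<beta>) * (?g a ^ (k - e \<beta> a) * ?r \<beta>)))"
    proof (rule sum.cong[OF refl])
      fix \<beta> assume "\<beta> \<in> B'"
      then have "K - e \<beta> a = (K - k) + (k - e \<beta> a)" using le_k[of \<beta>] kK by simp
      then have "?g a ^ (K - e \<beta> a) = ?g a ^ (K - k) * ?g a ^ (k - e \<beta> a)"
        by (simp only: power_add)
      then show "Cst (c \<beta>) * (\<Prod>i\<in>insert a I. ?g i ^ (K - e \<beta> i)) =
          ?g a ^ (K - k) * (Cst (c \<beta>) * (?g a ^ (k - e \<beta> a) * ?r \<beta>))"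
        using aI insert.hyps by (simp add: ac_simps)
    qed
    also have "\<dots> = ?g a ^ (K - k) * (\<Sum>\<beta>\<in>B'. Cst (c \<beta>) * (?g a ^ (k - e \<beta> a) * ?r \<beta>))"
      by (simp add: sum_distrib_left)
    finally have red: "(\<Sum>\<beta>\<in>B'. Cst (c \<beta>) * (?g a ^ (k - e \<beta> a) * ?r \<beta>)) = 0"
      using za by simp
    have inj: "\<beta> = \<gamma>" if "\<beta> \<in> B'" "\<gamma> \<in> B'" "e \<beta> a = e \<gamma> a" "\<forall>i\<in>I. e \<beta> i = e \<gamma> i" for \<beta> \<gamma>
      using insert.prems(4)[of \<beta> \<gamma>] that B' by auto
    show False
    proof (cases "k = 0")
      case True
      \<comment> \<open>There is no pole along z_a, so the relation is already one for the smaller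
        index set \<open>I\<close>.\<close>
      then have e0: "e \<beta> a = 0" if "\<beta> \<in> B'" for \<beta> using le_k[OF that] by simp
      have "\<forall>\<beta>\<in>B'. c \<beta> = 0"
      proof (rule insert.IH)
        fix \<beta> assume \<beta>: "\<beta> \<in> B'"
        then have "{i\<in>insert a I. e \<beta> i \<noteq> 0} = {i\<in>I. e \<beta> i \<noteq> 0}" using e0 by auto
        then show "nbc n z I {i\<in>I. e \<beta> i \<noteq> 0}"
          using insert.prems(2)[of \<beta>] \<beta> B' by (auto intro: nbc_mono)
      next
        show "(\<Sum>\<beta>\<in>B'. Cst (c \<beta>) * ?r \<beta>) = 0" using red True by simp
      qed (use B' insert.prems e0 inj in auto)
      then show False using \<beta>0 by (auto simp: B'_def)
    next
      case False
      obtain p where p: "p \<in> {1..n}" "z a p \<noteq> 0" using za by (rule lin_form_nonzero_coeff)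
      let ?\<sigma> = "eliminate n p (z a)" and ?z = "\<lambda>i. proj p (z a) (z i)"
      let ?C = "{\<beta>\<in>B'. e \<beta> a = k}"
      have \<sigma>a: "?\<sigma> (?g a) = 0"
        using p by (simp add: eliminate_lin_form lin_form_proj)
      have "0 = ?\<sigma> (\<Sum>\<beta>\<in>B'. Cst (c \<beta>) * (?g a ^ (k - e \<beta> a) * ?r \<beta>))"
        by (simp add: red eliminate_hom)
      \<comment> \<open>On z_a = 0 the factor z_a^(k - e \<beta> a) becomes 1 if the pole order is
        \<open>k\<close> and 0 otherwise, so exactly the terms in \<open>?C\<close> survive.\<close>
      also have "\<dots> = (\<Sum>\<beta>\<in>B'. Cst (c \<beta>) * (0 ^ (k - e \<beta> a) *
          (\<Prod>i\<in>I. lin_form n (?z i) ^ (K - e \<beta> i))))"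
        by (simp add: eliminate_hom eliminate_power eliminate_prod \<sigma>a)
          (simp add: eliminate_lin_form[OF p(1)])
      also have "\<dots> = (\<Sum>\<beta>\<in>?C. Cst (c \<beta>) * (0 ^ (k - e \<beta> a) *
          (\<Prod>i\<in>I. lin_form n (?z i) ^ (K - e \<beta> i))))"
      proof (rule sum.mono_neutral_right)
        show "\<forall>\<beta>\<in>B' - ?C. Cst (c \<beta>) * (0 ^ (k - e \<beta> a) *
            (\<Prod>i\<in>I. lin_form n (?z i) ^ (K - e \<beta> i))) = 0"
        proof
          fix \<beta> assume \<beta>: "\<beta> \<in> B' - ?C"
          then have "k - e \<beta> a \<noteq> 0" using le_k[of \<beta>] by auto
          then show "Cst (c \<beta>) * (0 ^ (k - e \<beta> a) *
              (\<Prod>i\<in>I. lin_form n (?z i) ^ (K - e \<beta> i))) = 0"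
            by (simp add: power_0_left)
        qed
      qed (use B' in auto)
      also have "\<dots> = (\<Sum>\<beta>\<in>?C. Cst (c \<beta>) * (\<Prod>i\<in>I. lin_form n (?z i) ^ (K - e \<beta> i)))"
        by (rule sum.cong) auto
      finally have sum0: "(\<Sum>\<beta>\<in>?C. Cst (c \<beta>) * (\<Prod>i\<in>I. lin_form n (?z i) ^ (K - e \<beta> i))) = 0"
        by simp
      have "\<forall>\<beta>\<in>?C. c \<beta> = 0"
      proof (rule insert.IH)
        fix \<beta> assume \<beta>: "\<beta> \<in> ?C"
        then have "{i\<in>I. e \<beta> i \<noteq> 0} = {i\<in>insert a I. e \<beta> i \<noteq> 0} - {a}" using aI by auto
        \<comment> \<open>The induction adds \<open>a\<close> as the least index, so all of
          \<open>I\<close> lies above it, as \<open>nbc_proj\<close> requires.\<close>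
        moreover have "nbc n ?z I ({i\<in>insert a I. e \<beta> i \<noteq> 0} - {a})"
          using insert.prems(2)[of \<beta>] \<beta> B' False insert.hyps by (intro nbc_proj) auto
        ultimately show "nbc n ?z I {i\<in>I. e \<beta> i \<noteq> 0}" by simp
      qed (use B' insert.prems inj sum0 in auto)
      then show False using \<beta>0 by (auto simp: B'_def)
    qed
  qed
  then show ?case by (auto simp: B'_def)
qed

section \<open>Exterior products of linear forms\<close>

lemma ext_coeff_sum: "ext_coeff (sum f A) S = (\<Sum>i\<in>A. ext_coeff (f i) S)"
  by (induction A rule: infinite_finite_induct) (simp_all add: ext_coeff_add)

lemma ext_sign_nonzero [simp]: "ext_sign A B \<noteq> (0 :: 'a::idom)"
  by (simp add: ext_sign_def)

definition wedge :: "(nat \<Rightarrow> 'b::comm_ring_1 ext) \<Rightarrow> nat set \<Rightarrow> 'b ext" where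
  "wedge v S = prod_list (map v (sorted_list_of_set S))"

lemma wedge_empty [simp]: "wedge v {} = 1"
  by (simp add: wedge_def)

context anticommuting
begin

lemma w_eq_wedge: "w = wedge v"
  by (simp add: fun_eq_iff w_def wedge_def)

lemmas wedge_insert_less = w_insert_less[unfolded w_eq_wedge]
lemmas wedge_mult = w_mult[unfolded w_eq_wedge]

text \<open>Moving v_a past the other factors costs only signs, and wherever it meets a multiple of
  itself the product vanishes. In a product containing dz_a the remaining forms may thus be replaced
  by their projections along z_a.\<close>

lemma mult_prod_list_shift:
  "v a * prod_list (map (\<lambda>i. v i + ext_scalar (l i) * v a) js) = v a * prod_list (map v js)"
proof (induction js)
  case (Cons j js)
  let ?P = "prod_list (map (\<lambda>i. v i + ext_scalar (l i) * v a) js)"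
  have "v a * (ext_scalar (l j) * v a) = 0"
    by (simp add: ext_scalar_left_commute square)
  then have "v a * (v j + ext_scalar (l j) * v a) = - (v j * v a)"
    by (simp add: distrib_left anticommute[of a j])
  then have "v a * ((v j + ext_scalar (l j) * v a) * ?P) = - (v j * (v a * ?P))"
    by (simp flip: mult.assoc)
  also have "\<dots> = v a * (v j * prod_list (map v js))"
    unfolding Cons.IH by (simp add: anticommute[of a j] flip: mult.assoc)
  finally show ?case by simp
qed simp

end

text \<open>The form dz with coefficients in F instead of F[x]: the dz_i have constant coefficients,
  so the independence of their products can be treated over the field.\<close>

definition dform :: "nat \<Rightarrow> (nat \<Rightarrow> 'f::field) \<Rightarrow> 'f ext" where
  "dform n u = (\<Sum>k=1..n. ext_scalar (u k) * ext_gen k)"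

lemma anticommuting_dform: "anticommuting (\<lambda>i. dform n (z i))"
  using anticommuting_gen_multiples[of z "\<lambda>_. {1..n}"] unfolding dform_def .

lemma dform_proj: "dform n b = dform n (proj p u b) + ext_scalar (b p / u p) * dform n u"
proof (rule ext_eqI)
  fix S
  show "ext_coeff (dform n b) S =
      ext_coeff (dform n (proj p u b) + ext_scalar (b p / u p) * dform n u) S"
    by (simp add: dform_def proj_def ext_coeff_sum ext_coeff_add sum_distrib_left
        left_diff_distrib mult.assoc flip: sum.distrib)
qed

lemma ext_coeff_dform:
  "ext_coeff (dform n u) S = (\<Sum>k=1..n. if S = {k} then u k else 0)"
  by (auto simp: dform_def ext_coeff_sum ext_gen.rep_eq intro: sum.cong)

text \<open>In every splitting of \<open>S\<close> between the first factor and the others, the part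
  containing \<open>p\<close> has coefficient 0.\<close>

lemma wedge_free_of_gen:
  assumes "\<And>i. i \<in> set js \<Longrightarrow> u i p = 0" "p \<in> S"
  shows "ext_coeff (prod_list (map (\<lambda>i. dform n (u i)) js)) S = 0"
  using assms
proof (induction js arbitrary: S)
  case Nil
  then show ?case by (auto simp: one_ext.rep_eq)
next
  case (Cons j js)
  have "ext_coeff (dform n (u j)) A * ext_coeff (prod_list (map (\<lambda>i. dform n (u i)) js)) (S - A) = 0"
    if "A \<subseteq> S" for A
  proof (cases "p \<in> A")
    case True
    then have "ext_coeff (dform n (u j)) A = 0"
      unfolding ext_coeff_dform using Cons.prems(1)[of j] by (intro sum.neutral) auto
    then show ?thesis by simp
  next
    case False
    then show ?thesis using Cons that by simp
  qed
  then show ?case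
    unfolding list.map prod_list.Cons times_ext.rep_eq mult.assoc by (intro sum.neutral) simp
qed

text \<open>Induction removing the least index a. Projecting the other forms along z_a clears dx_p
  from them without changing the product with dz_a. Their product has a non-zero coefficient at some
  T, which avoids p; at T \<union> {p} the whole product has this coefficient times that of dx_p in
  dz_a, up to sign.\<close>

lemma wedge_dform_nonzero:
  fixes z :: "nat \<Rightarrow> nat \<Rightarrow> 'f::field"
  assumes "finite N" "nbc n z N N"
  shows "wedge (\<lambda>i. dform n (z i)) N \<noteq> 0"
  using assms
proof (induction N arbitrary: z rule: finite_linorder_min_induct)
  case (insert a N)
  interpret v: anticommuting "\<lambda>i. dform n (z i)" by (rule anticommuting_dform)
  have aN: "a \<notin> N" using insert.hyps by blast
  have "lin_form n (z a) \<noteq> 0" using nbc_nonzero[OF insert.prems, of a] by simp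
  then obtain p where p: "p \<in> {1..n}" "z a p \<noteq> 0" by (rule lin_form_nonzero_coeff)
  let ?z = "\<lambda>i. proj p (z a) (z i)"
  have z0: "?z i p = 0" for i using p by (simp add: proj_def)
  let ?w = "wedge (\<lambda>i. dform n (?z i)) N"
  have "nbc n ?z N (insert a N - {a})"
    using insert by (intro nbc_proj[OF insert.prems]) auto
  then have "?w \<noteq> 0" using insert.IH aN by simp
  then obtain T where T: "ext_coeff ?w T \<noteq> 0" by (metis ext_coeff_zero ext_eqI)
  have w0: "ext_coeff ?w S = 0" if "p \<in> S" for S
    unfolding wedge_def using that z0 by (intro wedge_free_of_gen) auto
  have pT: "p \<notin> T" "finite T" using T w0 ext_coeff_infinite by blast+
  have shift: "dform n (?z i) = dform n (z i) + ext_scalar (- (z i p / z a p)) * dform n (z a)" for i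
    using dform_proj[of n "z i" p "z a"] by (simp add: ext_scalar_uminus)
  have "dform n (z a) * ?w = dform n (z a) * wedge (\<lambda>i. dform n (z i)) N"
    unfolding wedge_def shift by (rule v.mult_prod_list_shift)
  also have "\<dots> = wedge (\<lambda>i. dform n (z i)) (insert a N)"
    using insert.hyps by (intro v.wedge_insert_less[symmetric]) auto
  finally have eq: "wedge (\<lambda>i. dform n (z i)) (insert a N) = dform n (z a) * ?w" ..
  have "ext_coeff (dform n (z a) * ?w) (insert p T) =
      (\<Sum>A\<in>Pow (insert p T). ext_sign A (insert p T - A) * ext_coeff (dform n (z a)) A *
        ext_coeff ?w (insert p T - A))"
    by (simp add: times_ext.rep_eq)
  \<comment> \<open>\<open>?w\<close> is free of dx_p, so p must lie in \<open>A\<close>; as dz_a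
    has degree 1, only \<open>A = {p}\<close> contributes.\<close>
  also have "\<dots> = (\<Sum>A\<in>{{p}}. ext_sign A (insert p T - A) * ext_coeff (dform n (z a)) A *
        ext_coeff ?w (insert p T - A))"
  proof (rule sum.mono_neutral_right)
    show "\<forall>A\<in>Pow (insert p T) - {{p}}. ext_sign A (insert p T - A) *
        ext_coeff (dform n (z a)) A * ext_coeff ?w (insert p T - A) = 0"
    proof
      fix A assume A: "A \<in> Pow (insert p T) - {{p}}"
      show "ext_sign A (insert p T - A) * ext_coeff (dform n (z a)) A *
        ext_coeff ?w (insert p T - A) = 0"
      proof (cases "p \<in> A")
        case True
        then have "ext_coeff (dform n (z a)) A = 0"
          unfolding ext_coeff_dform using A by (intro sum.neutral) auto
        then show ?thesis by simp
      next
        case False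
        then show ?thesis using w0[of "insert p T - A"] by simp
      qed
    qed
  qed (use pT in auto)
  also have "\<dots> = ext_sign {p} T * z a p * ext_coeff ?w T"
  proof -
    have "insert p T - {p} = T" using pT by auto
    moreover have "ext_coeff (dform n (z a)) {p} = z a p"
      unfolding ext_coeff_dform using p by simp
    ultimately show ?thesis by simp
  qed
  finally show ?case using T p by (auto simp: eq)
qed simp

text \<open>Multiplication by \<open>dz\<^bsub>N - S\<^esub>\<close> isolates a minimal \<open>S\<close> in the relation.\<close>

lemma wedge_dform_independent:
  fixes z :: "nat \<Rightarrow> nat \<Rightarrow> 'f::field"
  assumes "finite N" "nbc n z N N" "finite Q" "inj_on \<sigma> Q" "\<And>q. q \<in> Q \<Longrightarrow> \<sigma> q \<subseteq> N"
    and "(\<Sum>q\<in>Q. ext_scalar (c q) * wedge (\<lambda>i. dform n (z i)) (\<sigma> q)) = 0"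
  shows "\<forall>q\<in>Q. c q = 0"
proof (rule ccontr)
  interpret v: anticommuting "\<lambda>i. dform n (z i)" by (rule anticommuting_dform)
  let ?w = "wedge (\<lambda>i. dform n (z i))"
  assume "\<not> ?thesis"
  then obtain q1 where "q1 \<in> Q \<and> c q1 \<noteq> 0" by blast
  then obtain q0 where q0: "q0 \<in> Q" "c q0 \<noteq> 0"
    and min: "\<And>q. q \<in> Q \<Longrightarrow> c q \<noteq> 0 \<Longrightarrow> card (\<sigma> q0) \<le> card (\<sigma> q)"
    using ex_has_least_nat[of "\<lambda>q. q \<in> Q \<and> c q \<noteq> 0" q1 "\<lambda>q. card (\<sigma> q)"] by blast
  define R where "R = N - \<sigma> q0"
  have fin: "finite (\<sigma> q)" if "q \<in> Q" for q using assms(1,5) that finite_subset by blast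
  have R: "finite R" "\<sigma> q0 \<inter> R = {}" "\<sigma> q0 \<union> R = N" using assms(1,5) q0 by (auto simp: R_def)
  have "0 = (\<Sum>q\<in>Q. ext_scalar (c q) * ?w (\<sigma> q)) * ?w R" by (simp add: assms)
  also have "\<dots> = (\<Sum>q\<in>Q. ext_scalar (c q) * (?w (\<sigma> q) * ?w R))"
    by (simp add: sum_distrib_right mult.assoc)
  also have "\<dots> = (\<Sum>q\<in>{q0}. ext_scalar (c q) * (?w (\<sigma> q) * ?w R))"
  proof (rule sum.mono_neutral_right)
    show "\<forall>q\<in>Q - {q0}. ext_scalar (c q) * (?w (\<sigma> q) * ?w R) = 0"
    proof
      fix q assume q: "q \<in> Q - {q0}"
      show "ext_scalar (c q) * (?w (\<sigma> q) * ?w R) = 0"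
      proof (cases "c q = 0")
        case False
        \<comment> \<open>Disjointness from \<open>R\<close> would make \<open>\<sigma> q\<close> a
          proper subset of \<open>\<sigma> q0\<close>, against the choice of least
          cardinality.\<close>
        have "\<sigma> q \<inter> R \<noteq> {}"
        proof
          assume "\<sigma> q \<inter> R = {}"
          moreover have "\<sigma> q \<noteq> \<sigma> q0" using assms(4) q q0 by (auto dest: inj_onD)
          ultimately have "\<sigma> q \<subset> \<sigma> q0" using assms(5)[of q] q by (auto simp: R_def)
          then have "card (\<sigma> q) < card (\<sigma> q0)" using fin q0 by (intro psubset_card_mono) auto
          then show False using min[of q] q False by simp
        qed
        then show ?thesis using v.wedge_mult[of "\<sigma> q" R] fin q R by simp
      qed simp
    qed
  qed (use assms q0 in auto)
  also have "\<dots> = ext_scalar (c q0 * ext_sign (\<sigma> q0) R) * ?w N"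
    using v.wedge_mult[of "\<sigma> q0" R] fin q0 R by (simp add: ext_scalar_mult mult.assoc)
  finally have zero: "ext_scalar (c q0 * ext_sign (\<sigma> q0) R) * ?w N = 0" ..
  obtain T where "ext_coeff (?w N) T \<noteq> 0"
    using wedge_dform_nonzero[OF assms(1,2)] by (metis ext_coeff_zero ext_eqI)
  moreover have "c q0 * ext_sign (\<sigma> q0) R * ext_coeff (?w N) T = 0"
    using arg_cong[OF zero, of "\<lambda>x. ext_coeff x T"] by simp
  ultimately show False using q0 by simp
qed

section \<open>Independence of normal forms\<close>

lemma to_fract_prod: "to_fract (prod f A) = (\<Prod>i\<in>A. to_fract (f i))"
  by (induction A rule: infinite_finite_induct) simp_all


lemma Cst_ext_sign: "Cst (ext_sign A B) = ext_sign A B"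
proof -
  have "Cst ((- 1) ^ k) = (- 1 :: 'a mpoly) ^ k" for k
    by (induction k) (simp_all add: Cst_mult Cst_uminus)
  then show ?thesis by (simp add: ext_sign_def)
qed

lemma prod_list_scalar:
  "prod_list (map (\<lambda>i. ext_scalar (y i) * x i) js) =
    ext_scalar (prod_list (map y js)) * prod_list (map x js)"
proof (induction js)
  case (Cons j js)
  then show ?case
    by (simp add: ext_scalar_mult mult.assoc ext_scalar_left_commute[of "x j"])
qed simp

lemma wedge_scalar:
  assumes "finite S"
  shows "wedge (\<lambda>i. ext_scalar (y i) * x i) S = ext_scalar (prod y S) * wedge x S"
  using prod.distinct_set_conv_list[of "sorted_list_of_set S" y] assms
  by (simp add: wedge_def prod_list_scalar)

lemma ext_coeff_d_lin_form: "ext_coeff (d_lin_form n u) S = Cst (ext_coeff (dform n u) S)"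
  by (auto simp: d_lin_form_def dform_def ext_coeff_sum ext_gen.rep_eq Cst_sum intro: sum.cong)

lemma ext_coeff_prod_d_lin_form:
  "ext_coeff (prod_list (map (\<lambda>i. ext_fract (d_lin_form n (c i))) js)) T =
    to_fract (Cst (ext_coeff (prod_list (map (\<lambda>i. dform n (c i)) js)) T))"
  by (induction js arbitrary: T)
    (simp_all add: one_ext.rep_eq times_ext.rep_eq ext_fract.rep_eq ext_coeff_d_lin_form Cst_sum
      Cst_mult Cst_ext_sign to_fract_sum to_fract_ext_sign)

text \<open>The image of t^\<mu> u_S under \<psi> is z^(-\<beta>) dz_S with
  \<open>S \<union> supp \<mu>\<close> as the support of \<beta>; so the condition says that the
  forms in each denominator are indexed by an nbc set.\<close>

definition normal_form :: "nat \<Rightarrow> nat \<Rightarrow> (nat \<Rightarrow> nat \<Rightarrow> 'f::field) \<Rightarrow> 'f mpoly ext \<Rightarrow> bool" where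
  "normal_form n m c \<omega> \<longleftrightarrow> (\<forall>S. \<forall>\<mu>\<in>supp (ext_coeff \<omega> S). nbc n c {1..m} (S \<union> supp \<mu>))"

context
  fixes n m :: nat and c :: "nat \<Rightarrow> nat \<Rightarrow> 'f::field"
  assumes z_nonzero: "\<And>i. i \<in> {1..m} \<Longrightarrow> lin_form n (c i) \<noteq> 0"
begin

abbreviation (input) zinv :: "nat \<Rightarrow> 'f mpoly fract" where
  "zinv i \<equiv> inverse (to_fract (lin_form n (c i)))"

lemma h0_unfold: "h0 n c = poly_eval (\<lambda>a. to_fract (Cst a)) zinv"
  by (rule h0_def) (rule z_nonzero)

lemma v0_unfold: "v0 n c = (\<lambda>i. ext_scalar (zinv i) * ext_fract (d_lin_form n (c i)))"
  by (rule ext, rule v0_def) (rule z_nonzero)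

lemma anticommuting_v: "anticommuting (v0 n c)"
  by (rule anticommuting_v0) (rule z_nonzero)

lemma psi0_unfold:
  "psi0 n m c \<omega> = (\<Sum>A\<in>Pow {1..m}. ext_scalar (h0 n c (ext_coeff \<omega> A)) * wedge (v0 n c) A)"
  unfolding anticommuting.w_eq_wedge[OF anticommuting_v, symmetric]
  by (rule psi0_def) (rule z_nonzero)

lemma h0_eq:
  assumes "p \<in> poly_on {1..m}"
  shows "h0 n c p = (\<Sum>\<mu>\<in>supp p. to_fract (Cst (Poly_Mapping.lookup p \<mu>)) *
    (\<Prod>i=1..m. zinv i ^ Poly_Mapping.lookup \<mu> i))"
  unfolding h0_unfold poly_eval_def
  using assms by (intro sum.cong refl) (simp add: mon_eval_superset[of "{1..m}"] poly_on_def)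

lemma wedge_v0:
  assumes "finite S"
  shows "ext_coeff (wedge (v0 n c) S) T =
    prod zinv S * to_fract (Cst (ext_coeff (wedge (\<lambda>i. dform n (c i)) S) T))"
  unfolding v0_unfold wedge_scalar[OF assms] ext_coeff_scalar_mult
  unfolding wedge_def ext_coeff_prod_d_lin_form ..

text \<open>The terms of the image are grouped by the exponent \<beta> of z^(-\<beta>). Partial
  fractions make the coefficient of each z^(-\<beta>) vanish; for fixed \<beta> the sets S are
  distinct subsets of the nbc support of \<beta>, where the dz_S are independent.\<close>

lemma normal_form_psi0_eq_0:
  assumes "\<omega> \<in> forms_on {1..m}" "normal_form n m c \<omega>" "psi0 n m c \<omega> = 0"
  shows "\<omega> = 0"
proof -
  let ?I = "{1..m}" and ?w = "wedge (\<lambda>i. dform n (c i))"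
  let ?a = "\<lambda>(S, \<mu>). Poly_Mapping.lookup (ext_coeff \<omega> S) \<mu>"
  define P where "P = (SIGMA S:Pow ?I. supp (ext_coeff \<omega> S))"
  \<comment> \<open>\<open>g (S, \<mu>)\<close> is the exponent of the denominator in the image of
    t^\<mu> u_S: besides t^\<mu>, each u_i contributes one factor z_i^-1.\<close>
  define g where "g = (\<lambda>(S, \<mu>) (i :: nat). Poly_Mapping.lookup \<mu> i + (if i \<in> S then 1 else (0 :: nat)))"
  have finP: "finite P" unfolding P_def by (intro finite_SigmaI) auto
  have PD: "finite S" "S \<subseteq> ?I" "supp \<mu> \<subseteq> ?I" "\<mu> \<in> supp (ext_coeff \<omega> S)"
    "nbc n c ?I (S \<union> supp \<mu>)" "{i. g (S, \<mu>) i \<noteq> 0} = S \<union> supp \<mu>" if "(S, \<mu>) \<in> P" for S \<mu>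
  proof -
    show S: "S \<subseteq> ?I" and \<mu>: "\<mu> \<in> supp (ext_coeff \<omega> S)" using that by (auto simp: P_def)
    show "finite S" using S finite_subset by blast
    show "supp \<mu> \<subseteq> ?I" using assms(1) \<mu> unfolding forms_on_def poly_on_def by blast
    show "nbc n c ?I (S \<union> supp \<mu>)" using assms(2) \<mu> unfolding normal_form_def by blast
    show "{i. g (S, \<mu>) i \<noteq> 0} = S \<union> supp \<mu>" by (auto simp: g_def in_keys_iff)
  qed
  \<comment> \<open>\<open>C T \<beta>\<close> is the coefficient of z^(-\<beta>) dx_T after
    grouping the terms of \<open>psi0 n m c \<omega>\<close>.\<close>
  define C where "C T \<beta> = (\<Sum>p\<in>{p\<in>P. g p = \<beta>}. ?a p * ext_coeff (?w (fst p)) T)" for T \<beta>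
  obtain K where K: "\<forall>k\<in>(\<lambda>(\<beta>, i). \<beta> i) ` (g ` P \<times> ?I). k \<le> K"
    using finite_nat_set_iff_bounded_le[of "(\<lambda>(\<beta>, i). \<beta> i) ` (g ` P \<times> ?I)"] finP by auto
  have C0: "C T \<beta> = 0" if \<beta>: "\<beta> \<in> g ` P" for T \<beta>
  proof -
    have "0 = ext_coeff (psi0 n m c \<omega>) T" using assms(3) by simp
    also have "\<dots> = (\<Sum>S\<in>Pow ?I. h0 n c (ext_coeff \<omega> S) * (prod zinv S * to_fract (Cst (ext_coeff (?w S) T))))"
      unfolding psi0_unfold ext_coeff_sum
        ext_coeff_scalar_mult
      by (intro sum.cong refl) (metis PowD finite_atLeastAtMost finite_subset wedge_v0)
    also have "\<dots> = (\<Sum>S\<in>Pow ?I. \<Sum>\<mu>\<in>supp (ext_coeff \<omega> S).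
        to_fract (Cst (?a (S, \<mu>) * ext_coeff (?w S) T)) * (\<Prod>i\<in>?I. zinv i ^ g (S, \<mu>) i))"
    proof (rule sum.cong[OF refl])
      fix S assume S: "S \<in> Pow ?I"
      have pS: "prod zinv S = (\<Prod>i\<in>?I. zinv i ^ (if i \<in> S then 1 else 0))"
        using S by (intro prod.mono_neutral_cong_left) auto
      have h: "ext_coeff \<omega> S \<in> poly_on ?I" using assms(1) by (simp add: forms_on_def)
      show "h0 n c (ext_coeff \<omega> S) * (prod zinv S * to_fract (Cst (ext_coeff (?w S) T))) =
          (\<Sum>\<mu>\<in>supp (ext_coeff \<omega> S).
            to_fract (Cst (?a (S, \<mu>) * ext_coeff (?w S) T)) * (\<Prod>i\<in>?I. zinv i ^ g (S, \<mu>) i))"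
        unfolding h0_eq[OF h] pS sum_distrib_right g_def prod.case power_add prod.distrib Cst_mult
          to_fract_mult
        by (simp only: ac_simps)
    qed
    also have "\<dots> = (\<Sum>p\<in>P. to_fract (Cst (?a p * ext_coeff (?w (fst p)) T)) * (\<Prod>i\<in>?I. zinv i ^ g p i))"
      unfolding P_def by (subst sum.Sigma) (auto intro!: sum.cong)
    also have "\<dots> = (\<Sum>\<beta>\<in>g ` P. \<Sum>p\<in>{p\<in>P. g p = \<beta>}.
        to_fract (Cst (?a p * ext_coeff (?w (fst p)) T)) * (\<Prod>i\<in>?I. zinv i ^ g p i))"
      by (rule sum.image_gen[OF finP])
    also have "\<dots> = (\<Sum>\<beta>\<in>g ` P. to_fract (Cst (C T \<beta>)) * (\<Prod>i\<in>?I. zinv i ^ \<beta> i))"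
      unfolding C_def Cst_sum to_fract_sum sum_distrib_right by (intro sum.cong refl) auto
    finally have "(\<Sum>\<beta>\<in>g ` P. to_fract (Cst (C T \<beta>)) * (\<Prod>i\<in>?I. zinv i ^ \<beta> i)) = 0" ..
    \<comment> \<open>Multiplication by all z_i^K clears the denominators and gives the polynomial
      identity to which \<open>nbc_monomials_independent\<close> applies.\<close>
    then have "0 = (\<Prod>i\<in>?I. to_fract (lin_form n (c i)) ^ K) *
        (\<Sum>\<beta>\<in>g ` P. to_fract (Cst (C T \<beta>)) * (\<Prod>i\<in>?I. zinv i ^ \<beta> i))" by simp
    also have "\<dots> = to_fract (\<Sum>\<beta>\<in>g ` P. Cst (C T \<beta>) * (\<Prod>i\<in>?I. lin_form n (c i) ^ (K - \<beta> i)))"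
      unfolding to_fract_sum sum_distrib_left
    proof (rule sum.cong[OF refl])
      fix \<beta> assume "\<beta> \<in> g ` P"
      then have le: "\<beta> i \<le> K" if "i \<in> ?I" for i using K that by force
      have "to_fract (\<Prod>i\<in>?I. lin_form n (c i) ^ (K - \<beta> i)) =
          (\<Prod>i\<in>?I. to_fract (lin_form n (c i)) ^ K * zinv i ^ \<beta> i)"
        unfolding to_fract_prod to_fract_power using z_nonzero le
        by (intro prod.cong refl) (simp add: power_diff power_inverse divide_inverse)
      then show "(\<Prod>i\<in>?I. to_fract (lin_form n (c i)) ^ K) *
          (to_fract (Cst (C T \<beta>)) * (\<Prod>i\<in>?I. zinv i ^ \<beta> i)) =
          to_fract (Cst (C T \<beta>) * (\<Prod>i\<in>?I. lin_form n (c i) ^ (K - \<beta> i)))"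
        by (simp only: to_fract_mult prod.distrib ac_simps)
    qed
    finally have "to_fract (\<Sum>\<beta>\<in>g ` P. Cst (C T \<beta>) * (\<Prod>i\<in>?I. lin_form n (c i) ^ (K - \<beta> i))) = 0" ..
    then have "(\<Sum>\<beta>\<in>g ` P. Cst (C T \<beta>) * (\<Prod>i\<in>?I. lin_form n (c i) ^ (K - \<beta> i))) = 0"
      by (simp only: to_fract_eq_0_iff)
    then have "\<forall>\<beta>\<in>g ` P. C T \<beta> = 0"
    proof (intro nbc_monomials_independent[where I = ?I and z = c and n = n and e = "\<lambda>\<beta>. \<beta>" and K = K])
      fix \<beta> assume "\<beta> \<in> g ` P"
      then obtain S \<mu> where p: "(S, \<mu>) \<in> P" "\<beta> = g (S, \<mu>)" by auto
      then have "{i \<in> ?I. \<beta> i \<noteq> 0} = S \<union> supp \<mu>" using PD[OF p(1)] by blast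
      then show "nbc n c ?I {i \<in> ?I. \<beta> i \<noteq> 0}" using PD[OF p(1)] by simp
    next
      fix \<beta> \<gamma> assume "\<beta> \<in> g ` P" "\<gamma> \<in> g ` P" and eq: "\<forall>i\<in>?I. \<beta> i = \<gamma> i"
      then obtain S \<mu> S' \<mu>' where "(S, \<mu>) \<in> P" "\<beta> = g (S, \<mu>)" "(S', \<mu>') \<in> P" "\<gamma> = g (S', \<mu>')" by auto
      then have "{i. \<beta> i \<noteq> 0} \<subseteq> ?I" "{i. \<gamma> i \<noteq> 0} \<subseteq> ?I" using PD(2,3,6) by (metis Un_least)+
      then show "\<beta> = \<gamma>" using eq by (intro ext) (metis (mono_tags, lifting) mem_Collect_eq subsetD)
    qed (use finP K in auto)
    then show ?thesis using \<beta> by blast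
  qed
  have "P = {}"
  proof (rule ccontr)
    assume "P \<noteq> {}"
    then obtain S0 \<mu>0 where p0: "(S0, \<mu>0) \<in> P" by auto
    define \<beta> where "\<beta> = g (S0, \<mu>0)"
    define N where "N = S0 \<union> supp \<mu>0"
    let ?Q = "{p\<in>P. g p = \<beta>}"
    have "\<forall>p\<in>?Q. ?a p = 0"
    proof (rule wedge_dform_independent)
      show "finite N" unfolding N_def using PD(1)[OF p0] by simp
      show "nbc n c N N" using PD(2,3,5)[OF p0] unfolding N_def by (auto intro: nbc_mono)
      \<comment> \<open>For fixed \<beta> the set \<open>S\<close> determines \<mu>, as \<beta>
        minus the indicator function of \<open>S\<close>.\<close>
      show "inj_on fst ?Q"
      proof (rule inj_onI)
        fix p q assume "p \<in> ?Q" "q \<in> ?Q" "fst p = fst q"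
        then obtain S \<mu> \<nu> where pq: "p = (S, \<mu>)" "q = (S, \<nu>)" and "g (S, \<mu>) = g (S, \<nu>)"
          by (metis (mono_tags, lifting) mem_Collect_eq prod.collapse)
        then have "Poly_Mapping.lookup \<mu> i = Poly_Mapping.lookup \<nu> i" for i
          by (auto simp: g_def dest: fun_cong[of _ _ i])
        then show "p = q" by (simp add: pq poly_mapping_eqI)
      qed
      show "fst q \<subseteq> N" if q: "q \<in> ?Q" for q
        using PD(6)[OF p0] PD(6)[of "fst q" "snd q"] q by (auto simp: N_def \<beta>_def)
      show "(\<Sum>q\<in>?Q. ext_scalar (?a q) * ?w (fst q)) = 0"
      proof (rule ext_eqI)
        fix T
        have "C T \<beta> = 0" using C0[of \<beta> T] p0 unfolding \<beta>_def by blast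
        then show "ext_coeff (\<Sum>q\<in>?Q. ext_scalar (?a q) * ?w (fst q)) T = ext_coeff 0 T"
          by (simp add: ext_coeff_sum C_def)
      qed
    qed (use finP in auto)
    then show False using p0 PD(4)[OF p0] by (auto simp: \<beta>_def in_keys_iff)
  qed
  show ?thesis
  proof (rule ext_eqI)
    fix S
    show "ext_coeff \<omega> S = ext_coeff 0 S"
    proof (cases "S \<subseteq> ?I")
      case True
      then have "supp (ext_coeff \<omega> S) = {}" using \<open>P = {}\<close> unfolding P_def by blast
      then show ?thesis by simp
    next
      case False
      then show ?thesis using assms(1) by (auto simp: forms_on_def)
    qed
  qed
qed

end

section \<open>The elements \<open>P\<^bsub>L,S\<^esub>\<close>\<close>

text \<open>
  With \<open>y\<^sub>i = t\<^sub>i\<close> and \<open>w\<^sub>i = dz\<^sub>i\<close> the right-hand side is \<open>P\<^bsub>L,S\<^esub>\<close> and the left-hand side is free of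
  denominators; with \<open>y\<^sub>i = z\<^sub>i\<^sup>-\<^sup>1\<close> the left-hand side is \<open>\<psi>(P\<^bsub>L,S\<^esub>)\<close> and the right-hand side
  vanishes because \<open>\<Sum>a\<^sub>iz\<^sub>i = 0\<close> and \<open>\<Sum>a\<^sub>idz\<^sub>i = 0\<close>.
\<close>

lemma relation_form_eq:
  fixes w :: "nat \<Rightarrow> 'b::comm_ring_1 ext"
  assumes w: "anticommuting w" and Q: "finite Q" "S \<subseteq> Q" and v: "\<And>i. v i = ext_scalar (y i) * w i"
    and js: "js = sorted_list_of_set S"
  shows "(\<Sum>i\<in>Q - S. ext_scalar (a i * prod y (Q - S - {i})) *
      (prod_list (map v js) - (\<Sum>s<length js. prod_list (map v (js[s := i]))))) =
    ext_scalar (\<Sum>i\<in>Q. a i * prod y (Q - {i})) * prod_list (map w js) -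
    (\<Sum>s<length js. ext_scalar (prod y (Q - {js ! s})) *
      prod_list ((map w js)[s := \<Sum>i\<in>Q. ext_scalar (a i) * w i]))"
proof -
  define Y where "Y i = prod y (Q - {i})" for i
  define D where "D = prod_list (map w js)"
  define U where "U s i = prod_list (map w (js[s := i]))" for s i
  have finS: "finite S" using Q finite_subset by blast
  then have js': "distinct js" "set js = S" by (simp_all add: js)
  have v': "v = (\<lambda>i. ext_scalar (y i) * w i)" by (simp add: fun_eq_iff v)
  have prod_v: "prod_list (map v ks) = ext_scalar (prod y (set ks)) * prod_list (map w ks)"
    if "distinct ks" for ks
    unfolding v' prod_list_scalar by (simp add: prod.distinct_set_conv_list[OF that])
  have summand: "ext_scalar (a i * prod y (Q - S - {i})) *
      (prod_list (map v js) - (\<Sum>s<length js. prod_list (map v (js[s := i])))) =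
    ext_scalar (a i * Y i) * D - (\<Sum>s<length js. ext_scalar (a i * Y (js ! s)) * U s i)"
    if i: "i \<in> Q - S" for i
  proof -
    have 1: "ext_scalar (a i * prod y (Q - S - {i})) * prod_list (map v js) = ext_scalar (a i * Y i) * D"
    proof -
      \<comment> \<open>The factors y_q with q \<in> S turn each w_q into v_q; this is what removes
        the denominators.\<close>
      have "Q - {i} = (Q - S - {i}) \<union> S" using i Q by auto
      then have "Y i = prod y (Q - S - {i}) * prod y S"
        unfolding Y_def using Q finS by (simp only:) (subst prod.union_disjoint, auto)
      then show ?thesis
        by (simp add: prod_v js' D_def ext_scalar_mult mult.assoc)
    qed
    have 2: "ext_scalar (a i * prod y (Q - S - {i})) * prod_list (map v (js[s := i])) =
        ext_scalar (a i * Y (js ! s)) * U s i" if s: "s < length js" for s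
    proof -
      have "js ! s \<in> S" using s js' by auto
      have "set (js[s := i]) = insert i (S - {js ! s})"
        using s js' by (simp add: set_update_distinct)
      moreover have "distinct (js[s := i])" using i js' by (intro distinct_list_update) auto
      moreover have "Q - {js ! s} = (Q - S - {i}) \<union> insert i (S - {js ! s})"
        using i Q \<open>js ! s \<in> S\<close> by auto
      then have "Y (js ! s) = prod y (Q - S - {i}) * prod y (insert i (S - {js ! s}))"
        unfolding Y_def using Q finS by (simp only:) (subst prod.union_disjoint, auto)
      ultimately show ?thesis
        by (simp add: prod_v U_def ext_scalar_mult mult.assoc)
    qed
    show ?thesis unfolding right_diff_distrib sum_distrib_left 1 using 2 by simp
  qed
  have upd: "prod_list ((map w js)[s := \<Sum>i\<in>Q. ext_scalar (a i) * w i]) =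
      ext_scalar (a (js ! s)) * D + (\<Sum>i\<in>Q - S. ext_scalar (a i) * U s i)"
    if s: "s < length js" for s
  proof -
    have inS: "js ! s \<in> S" using s js' by auto
    have "prod_list ((map w js)[s := \<Sum>i\<in>Q. ext_scalar (a i) * w i]) =
        (\<Sum>i\<in>Q. prod_list (take s (map w js)) * (ext_scalar (a i) * w i) *
          prod_list (drop (Suc s) (map w js)))"
      using s by (simp only: prod_list_update length_map sum_distrib_left sum_distrib_right)
    also have "\<dots> = (\<Sum>i\<in>Q. ext_scalar (a i) * U s i)"
      using s unfolding U_def
      by (intro sum.cong refl)
        (simp only: map_update prod_list_update length_map mult.assoc ext_scalar_left_commute)
    also have "\<dots> = (\<Sum>i\<in>Q - S. ext_scalar (a i) * U s i) + (\<Sum>i\<in>S. ext_scalar (a i) * U s i)"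
      using Q(2,1) by (rule sum.subset_diff)
    \<comment> \<open>Any index of \<open>S\<close> other than \<open>js ! s\<close> would occur
      twice in the product, which then vanishes.\<close>
    also have "(\<Sum>i\<in>S. ext_scalar (a i) * U s i) = (\<Sum>i\<in>{js ! s}. ext_scalar (a i) * U s i)"
    proof (rule sum.mono_neutral_right)
      show "\<forall>i\<in>S - {js ! s}. ext_scalar (a i) * U s i = 0"
      proof
        fix i assume i: "i \<in> S - {js ! s}"
        then obtain r where r: "r < length js" "js ! r = i" using js' by (auto simp: in_set_conv_nth)
        then have "r \<noteq> s" using i by auto
        moreover from this have "js[s := i] ! r = js[s := i] ! s" using r s by simp
        ultimately have "\<not> distinct (js[s := i])"
          using r s nth_eq_iff_index_eq[of "js[s := i]" r s] by auto
        then show "ext_scalar (a i) * U s i = 0"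
          unfolding U_def by (simp add: anticommuting.prod_list_0[OF w])
      qed
    qed (use finS inS in auto)
    finally show ?thesis by (simp add: U_def D_def)
  qed
  have "bij_betw ((!) js) {..<length js} S" by (rule bij_betw_nth) (use js' in auto)
  then have S: "(\<Sum>s<length js. ext_scalar (a (js ! s) * Y (js ! s)) * D) =
      (\<Sum>i\<in>S. ext_scalar (a i * Y i) * D)"
    by (rule sum.reindex_bij_betw)
  have "(\<Sum>s<length js. ext_scalar (Y (js ! s)) *
      prod_list ((map w js)[s := \<Sum>i\<in>Q. ext_scalar (a i) * w i])) =
    (\<Sum>s<length js. ext_scalar (a (js ! s) * Y (js ! s)) * D +
      (\<Sum>i\<in>Q - S. ext_scalar (a i * Y (js ! s)) * U s i))"
  proof (rule sum.cong[OF refl])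
    fix s assume "s \<in> {..<length js}"
    then show "ext_scalar (Y (js ! s)) *
      prod_list ((map w js)[s := \<Sum>i\<in>Q. ext_scalar (a i) * w i]) =
      ext_scalar (a (js ! s) * Y (js ! s)) * D + (\<Sum>i\<in>Q - S. ext_scalar (a i * Y (js ! s)) * U s i)"
      by (simp add: upd distrib_left sum_distrib_left mult.commute[of "a _"] ext_scalar_mult mult.assoc)
  qed
  also have "\<dots> = (\<Sum>i\<in>S. ext_scalar (a i * Y i) * D) +
      (\<Sum>i\<in>Q - S. \<Sum>s<length js. ext_scalar (a i * Y (js ! s)) * U s i)"
    unfolding sum.distrib S by (simp add: sum.swap[of _ "Q - S"])
  finally have R: "(\<Sum>s<length js. ext_scalar (Y (js ! s)) *
      prod_list ((map w js)[s := \<Sum>i\<in>Q. ext_scalar (a i) * w i])) = \<dots>" .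
  \<comment> \<open>The part with i \<in> S equals the diagonal part in \<open>R\<close> and cancels
    against it, so that only indices i outside \<open>S\<close> remain.\<close>
  have P: "ext_scalar (\<Sum>i\<in>Q. a i * Y i) * D =
      (\<Sum>i\<in>Q - S. ext_scalar (a i * Y i) * D) + (\<Sum>i\<in>S. ext_scalar (a i * Y i) * D)"
    unfolding ext_scalar_sum sum_distrib_right by (rule sum.subset_diff) (use Q in auto)
  have "(\<Sum>i\<in>Q - S. ext_scalar (a i * prod y (Q - S - {i})) *
      (prod_list (map v js) - (\<Sum>s<length js. prod_list (map v (js[s := i]))))) =
    (\<Sum>i\<in>Q - S. ext_scalar (a i * Y i) * D) -
      (\<Sum>i\<in>Q - S. \<Sum>s<length js. ext_scalar (a i * Y (js ! s)) * U s i)"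
    unfolding sum_subtractf[symmetric] by (intro sum.cong refl summand)
  then show ?thesis
    using P R unfolding Y_def[symmetric] D_def[symmetric] by simp
qed

lemma ext_fract_prod_list: "ext_fract (prod_list xs) = prod_list (map ext_fract xs)"
  by (induction xs) (simp_all add: ext_fract_mult)

text \<open>This is \<open>relation_form_eq\<close> for y = t and w = dz, hence v = u. The formula
  has no denominators, so it exhibits P_{L,S} as a combination of monomials of \<Xi>.\<close>

lemma P_form_eq:
  fixes L :: "nat \<Rightarrow>\<^sub>0 'f::field"
  assumes "S \<subseteq> supp L" and js: "js = sorted_list_of_set S"
  shows "P_form L S = (\<Sum>i\<in>supp L - S.
    ext_scalar (Cst (Poly_Mapping.lookup L i) * prod Var (supp L - S - {i})) *
      (prod_list (map ext_gen js) - (\<Sum>s<length js. prod_list (map ext_gen (js[s := i])))))"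
    (is "_ = ?P")
proof (rule ext_fract_inject)
  let ?a = "\<lambda>i. to_fract (Cst (Poly_Mapping.lookup L i))"
  have gen: "ext_gen i = ext_scalar (to_fract (Var i)) * (dz_loc i :: 'f mpoly fract ext)" for i
    unfolding dz_loc_def by (intro ext_eqI) simp
  have "ext_fract ?P = (\<Sum>i\<in>supp L - S. ext_scalar (?a i * (\<Prod>q\<in>supp L - S - {i}. to_fract (Var q))) *
      (prod_list (map ext_gen js) - (\<Sum>s<length js. prod_list (map ext_gen (js[s := i])))))"
    by (simp add: ext_fract_sum ext_fract_mult ext_fract_diff ext_fract_scalar ext_fract_prod_list
        to_fract_prod comp_def)
  also have "\<dots> = P_form_loc L S"
    unfolding P_form_loc_def Let_def dL_loc_def P_rel_def js[symmetric]
    by (subst relation_form_eq[OF dz.anticommuting_axioms finite_keys assms(1) gen js])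
      (simp add: to_fract_sum to_fract_prod)
  finally show "ext_fract (P_form L S) = ext_fract ?P"
    by (simp add: ext_fract_P_form[OF assms(1)])
qed

section \<open>Vanishing of \<psi> on the P_{L,S}\<close>

lemma lookup_lin_form:
  assumes "k \<in> {1..n}"
  shows "Poly_Mapping.lookup (lin_form n b) (Poly_Mapping.single k 1) = b k"
proof -
  have "Poly_Mapping.lookup (Cst (b j) * Var j) (Poly_Mapping.single k 1) = (if j = k then b k else 0)" for j
  proof -
    have "Poly_Mapping.single j (1 :: nat) = Poly_Mapping.single k 1 \<longleftrightarrow> j = k"
      by (metis keys_single singleton_inject zero_neq_one)
    then show ?thesis by (simp add: Cst_def Var_def mult_single lookup_single when_def)
  qed
  then show ?thesis using assms by (simp add: lin_form_def lookup_sum)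
qed

lemma lin_form_eq_0D: "lin_form n b = 0 \<Longrightarrow> k \<in> {1..n} \<Longrightarrow> b k = 0"
  using lookup_lin_form[of k n b] by simp

text \<open>Comparing coefficients of x_k turns a relation among the z_i into scalar relations,
  which transfer it to the dz_i.\<close>

lemma lin_relation_coeff:
  assumes "lin_relation n m c L" "k \<in> {1..n}"
  shows "(\<Sum>i\<in>supp L. Poly_Mapping.lookup L i * c i k) = 0"
proof (rule lin_form_eq_0D)
  have "lin_form n (\<lambda>k. \<Sum>i\<in>supp L. Poly_Mapping.lookup L i * c i k) =
      (\<Sum>i\<in>supp L. Cst (Poly_Mapping.lookup L i) * lin_form n (c i))"
    unfolding lin_form_def
    by (simp add: Cst_sum Cst_mult sum_distrib_left sum_distrib_right mult.assoc)
      (rule sum.swap)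
  then show "lin_form n (\<lambda>k. \<Sum>i\<in>supp L. Poly_Mapping.lookup L i * c i k) = 0"
    using assms(1) by (simp add: lin_relation_def)
qed (rule assms(2))

context
  fixes n m :: nat and c :: "nat \<Rightarrow> nat \<Rightarrow> 'f::field"
  assumes z_nonzero: "\<And>i. i \<in> {1..m} \<Longrightarrow> lin_form n (c i) \<noteq> 0"
begin

lemma psi0_hom:
  "psi0 n m c (x + y) = psi0 n m c x + psi0 n m c y"
  "psi0 n m c (x * y) = psi0 n m c x * psi0 n m c y"
  "psi0 n m c (ext_scalar p) = ext_scalar (h0 n c p)"
  by (rule psi0_add psi0_mult psi0_scalar, rule z_nonzero, assumption)+

lemma psi0_basic: "psi0 n m c 0 = 0" "psi0 n m c 1 = 1"
  using psi0_hom(1)[of 0 0] psi0_hom(3)[of 1] h0_simps(4)[of m n c] z_nonzero by auto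

lemma psi0_sum: "psi0 n m c (sum f A) = (\<Sum>i\<in>A. psi0 n m c (f i))"
  by (induction A rule: infinite_finite_induct) (simp_all add: psi0_basic psi0_hom)

lemma psi0_diff: "psi0 n m c (x - y) = psi0 n m c x - psi0 n m c y"
  using psi0_hom(1)[of "x - y" y] by simp

lemma psi0_prod_gen:
  "set js \<subseteq> {1..m} \<Longrightarrow> psi0 n m c (prod_list (map ext_gen js)) = prod_list (map (v0 n c) js)"
proof (induction js)
  case (Cons j js)
  have "psi0 n m c (ext_gen j) = v0 n c j"
    by (rule psi0_gen[OF z_nonzero]) (use Cons.prems in auto)
  then show ?case using Cons by (simp add: psi0_hom)
qed (simp add: psi0_basic)

lemma h0_hom:
  "h0 n c (x + y) = h0 n c x + h0 n c y"
  "h0 n c (x * y) = h0 n c x * h0 n c y"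
  "h0 n c 1 = 1" "h0 n c (Cst a) = to_fract (Cst a)"
  "h0 n c (Var i) = inverse (to_fract (lin_form n (c i)))"
  by (rule h0_simps, rule z_nonzero, assumption)+

lemma h0_prod: "h0 n c (prod f A) = (\<Prod>i\<in>A. h0 n c (f i))"
  by (induction A rule: infinite_finite_induct) (simp_all add: h0_hom)

text \<open>By \<open>relation_form_eq\<close> with y = z^-1 and w = dz. There the first sum is the
  product of the z_i^-1 times \<Sum> a_i z_i = 0, and in every other term one factor is \<Sum> a_i
  dz_i = 0.\<close>

lemma psi0_P_form:
  assumes L: "lin_relation n m c L" and S: "S \<subseteq> supp L"
  shows "psi0 n m c (P_form L S) = 0"
proof -
  define js where "js = sorted_list_of_set S"
  have suppL: "supp L \<subseteq> {1..m}" using L by (simp add: lin_relation_def)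
  have js: "set js = S" unfolding js_def using S finite_subset[OF S] by simp
  let ?a = "\<lambda>i. to_fract (Cst (Poly_Mapping.lookup L i))"
  let ?y = "\<lambda>i. inverse (to_fract (lin_form n (c i)))"
  let ?w = "\<lambda>i. ext_fract (d_lin_form n (c i))"
  have w_eq: "?w i = (\<Sum>j\<in>{1..n}. ext_scalar (to_fract (Cst (c i j))) * ext_gen j)" for i
    by (simp add: d_lin_form_def ext_fract_sum ext_fract_mult ext_fract_scalar)
  have v: "v0 n c i = ext_scalar (?y i) * ?w i" for i
    by (rule v0_def) (rule z_nonzero)
  have anti: "anticommuting ?w"
    unfolding w_eq by (rule anticommuting_gen_multiples)
  have "psi0 n m c (P_form L S) = (\<Sum>i\<in>supp L - S. ext_scalar (?a i * prod ?y (supp L - S - {i})) *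
      (prod_list (map (v0 n c) js) - (\<Sum>s<length js. prod_list (map (v0 n c) (js[s := i])))))"
    unfolding P_form_eq[OF S js_def] psi0_sum psi0_hom psi0_diff h0_hom h0_prod
  proof (rule sum.cong[OF refl])
    fix i assume "i \<in> supp L - S"
    then have "set (js[s := i]) \<subseteq> {1..m}" for s
      using set_update_subset_insert[of js s i] js S suppL by auto
    moreover have "set js \<subseteq> {1..m}" using js S suppL by auto
    ultimately show "ext_scalar (?a i * prod ?y (supp L - S - {i})) *
        (psi0 n m c (prod_list (map ext_gen js)) -
          (\<Sum>s<length js. psi0 n m c (prod_list (map ext_gen (js[s := i]))))) =
        ext_scalar (?a i * prod ?y (supp L - S - {i})) *
        (prod_list (map (v0 n c) js) - (\<Sum>s<length js. prod_list (map (v0 n c) (js[s := i]))))"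
      by (simp add: psi0_prod_gen)
  qed
  also have "\<dots> = ext_scalar (\<Sum>i\<in>supp L. ?a i * prod ?y (supp L - {i})) * prod_list (map ?w js) -
    (\<Sum>s<length js. ext_scalar (prod ?y (supp L - {js ! s})) *
      prod_list ((map ?w js)[s := \<Sum>i\<in>supp L. ext_scalar (?a i) * ?w i]))"
    by (rule relation_form_eq[OF anti finite_keys S v js_def])
  also have "(\<Sum>i\<in>supp L. ?a i * prod ?y (supp L - {i})) = 0"
  proof -
    have "?a i * prod ?y (supp L - {i}) = prod ?y (supp L) * to_fract (Cst (Poly_Mapping.lookup L i) * lin_form n (c i))"
      if "i \<in> supp L" for i
    proof -
      have "prod ?y (supp L) = ?y i * prod ?y (supp L - {i})"
        using that by (intro prod.remove) auto
      moreover have "to_fract (lin_form n (c i)) \<noteq> 0" using z_nonzero suppL that by auto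
      ultimately show ?thesis by simp
    qed
    then have "(\<Sum>i\<in>supp L. ?a i * prod ?y (supp L - {i})) =
        prod ?y (supp L) * to_fract (\<Sum>i\<in>supp L. Cst (Poly_Mapping.lookup L i) * lin_form n (c i))"
      unfolding to_fract_sum sum_distrib_left by (intro sum.cong refl)
    moreover have "(\<Sum>i\<in>supp L. Cst (Poly_Mapping.lookup L i) * lin_form n (c i)) = 0"
      using L by (simp add: lin_relation_def)
    ultimately show ?thesis by (simp only: to_fract_0 mult_zero_right)
  qed
  also have "(\<Sum>i\<in>supp L. ext_scalar (?a i) * ?w i) = 0"
  proof -
    have "(\<Sum>i\<in>supp L. ext_scalar (?a i) * ?w i) =
      (\<Sum>j\<in>{1..n}. ext_scalar (to_fract (Cst (\<Sum>i\<in>supp L. Poly_Mapping.lookup L i * c i j))) * ext_gen j)"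
      unfolding w_eq sum_distrib_left Cst_sum to_fract_sum ext_scalar_sum sum_distrib_right
        Cst_mult to_fract_mult ext_scalar_mult mult.assoc
      by (rule sum.swap)
    also have "\<dots> = 0"
      by (rule sum.neutral) (simp add: lin_relation_coeff[OF L])
    finally show ?thesis .
  qed
  finally show ?thesis by (simp add: prod_list_update)
qed

end

section \<open>Broken circuits and monomials\<close>

text \<open>The exponent of the square-free monomial in the variables indexed by
  \<open>X\<close>.\<close>

definition ind :: "nat set \<Rightarrow> nat \<Rightarrow>\<^sub>0 nat" where
  "ind X = (\<Sum>i\<in>X. Poly_Mapping.single i 1)"

lemma lookup_ind: "finite X \<Longrightarrow> Poly_Mapping.lookup (ind X) i = (if i \<in> X then 1 else 0)"
  by (simp add: ind_def lookup_sum lookup_single when_def)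

lemma prod_Var: "prod Var X = Poly_Mapping.single (ind X) 1"
  by (induction X rule: infinite_finite_induct)
    (simp_all add: ind_def Var_def mult_single)

lemma single_eq_prod:
  "Poly_Mapping.single \<mu> a = Cst a * (\<Prod>i\<in>supp \<mu>. Var i ^ Poly_Mapping.lookup \<mu> i)"
proof -
  have pow: "Var i ^ k = Poly_Mapping.single (Poly_Mapping.single i k) (1 :: 'a)" for i k
    by (induction k) (simp_all add: Var_def mult_single flip: single_add)
  have prod: "(\<Prod>i\<in>A. Poly_Mapping.single (f i) (1 :: 'a)) = Poly_Mapping.single (sum f A) 1"
    for A :: "nat set" and f :: "nat \<Rightarrow> nat \<Rightarrow>\<^sub>0 nat"
    by (induction A rule: infinite_finite_induct) (simp_all add: mult_single)
  have "(\<Sum>i\<in>supp \<mu>. Poly_Mapping.single i (Poly_Mapping.lookup \<mu> i)) = \<mu>"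
  proof (rule poly_mapping_eqI)
    fix k
    show "Poly_Mapping.lookup (\<Sum>i\<in>supp \<mu>. Poly_Mapping.single i (Poly_Mapping.lookup \<mu> i)) k =
        Poly_Mapping.lookup \<mu> k"
      by (cases "k \<in> supp \<mu>") (auto simp: lookup_sum lookup_single when_def in_keys_iff)
  qed
  then show ?thesis by (simp add: pow prod Cst_def mult_single)
qed

text \<open>For the uniqueness of h: every polynomial arises from constants and variables by sums
  and products that stay in \<open>poly_on V\<close>.\<close>

lemma poly_on_induct [consumes 1, case_names Cst Var add mult]:
  assumes "p \<in> poly_on V" and Cst: "\<And>a. P (Cst a)" and Var: "\<And>i. i \<in> V \<Longrightarrow> P (Var i)"
    and add: "\<And>p q. p \<in> poly_on V \<Longrightarrow> q \<in> poly_on V \<Longrightarrow> P p \<Longrightarrow> P q \<Longrightarrow> P (p + q)"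
    and mult: "\<And>p q. p \<in> poly_on V \<Longrightarrow> q \<in> poly_on V \<Longrightarrow> P p \<Longrightarrow> P q \<Longrightarrow> P (p * q)"
  shows "P p"
proof -
  define Q where "Q x \<longleftrightarrow> x \<in> poly_on V \<and> P x" for x
  have Q_Cst: "Q (Cst a)" for a by (simp add: Q_def Cst)
  have Q_add: "Q x \<Longrightarrow> Q y \<Longrightarrow> Q (x + y)" for x y by (simp add: Q_def add poly_on_add)
  have Q_mult: "Q x \<Longrightarrow> Q y \<Longrightarrow> Q (x * y)" for x y by (simp add: Q_def mult poly_on_mult)
  have Q_01: "Q 0" "Q 1" using Q_Cst[of 0] Q_Cst[of 1] by simp_all
  have Q_sum: "(\<And>i. i \<in> A \<Longrightarrow> Q (f i)) \<Longrightarrow> Q (sum f A)" for A and f :: "(nat \<Rightarrow>\<^sub>0 nat) \<Rightarrow> _"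
    by (induction A rule: infinite_finite_induct) (simp_all add: Q_01 Q_add)
  have Q_prod: "(\<And>i. i \<in> A \<Longrightarrow> Q (f i)) \<Longrightarrow> Q (prod f A)" for A and f :: "nat \<Rightarrow> _"
    by (induction A rule: infinite_finite_induct) (simp_all add: Q_01 Q_mult)
  have Q_power: "Q x \<Longrightarrow> Q (x ^ k)" for x k
    by (induction k) (simp_all add: Q_01 Q_mult)
  have "Q (\<Sum>\<mu>\<in>supp p. Poly_Mapping.single \<mu> (Poly_Mapping.lookup p \<mu>))"
  proof (rule Q_sum)
    fix \<mu> assume "\<mu> \<in> supp p"
    then have "supp \<mu> \<subseteq> V" using assms(1) by (simp add: poly_on_def)
    then show "Q (Poly_Mapping.single \<mu> (Poly_Mapping.lookup p \<mu>))"
      unfolding single_eq_prod[of \<mu>]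
      by (intro Q_mult Q_Cst Q_prod Q_power) (auto simp: Q_def Var)
  qed
  then show ?thesis using mpoly_sum_monomials[of p] by (simp add: Q_def)
qed

section \<open>The standard basis u_S of the exterior algebra\<close>

lemma anticommuting_ext_gen: "anticommuting ext_gen"
  by unfold_locales (rule ext_gen_anticommute ext_gen_square)+

lemma ext_coeff_gen_mult:
  "ext_coeff (ext_gen a * x) T =
    (if a \<in> T then ext_sign {a} (T - {a}) * ext_coeff x (T - {a}) else 0)"
proof (cases "finite T")
  case True
  have "ext_coeff (ext_gen a * x) T =
      (\<Sum>A\<in>Pow T. if A = {a} then ext_sign {a} (T - {a}) * ext_coeff x (T - {a}) else 0)"
    unfolding times_ext.rep_eq by (rule sum.cong) (auto simp: ext_gen.rep_eq)
  then show ?thesis using True by simp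
qed (simp add: ext_coeff_infinite)

lemma ext_coeff_wedge_gen:
  "finite S \<Longrightarrow> ext_coeff (wedge ext_gen S) T = (if T = S then 1 else 0)"
proof (induction S arbitrary: T rule: finite_linorder_min_induct)
  case empty
  then show ?case by (simp add: one_ext.rep_eq)
next
  case (insert a S)
  have aS: "a \<notin> S" using insert.hyps by blast
  have "wedge ext_gen (insert a S) = ext_gen a * (wedge ext_gen S :: 'a ext)"
    using insert.hyps by (intro anticommuting.wedge_insert_less[OF anticommuting_ext_gen]) auto
  moreover have "ext_sign {a} S = (1 :: 'a)"
    using insert.hyps by (intro ext_sign_eq_1) (auto intro: less_imp_le)
  moreover have "a \<in> T \<and> T - {a} = S \<longleftrightarrow> T = insert a S" using aS by auto
  ultimately show ?case by (auto simp: ext_coeff_gen_mult insert.IH)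
qed

lemma form_eq_sum_wedge:
  assumes "\<omega> \<in> forms_on V" "finite V"
  shows "\<omega> = (\<Sum>S\<in>Pow V. ext_scalar (ext_coeff \<omega> S) * wedge ext_gen S)"
proof (rule ext_eqI)
  fix T
  have "ext_coeff (\<Sum>S\<in>Pow V. ext_scalar (ext_coeff \<omega> S) * wedge ext_gen S) T =
      (\<Sum>S\<in>Pow V. if T = S then ext_coeff \<omega> S else 0)"
    unfolding ext_coeff_sum using assms(2)
    by (intro sum.cong refl) (auto simp: ext_coeff_wedge_gen finite_subset)
  also have "\<dots> = ext_coeff \<omega> T"
    using assms by (auto simp: forms_on_def)
  finally show "ext_coeff \<omega> T =
      ext_coeff (\<Sum>S\<in>Pow V. ext_scalar (ext_coeff \<omega> S) * wedge ext_gen S) T" ..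
qed

lemma forms_on_prod_gen: "set js \<subseteq> V \<Longrightarrow> prod_list (map ext_gen js) \<in> forms_on V"
  by (induction js) (auto intro: forms_on_mult forms_on_gen)

lemma forms_on_induct [consumes 2, case_names scalar gen add mult]:
  assumes "\<omega> \<in> forms_on V" "finite V" and scalar: "\<And>p. p \<in> poly_on V \<Longrightarrow> P (ext_scalar p)"
    and gen: "\<And>i. i \<in> V \<Longrightarrow> P (ext_gen i)"
    and add: "\<And>x y. x \<in> forms_on V \<Longrightarrow> y \<in> forms_on V \<Longrightarrow> P x \<Longrightarrow> P y \<Longrightarrow> P (x + y)"
    and mult: "\<And>x y. x \<in> forms_on V \<Longrightarrow> y \<in> forms_on V \<Longrightarrow> P x \<Longrightarrow> P y \<Longrightarrow> P (x * y)"
  shows "P \<omega>"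
proof -
  define Q where "Q x \<longleftrightarrow> x \<in> forms_on V \<and> P x" for x
  have Q_scalar: "p \<in> poly_on V \<Longrightarrow> Q (ext_scalar p)" for p by (simp add: Q_def scalar forms_on_scalar)
  have Q_add: "Q x \<Longrightarrow> Q y \<Longrightarrow> Q (x + y)" for x y by (simp add: Q_def add forms_on_add)
  have Q_mult: "Q x \<Longrightarrow> Q y \<Longrightarrow> Q (x * y)" for x y by (simp add: Q_def mult forms_on_mult)
  have Q_01: "Q 0" "Q 1" using Q_scalar[of 0] Q_scalar[of 1] by simp_all
  have Q_sum: "(\<And>i. i \<in> A \<Longrightarrow> Q (f i)) \<Longrightarrow> Q (sum f A)" for A and f :: "nat set \<Rightarrow> _"
    by (induction A rule: infinite_finite_induct) (simp_all add: Q_01 Q_add)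
  have Q_gen: "i \<in> V \<Longrightarrow> Q (ext_gen i)" for i by (simp add: Q_def gen forms_on_gen)
  have Q_prod: "set js \<subseteq> V \<Longrightarrow> Q (prod_list (map ext_gen js))" for js
    by (induction js) (simp_all add: Q_01 Q_mult Q_gen)
  have "Q (\<Sum>S\<in>Pow V. ext_scalar (ext_coeff \<omega> S) * wedge ext_gen S)"
  proof (intro Q_sum Q_mult Q_scalar)
    fix S assume S: "S \<in> Pow V"
    show "ext_coeff \<omega> S \<in> poly_on V" using assms(1) by (simp add: forms_on_def)
    show "Q (wedge ext_gen S)"
      unfolding wedge_def using S assms(2) finite_subset[of S V] by (intro Q_prod) auto
  qed
  then show ?thesis using form_eq_sum_wedge[OF assms(1,2)] by (simp add: Q_def)
qed

text \<open>Sorting the factors costs only a sign. The existence of some \<open>k\<close> suffices,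
  since constant factors preserve the existence of normal forms.\<close>

lemma (in anticommuting) prod_list_eq_wedge:
  "distinct js \<Longrightarrow> \<exists>k. prod_list (map v js) = ext_scalar ((- 1) ^ k) * wedge v (set js)"
proof (induction js)
  case Nil
  then show ?case by (auto intro: exI[of _ 0])
next
  case (Cons j js)
  then obtain k where k: "prod_list (map v js) = ext_scalar ((- 1) ^ k) * wedge v (set js)" by auto
  have "v j * wedge v (set js) = ext_scalar (ext_sign {j} (set js)) * wedge v (insert j (set js))"
    using mult_w[of "set js" j] Cons.prems by (simp add: w_eq_wedge)
  then have "prod_list (map v (j # js)) =
      ext_scalar ((- 1) ^ k * ext_sign {j} (set js)) * wedge v (set (j # js))"
    by (simp add: k ext_scalar_left_commute[of "v j"] ext_scalar_mult mult.assoc)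
  then show ?case by (auto simp: ext_sign_def simp flip: power_add)
qed

lemma (in anticommuting) prod_list_permute:
  assumes "distinct js" "distinct ks" "set js = set ks"
  shows "\<exists>k. prod_list (map v js) = ext_scalar ((- 1) ^ k) * prod_list (map v ks)"
proof -
  obtain k l where k: "prod_list (map v js) = ext_scalar ((- 1) ^ k) * wedge v (set ks)"
    and l: "prod_list (map v ks) = ext_scalar ((- 1) ^ l) * wedge v (set ks)"
    using prod_list_eq_wedge[OF assms(1)] prod_list_eq_wedge[OF assms(2)] assms(3) by metis
  have "ext_scalar ((- 1) ^ (k + l)) * prod_list (map v ks) = prod_list (map v js)"
    unfolding k l by (rule ext_eqI) (simp add: power_add mult.assoc)
  then show ?thesis by metis
qed

section \<open>Minimal relations and broken circuits\<close>

lemma lin_relation_superset: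
  assumes "finite A" "supp L \<subseteq> A"
  shows "(\<Sum>i\<in>supp L. Cst (Poly_Mapping.lookup L i) * lin_form n (c i)) =
    (\<Sum>i\<in>A. Cst (Poly_Mapping.lookup L i) * lin_form n (c i))"
  by (rule sum.mono_neutral_left) (use assms in \<open>auto simp: in_keys_iff\<close>)

text \<open>Among the relations supported in \<open>supp L0\<close> one with fewest indices is
  minimal, since a decomposition would provide one with fewer.\<close>

lemma lin_relation_contains_minimal:
  assumes "lin_relation n m c L0"
  obtains L where "minimal_relation n m c L" "supp L \<subseteq> supp L0"
proof -
  let ?P = "\<lambda>L. lin_relation n m c L \<and> supp L \<subseteq> supp L0"
  obtain L where L: "?P L" and min: "\<And>L'. ?P L' \<Longrightarrow> card (supp L) \<le> card (supp L')"
    using ex_has_least_nat[of ?P L0 "\<lambda>L. card (supp L)"] assms by blast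
  have "\<not> supp L1 \<subset> supp L" if "lin_relation n m c L1" for L1
  proof
    assume "supp L1 \<subset> supp L"
    then show False
      using min[of L1] that L psubset_card_mono[of "supp L" "supp L1"] by auto
  qed
  then have "minimal_relation n m c L" using L unfolding minimal_relation_def by blast
  then show ?thesis using L that by blast
qed

text \<open>A dependence of z_j on the z_i with i \<in> N, i < j, is a relation \<open>L0\<close>
  supported in N \<union> {j}, and \<open>L\<close> is a minimal relation inside it.\<close>

lemma not_nbc_imp_broken_circuit:
  fixes c :: "nat \<Rightarrow> nat \<Rightarrow> 'f::field"
  assumes "\<not> nbc n c {1..m} N" "N \<subseteq> {1..m}"
  obtains L i0 where "minimal_relation n m c L" "i0 \<in> supp L" "\<And>q. q \<in> supp L \<Longrightarrow> q \<le> i0"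
    "supp L - {i0} \<subseteq> N"
proof -
  obtain j b where j: "j \<in> {1..m}"
    and eq: "lin_form n (c j) = (\<Sum>i | i \<in> N \<and> i < j. Cst (b i) * lin_form n (c i))"
    using assms(1) unfolding nbc_def by blast
  let ?N = "{i. i \<in> N \<and> i < j}"
  define L0 where "L0 = Poly_Mapping.single j 1 - (\<Sum>i\<in>?N. Poly_Mapping.single i (b i))"
  have lookup: "Poly_Mapping.lookup L0 i = (if i = j then 1 else if i \<in> ?N then - b i else 0)" for i
    by (simp add: L0_def lookup_minus lookup_sum lookup_single when_def)
  have supp0: "supp L0 \<subseteq> insert j ?N" by (auto simp: in_keys_iff lookup split: if_splits)
  have "j \<in> supp L0" by (simp add: in_keys_iff lookup)
  moreover have "(\<Sum>i\<in>supp L0. Cst (Poly_Mapping.lookup L0 i) * lin_form n (c i)) = 0"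
  proof -
    have "(\<Sum>i\<in>?N. Cst (Poly_Mapping.lookup L0 i) * lin_form n (c i)) =
        (\<Sum>i\<in>?N. - (Cst (b i) * lin_form n (c i)))"
      by (intro sum.cong refl) (auto simp: lookup Cst_uminus)
    then show ?thesis
      by (subst lin_relation_superset[OF _ supp0]) (simp_all add: lookup eq sum_negf)
  qed
  ultimately have "lin_relation n m c L0"
    using supp0 j assms(2) unfolding lin_relation_def by auto
  then obtain L where L: "minimal_relation n m c L" "supp L \<subseteq> supp L0"
    by (rule lin_relation_contains_minimal)
  have ne: "supp L \<noteq> {}" using L by (simp add: minimal_relation_def lin_relation_def)
  let ?i = "Max (supp L)"
  have i: "?i \<in> supp L" "\<And>q. q \<in> supp L \<Longrightarrow> q \<le> ?i" using ne by auto
  \<comment> \<open>The maximum of \<open>L\<close> may be smaller than j; in either case the other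
    indices of \<open>L\<close> are below j and hence in \<open>N\<close>.\<close>
  have "?i \<le> j" using i(1) L(2) supp0 by auto
  then have "supp L - {?i} \<subseteq> N" using i L(2) supp0 by fastforce
  then show ?thesis using that L(1) i by blast
qed

section \<open>Reduction to normal form\<close>

lemma keys_Cst_mult: "supp (Cst a * p) \<subseteq> supp p"
  using keys_mult[of "Cst a" p] by (auto simp: Cst_def split: if_splits)

lemma normal_form_add:
  assumes "normal_form n m c x" "normal_form n m c y"
  shows "normal_form n m c (x + y)"
  unfolding normal_form_def
proof (intro allI ballI)
  fix S \<mu> assume "\<mu> \<in> supp (ext_coeff (x + y) S)"
  then have "\<mu> \<in> supp (ext_coeff x S) \<union> supp (ext_coeff y S)"
    unfolding ext_coeff_add using Poly_Mapping.keys_add by (rule set_rev_mp)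
  then show "nbc n c {1..m} (S \<union> supp \<mu>)" using assms by (auto simp: normal_form_def)
qed

lemma normal_form_Cst_mult: "normal_form n m c x \<Longrightarrow> normal_form n m c (ext_scalar (Cst a) * x)"
  by (auto simp: normal_form_def dest: set_rev_mp[OF _ keys_Cst_mult])

text \<open>The termination measure of the reduction: each occurrence of an index i \<le> m in
  t^\<mu> u_js counts m - i, so replacing an index by a larger one lowers the weight.\<close>

definition weight :: "nat \<Rightarrow> (nat \<Rightarrow>\<^sub>0 nat) \<Rightarrow> nat list \<Rightarrow> nat" where
  "weight m \<mu> js = (\<Sum>i=1..m. (m - i) * Poly_Mapping.lookup \<mu> i) + (\<Sum>j\<leftarrow>js. m - j)"

lemma weight_ind:
  assumes "X \<subseteq> {1..m}"
  shows "weight m (\<mu> + ind X) js = weight m \<mu> js + (\<Sum>q\<in>X. m - q)"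
proof -
  have fin: "finite X" using assms finite_subset by blast
  have "(\<Sum>i=1..m. (m - i) * Poly_Mapping.lookup (ind X) i) = (\<Sum>i=1..m. if i \<in> X then m - i else 0)"
    by (intro sum.cong refl) (simp add: lookup_ind[OF fin])
  also have "\<dots> = (\<Sum>q\<in>{1..m} \<inter> X. m - q)" by (rule sum.inter_restrict[symmetric]) simp
  also have "{1..m} \<inter> X = X" using assms by blast
  finally show ?thesis by (simp add: weight_def lookup_add distrib_left sum.distrib)
qed

lemma sum_list_update_add:
  fixes f :: "'a \<Rightarrow> nat"
  assumes "s < length xs"
  shows "(\<Sum>x\<leftarrow>xs[s := y]. f x) + f (xs ! s) = (\<Sum>x\<leftarrow>xs. f x) + f y"
  using assms by (induction xs arbitrary: s) (auto split: nat.split)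

text \<open>The u's are given by a list, since replacing one index in P_{L,S} can leave the product
  unsorted or with a repetition.\<close>

definition mon_form :: "(nat \<Rightarrow>\<^sub>0 nat) \<Rightarrow> nat list \<Rightarrow> 'f::field mpoly ext" where
  "mon_form \<mu> js = ext_scalar (Poly_Mapping.single \<mu> 1) * prod_list (map ext_gen js)"

text \<open>\<open>J\<close> stands for the ideal generated by the P_{L,S}; the next context
  describes it by closure properties.\<close>

definition has_normal_form_mod ::
    "nat \<Rightarrow> nat \<Rightarrow> (nat \<Rightarrow> nat \<Rightarrow> 'f::field) \<Rightarrow> 'f mpoly ext set \<Rightarrow> 'f mpoly ext \<Rightarrow> bool" where
  "has_normal_form_mod n m c J \<omega> \<longleftrightarrow>
     (\<exists>\<nu>\<in>forms_on {1..m}. normal_form n m c \<nu> \<and> \<omega> - \<nu> \<in> J)"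

section \<open>Reduction of monomials modulo the P_{L,S}\<close>

context
  fixes n m :: nat and c :: "nat \<Rightarrow> nat \<Rightarrow> 'f::field" and J :: "'f mpoly ext set"
  assumes J_0: "0 \<in> J" and J_add: "\<And>x y. x \<in> J \<Longrightarrow> y \<in> J \<Longrightarrow> x + y \<in> J"
    and J_left: "\<And>x y. x \<in> forms_on {1..m} \<Longrightarrow> y \<in> J \<Longrightarrow> x * y \<in> J"
    and J_right: "\<And>x y. x \<in> forms_on {1..m} \<Longrightarrow> y \<in> J \<Longrightarrow> y * x \<in> J"
    and J_P_form: "\<And>L S. minimal_relation n m c L \<Longrightarrow> S \<subseteq> supp L \<Longrightarrow> P_form L S \<in> J"
begin

abbreviation (input) has_normal_form :: "'f mpoly ext \<Rightarrow> bool" where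
  "has_normal_form \<equiv> has_normal_form_mod n m c J"

lemma has_normal_form_J: "x \<in> J \<Longrightarrow> has_normal_form x"
  unfolding has_normal_form_mod_def by (intro bexI[of _ 0]) (auto simp: normal_form_def)

lemma has_normal_form_add:
  assumes "has_normal_form x" "has_normal_form y"
  shows "has_normal_form (x + y)"
proof -
  obtain \<nu> \<nu>' where "\<nu> \<in> forms_on {1..m}" "normal_form n m c \<nu>" "x - \<nu> \<in> J"
    "\<nu>' \<in> forms_on {1..m}" "normal_form n m c \<nu>'" "y - \<nu>' \<in> J"
    using assms unfolding has_normal_form_mod_def by blast
  then show ?thesis unfolding has_normal_form_mod_def
    by (intro bexI[of _ "\<nu> + \<nu>'"] conjI normal_form_add forms_on_add)
      (auto simp: add_diff_add intro: J_add)
qed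

lemma has_normal_form_Cst_mult:
  assumes "has_normal_form x"
  shows "has_normal_form (ext_scalar (Cst a) * x)"
proof -
  obtain \<nu> where \<nu>: "\<nu> \<in> forms_on {1..m}" "normal_form n m c \<nu>" "x - \<nu> \<in> J"
    using assms unfolding has_normal_form_mod_def by blast
  then show ?thesis unfolding has_normal_form_mod_def
    by (intro bexI[of _ "ext_scalar (Cst a) * \<nu>"] conjI normal_form_Cst_mult)
      (auto simp flip: right_diff_distrib intro!: J_left forms_on_mult forms_on_scalar)
qed

lemma has_normal_form_diff:
  assumes "has_normal_form x" "has_normal_form y"
  shows "has_normal_form (x - y)"
proof -
  have "x - y = x + ext_scalar (Cst (- 1)) * y"
    by (simp add: Cst_uminus ext_scalar_uminus)
  then show ?thesis using assms by (simp only: has_normal_form_add has_normal_form_Cst_mult)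
qed

lemma has_normal_form_sum: "(\<And>i. i \<in> A \<Longrightarrow> has_normal_form (f i)) \<Longrightarrow> has_normal_form (sum f A)"
  by (induction A rule: infinite_finite_induct) (simp_all add: has_normal_form_add has_normal_form_J J_0)

text \<open>Multiples of P_{L,S} expanded into monomials: setting them to 0 gives the rewriting
  rules.\<close>

lemma P_form_mult_mon_form:
  fixes L :: "nat \<Rightarrow>\<^sub>0 'f"
  assumes "S \<subseteq> supp L" and js: "js = sorted_list_of_set S"
  shows "ext_scalar (Poly_Mapping.single \<mu> 1) * P_form L S * prod_list (map ext_gen ks) =
    (\<Sum>i\<in>supp L - S. ext_scalar (Cst (Poly_Mapping.lookup L i)) *
      (mon_form (\<mu> + ind (supp L - S - {i})) (js @ ks) -
        (\<Sum>s<length js. mon_form (\<mu> + ind (supp L - S - {i})) (js[s := i] @ ks))))"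
  unfolding P_form_eq[OF assms] sum_distrib_left sum_distrib_right
proof (rule sum.cong[OF refl])
  fix i
  let ?t = "Poly_Mapping.single \<mu> (1 :: 'f)" and ?u = "prod Var (supp L - S - {i}) :: 'f mpoly"
  let ?a = "Cst (Poly_Mapping.lookup L i)" and ?k = "prod_list (map ext_gen ks) :: 'f mpoly ext"
  have tu: "Poly_Mapping.single (\<mu> + ind (supp L - S - {i})) 1 = ?t * ?u"
    by (simp add: prod_Var mult_single)
  have mon: "ext_scalar ?a * mon_form (\<mu> + ind (supp L - S - {i})) (xs @ ks) =
      ext_scalar ?t * (ext_scalar (?a * ?u) * prod_list (map ext_gen xs)) * ?k" for xs
    unfolding mon_form_def tu by (rule ext_eqI) (simp add: mult.assoc)
  show "ext_scalar ?t * (ext_scalar (?a * ?u) * (prod_list (map ext_gen js) -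
        (\<Sum>s<length js. prod_list (map ext_gen (js[s := i]))))) * ?k =
      ext_scalar ?a * (mon_form (\<mu> + ind (supp L - S - {i})) (js @ ks) -
        (\<Sum>s<length js. mon_form (\<mu> + ind (supp L - S - {i})) (js[s := i] @ ks)))"
    unfolding right_diff_distrib left_diff_distrib sum_distrib_left sum_distrib_right mon ..
qed

text \<open>
  In \<open>P\<^bsub>L,S\<^esub>\<close> the term \<open>t\<^bsub>|L| - S - {i\<^sub>0}\<^esub> u\<^sub>S\<close> with \<open>i\<^sub>0 = max |L|\<close> has the largest weight: in all
  others some index of \<open>|L| - {i\<^sub>0}\<close> is replaced by \<open>i\<^sub>0\<close>.
\<close>

lemma has_normal_form_mon_form:
  assumes "supp \<mu> \<subseteq> {1..m}" "set js \<subseteq> {1..m}"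
  shows "has_normal_form (mon_form \<mu> js)"
  using assms
proof (induction "weight m \<mu> js" arbitrary: \<mu> js rule: less_induct)
  case less
  interpret gen: anticommuting "ext_gen :: nat \<Rightarrow> 'f mpoly ext" by (rule anticommuting_ext_gen)
  have permute: "has_normal_form (mon_form \<mu> js)" if ks: "has_normal_form (mon_form \<mu> ks)"
    and dist: "distinct js" "distinct ks" "set js = set ks" for ks
  proof -
    obtain k where "prod_list (map ext_gen js) =
        ext_scalar ((- 1) ^ k) * (prod_list (map ext_gen ks) :: 'f mpoly ext)"
      using gen.prod_list_permute[OF dist] by blast
    moreover have "(- 1) ^ k = Cst ((- 1 :: 'f) ^ k)"
      by (induction k) (simp_all add: Cst_mult Cst_uminus)
    ultimately have "mon_form \<mu> js = ext_scalar (Cst ((- 1) ^ k)) * (mon_form \<mu> ks :: 'f mpoly ext)"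
      by (simp only: mon_form_def) (rule ext_scalar_left_commute)
    then show ?thesis using has_normal_form_Cst_mult[OF ks] by simp
  qed
  define S where "S = set js"
  have S: "S \<subseteq> {1..m}" using less.prems by (simp add: S_def)
  show ?case
  proof (cases "distinct js")
    case False
    then show ?thesis by (simp add: mon_form_def gen.prod_list_0 has_normal_form_J J_0)
  next
    case js: True
    show ?thesis
    proof (cases "nbc n c {1..m} (S \<union> supp \<mu>)")
      case True
      let ?\<nu> = "mon_form \<mu> (sorted_list_of_set S) :: 'f mpoly ext"
      have coeff: "ext_coeff ?\<nu> T = (if T = S then Poly_Mapping.single \<mu> 1 else 0)" for T
        by (simp add: mon_form_def S_def ext_coeff_wedge_gen flip: wedge_def)
      have "?\<nu> \<in> forms_on {1..m}"
        using less.prems(1) S by (auto simp: forms_on_def coeff poly_on_def)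
      moreover have "normal_form n m c ?\<nu>"
        using True by (auto simp: normal_form_def coeff)
      ultimately have "has_normal_form ?\<nu>" unfolding has_normal_form_mod_def using J_0 by force
      then show ?thesis using js by (rule permute) (auto simp: S_def)
    next
      case False
      moreover have "S \<union> supp \<mu> \<subseteq> {1..m}" using less.prems by (auto simp: S_def)
      ultimately obtain L i0 where L: "minimal_relation n m c L" "i0 \<in> supp L"
        "\<And>q. q \<in> supp L \<Longrightarrow> q \<le> i0" "supp L - {i0} \<subseteq> S \<union> supp \<mu>"
        by (rule not_nbc_imp_broken_circuit) blast
      \<comment> \<open>The broken circuit |L| - {i0} is split: \<open>S'\<close> is its part met by
        the u's, and the rest \<open>X i0\<close> lies in \<open>supp \<mu>\<close>, so t^\<mu> is
        divisible by the square-free monomial of \<open>X i0\<close>.\<close>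
      define S' where "S' = S \<inter> (supp L - {i0})"
      define X where "X i = supp L - S' - {i}" for i
      define js1 where "js1 = sorted_list_of_set S'"
      define js2 where "js2 = sorted_list_of_set (S - S')"
      have suppL: "supp L \<subseteq> {1..m}" using L(1) by (simp add: minimal_relation_def lin_relation_def)
      have finX: "finite (X i)" for i by (simp add: X_def)
      have S': "S' \<subseteq> supp L" "i0 \<notin> S'" "finite S'" by (auto simp: S'_def S_def)
      have set12: "set js1 = S'" "set js2 = S - S'" "distinct js1" "distinct js2"
        using S' by (simp_all add: js1_def js2_def S_def)
      define \<mu>' where "\<mu>' = \<mu> - ind (X i0)"
      have \<mu>: "\<mu> = \<mu>' + ind (X i0)"
      proof (rule poly_mapping_eqI)
        fix i
        have "i \<in> supp \<mu>" if "i \<in> X i0" using that L(4) by (auto simp: X_def S'_def)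
        then show "Poly_Mapping.lookup \<mu> i = Poly_Mapping.lookup (\<mu>' + ind (X i0)) i"
          by (auto simp: \<mu>'_def lookup_add lookup_minus lookup_ind[OF finX] in_keys_iff)
      qed
      have keys': "supp (\<mu>' + ind (X i)) \<subseteq> {1..m}" for i
      proof
        fix k assume "k \<in> supp (\<mu>' + ind (X i))"
        then have "k \<in> supp \<mu> \<or> k \<in> X i"
          by (auto simp: in_keys_iff \<mu>'_def lookup_add lookup_minus lookup_ind[OF finX] split: if_splits)
        then show "k \<in> {1..m}" using less.prems suppL by (auto simp: X_def)
      qed
      have W: "(\<Sum>q\<in>X i. m - q) + (m - i) = (\<Sum>q\<in>X i0. m - q) + (m - i0)" if "i \<in> supp L - S'" for i
      proof -
        have "(\<Sum>q\<in>supp L - S'. m - q) = (m - i) + (\<Sum>q\<in>X i. m - q)"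
          if "i \<in> supp L - S'" for i
          unfolding X_def by (rule sum.remove) (use that in auto)
        from this[of i] this[of i0] show ?thesis using that L(2) S' by simp
      qed
      have weight: "weight m (\<mu>' + ind (X i)) ks = weight m \<mu>' ks + (\<Sum>q\<in>X i. m - q)" for i ks
        by (rule weight_ind) (use suppL in \<open>auto simp: X_def\<close>)
      have smaller: "m - i0 < m - i" if "i \<in> supp L - {i0}" for i
      proof -
        have "i0 \<le> m" using L(2) suppL by auto
        then show ?thesis using that L(3)[of i] by auto
      qed
      have weight_js: "weight m \<mu>' (js1 @ js2) = weight m \<mu>' js"
      proof -
        have "(\<Sum>j\<leftarrow>js. m - j) = (\<Sum>j\<in>S. m - j)"
          using js by (simp add: S_def sum.distinct_set_conv_list)
        also have "\<dots> = (\<Sum>j\<in>S - S'. m - j) + (\<Sum>j\<in>S'. m - j)"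
          by (rule sum.subset_diff) (auto simp: S'_def S_def)
        also have "\<dots> = (\<Sum>j\<leftarrow>js1 @ js2. m - j)"
          using set12 by (simp add: sum.distinct_set_conv_list[symmetric])
        finally show ?thesis by (simp add: weight_def)
      qed
      have set_js12: "set (js1 @ js2) = set js" using set12 by (auto simp: S_def S'_def)
      \<comment> \<open>\<open>X i\<close> arises from \<open>X i0\<close> by exchanging i for the
        larger index i0.\<close>
      have red1: "has_normal_form (mon_form (\<mu>' + ind (X i)) (js1 @ js2))" if i: "i \<in> supp L - S' - {i0}" for i
      proof (rule less.hyps)
        show "weight m (\<mu>' + ind (X i)) (js1 @ js2) < weight m \<mu> js"
          unfolding \<mu> weight weight_js using W[of i] smaller[of i] i by auto
        show "set (js1 @ js2) \<subseteq> {1..m}" using set_js12 less.prems by simp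
      qed (rule keys')
      \<comment> \<open>The entry \<open>js1 ! s\<close> is replaced by i, while \<open>X i\<close>
        has i0 in place of i if i \<noteq> i0; altogether \<open>js1 ! s\<close> is exchanged for
        the larger index i0.\<close>
      have red2: "has_normal_form (mon_form (\<mu>' + ind (X i)) (js1[s := i] @ js2))"
        if i: "i \<in> supp L - S'" and s: "s < length js1" for i s
      proof (rule less.hyps)
        have "js1 ! s \<in> S'" using set12 s by auto
        then have "js1 ! s \<in> supp L - {i0}" by (simp add: S'_def)
        then have "m - i0 < m - js1 ! s" by (rule smaller)
        moreover have "(\<Sum>x\<leftarrow>js1[s := i]. m - x) + (m - js1 ! s) = (\<Sum>x\<leftarrow>js1. m - x) + (m - i)"
          by (rule sum_list_update_add[OF s])
        ultimately show "weight m (\<mu>' + ind (X i)) (js1[s := i] @ js2) < weight m \<mu> js"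
          using W[OF i] unfolding \<mu> weight weight_js[symmetric] by (simp add: weight_def)
        show "set (js1[s := i] @ js2) \<subseteq> {1..m}"
        proof -
          have "set (js1[s := i]) \<subseteq> insert i (set js1)" by (rule set_update_subset_insert)
          moreover have "i \<in> {1..m}" using i suppL by blast
          moreover have "set js1 \<union> set js2 \<subseteq> {1..m}" using set_js12 less.prems by simp
          ultimately show ?thesis unfolding set_append by blast
        qed
      qed (rule keys')
      let ?a = "Poly_Mapping.lookup L"
      let ?M = "\<lambda>i. mon_form (\<mu>' + ind (X i)) (js1 @ js2) :: 'f mpoly ext"
      let ?N = "\<lambda>i. \<Sum>s<length js1. mon_form (\<mu>' + ind (X i)) (js1[s := i] @ js2) :: 'f mpoly ext"
      define E where "E = ext_scalar (Poly_Mapping.single \<mu>' 1) * P_form L S' * prod_list (map ext_gen js2)"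
      have "supp \<mu>' \<subseteq> supp \<mu>" by (auto simp: \<mu>'_def in_keys_iff lookup_minus)
      then have "ext_scalar (Poly_Mapping.single \<mu>' 1) \<in> forms_on {1..m}"
        using less.prems by (intro forms_on_scalar) (auto simp: poly_on_def)
      moreover have "prod_list (map ext_gen js2) \<in> forms_on {1..m}"
        using set12 less.prems by (intro forms_on_prod_gen) (auto simp: S_def)
      ultimately have "E \<in> J" unfolding E_def by (intro J_right J_left J_P_form L(1) S'(1))
      have "E = (\<Sum>i\<in>supp L - S'. ext_scalar (Cst (?a i)) * (?M i - ?N i))"
        unfolding E_def X_def by (rule P_form_mult_mon_form[OF S'(1) js1_def])
      also have "\<dots> = ext_scalar (Cst (?a i0)) * (?M i0 - ?N i0) +
          (\<Sum>i\<in>supp L - S' - {i0}. ext_scalar (Cst (?a i)) * (?M i - ?N i))"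
        by (rule sum.remove) (use L(2) S' in auto)
      \<comment> \<open>Modulo \<open>E \<in> J\<close> the term for i0, a non-zero constant times
        t^\<mu> u_js, becomes a combination of monomials of smaller weight.\<close>
      finally have eq: "ext_scalar (Cst (?a i0)) * ?M i0 = E + ext_scalar (Cst (?a i0)) * ?N i0 -
          (\<Sum>i\<in>supp L - S' - {i0}. ext_scalar (Cst (?a i)) * (?M i - ?N i))"
        by (simp add: right_diff_distrib)
      have "has_normal_form (ext_scalar (Cst (?a i0)) * ?M i0)"
        unfolding eq using L(2) S'(2)
        by (intro has_normal_form_diff has_normal_form_add has_normal_form_sum has_normal_form_Cst_mult has_normal_form_J[OF \<open>E \<in> J\<close>])
          (auto intro: red1 red2)
      then have "has_normal_form (ext_scalar (Cst (inverse (?a i0))) * (ext_scalar (Cst (?a i0)) * ?M i0))"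
        by (rule has_normal_form_Cst_mult)
      also have "ext_scalar (Cst (inverse (?a i0))) * (ext_scalar (Cst (?a i0)) * ?M i0) = mon_form \<mu> (js1 @ js2)"
        using L(2) unfolding mult.assoc[symmetric] ext_scalar_mult[symmetric] Cst_mult[symmetric]
        by (simp add: in_keys_iff flip: \<mu>)
      finally show ?thesis
        by (rule permute[OF _ js _ set_js12[symmetric]]) (use set12 in auto)
    qed
  qed
qed

lemma has_normal_form_forms:
  assumes "\<omega> \<in> forms_on {1..m}"
  shows "has_normal_form \<omega>"
proof -
  have "has_normal_form (ext_scalar (ext_coeff \<omega> S) * wedge ext_gen S)" if S: "S \<in> Pow {1..m}" for S
  proof -
    let ?p = "ext_coeff \<omega> S"
    have p: "?p \<in> poly_on {1..m}" using assms by (simp add: forms_on_def)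
    have "?p = (\<Sum>\<mu>\<in>supp ?p. Cst (Poly_Mapping.lookup ?p \<mu>) * Poly_Mapping.single \<mu> 1)"
      using mpoly_sum_monomials[of ?p] by (simp add: Cst_def mult_single)
    from arg_cong[OF this, of "\<lambda>q. ext_scalar q * wedge ext_gen S"]
    have "ext_scalar ?p * wedge ext_gen S =
        (\<Sum>\<mu>\<in>supp ?p. ext_scalar (Cst (Poly_Mapping.lookup ?p \<mu>) * Poly_Mapping.single \<mu> 1) *
          wedge ext_gen S)"
      unfolding ext_scalar_sum sum_distrib_right .
    also have "\<dots> = (\<Sum>\<mu>\<in>supp ?p.
        ext_scalar (Cst (Poly_Mapping.lookup ?p \<mu>)) * mon_form \<mu> (sorted_list_of_set S))"
      by (simp only: mon_form_def wedge_def ext_scalar_mult mult.assoc)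
    also have "has_normal_form \<dots>"
      using p S finite_subset[of S "{1..m}"]
      by (intro has_normal_form_sum has_normal_form_Cst_mult has_normal_form_mon_form) (auto simp: poly_on_def)
    finally show ?thesis .
  qed
  then show ?thesis
    by (subst form_eq_sum_wedge[OF assms]) (auto intro: has_normal_form_sum)
qed

end

section \<open>The kernels\<close>

lemma a_inv_ring_on:
  assumes "ring (ring_on A)" "x \<in> A" "- x \<in> A"
  shows "\<ominus>\<^bsub>ring_on A\<^esub> x = - x"
proof -
  interpret ring "ring_on A" by fact
  show ?thesis by (rule minus_equality) (use assms in auto)
qed

lemma ideal_ring_onI:
  assumes "ring (ring_on A)" "I \<subseteq> A" "0 \<in> I"
    and "\<And>x y. x \<in> I \<Longrightarrow> y \<in> I \<Longrightarrow> x + y \<in> I"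
    and left: "\<And>x y. x \<in> A \<Longrightarrow> y \<in> I \<Longrightarrow> x * y \<in> I"
    and right: "\<And>x y. x \<in> A \<Longrightarrow> y \<in> I \<Longrightarrow> y * x \<in> I"
  shows "ideal I (ring_on A)"
proof (rule idealI[OF assms(1)])
  interpret ring "ring_on A" by fact
  have minus1: "- 1 \<in> A"
  proof -
    have "\<ominus>\<^bsub>ring_on A\<^esub> 1 \<in> A" using a_inv_closed[of 1] one_closed by simp
    moreover have "\<ominus>\<^bsub>ring_on A\<^esub> 1 + 1 = 0" using l_neg[of 1] one_closed by simp
    ultimately show ?thesis by (metis eq_neg_iff_add_eq_0)
  qed
  show "subgroup I (add_monoid (ring_on A))"
  proof
    fix x assume x: "x \<in> I"
    then have "- x \<in> I" using left[OF minus1] by force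
    moreover have "\<ominus>\<^bsub>ring_on A\<^esub> x = - x"
      by (rule a_inv_ring_on) (use assms x \<open>- x \<in> I\<close> in auto)
    ultimately show "inv\<^bsub>add_monoid (ring_on A)\<^esub> x \<in> I" by (simp add: a_inv_def)
  qed (use assms in auto)
qed (use left right in auto)

text \<open>Makes the projection of \<Xi> onto its part F[t] of degree 0 in the u's
  multiplicative.\<close>

lemma ext_coeff_mult_empty: "ext_coeff (x * y) {} = ext_coeff x {} * ext_coeff y {}"
  by (simp add: times_ext.rep_eq)

lemma ext_coeff_prod_gen_empty:
  "js \<noteq> [] \<Longrightarrow> ext_coeff (prod_list (map ext_gen js)) {} = 0"
  by (cases js) (simp_all add: ext_coeff_mult_empty ext_gen.rep_eq)

lemma ext_coeff_diff: "ext_coeff (x - y) S = ext_coeff x S - ext_coeff y S"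
  by transfer simp

text \<open>For non-empty \<open>S\<close> every term in \<open>P_form_eq\<close> contains a product
  of |S| generators, so nothing of degree 0 occurs.\<close>

lemma ext_coeff_P_form_empty:
  assumes "S \<subseteq> supp L"
  shows "ext_coeff (P_form L S) {} = (if S = {} then P_rel L else 0)"
proof (cases "S = {}")
  case True
  then show ?thesis by (simp add: P_form_empty ext_scalar.rep_eq)
next
  case False
  define js where "js = sorted_list_of_set S"
  have "finite S" by (rule finite_subset[OF assms finite_keys])
  then have "js \<noteq> []" using False by (simp add: js_def)
  then have "ext_coeff (P_form L S) {} = 0"
    by (simp add: P_form_eq[OF assms js_def] ext_coeff_sum ext_coeff_diff ext_coeff_prod_gen_empty)
  then show ?thesis using False by simp
qed

section \<open>Uniqueness of h and \<psi>\<close>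

context
  fixes n m :: nat and c :: "nat \<Rightarrow> nat \<Rightarrow> 'f::field"
  assumes z_nonzero: "\<And>i. i \<in> {1..m} \<Longrightarrow> lin_form n (c i) \<noteq> 0"
begin

lemma hom_eq_h0:
  assumes h: "h \<in> ring_hom (poly_ring {1..m}) (loc_poly_ring n m c)"
    and "\<And>a. h (Cst a) = to_fract (Cst a)"
    and "\<And>i. i \<in> {1..m} \<Longrightarrow> h (Var i) = inverse (to_fract (lin_form n (c i)))"
    and p: "p \<in> poly_on {1..m}"
  shows "h p = h0 n c p"
proof -
  note h0_hom = h0_hom[of m n c, OF z_nonzero]
  show ?thesis using p
  proof (induction rule: poly_on_induct)
    case (add p q)
    then show ?case using ring_hom_add[OF h, of p q] h0_hom(1)[of p q]
      by (simp add: poly_ring_def loc_poly_ring_def)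
  next
    case (mult p q)
    then show ?case using ring_hom_mult[OF h, of p q] h0_hom(2)[of p q]
      by (simp add: poly_ring_def loc_poly_ring_def)
  qed (use assms h0_hom in auto)
qed

lemma hom_eq_psi0:
  assumes psi: "\<psi> \<in> ring_hom (form_ring {1..m}) (loc_form_ring n m c)"
    and Cst: "\<And>a. \<psi> (ext_scalar (Cst a)) = ext_scalar (to_fract (Cst a))"
    and Var: "\<And>i. i \<in> {1..m} \<Longrightarrow>
      \<psi> (ext_scalar (Var i)) = ext_scalar (inverse (to_fract (lin_form n (c i))))"
    and gen: "\<And>i. i \<in> {1..m} \<Longrightarrow> \<psi> (ext_gen i) =
      ext_scalar (inverse (to_fract (lin_form n (c i)))) * ext_fract (d_lin_form n (c i))"
    and \<omega>: "\<omega> \<in> forms_on {1..m}"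
  shows "\<psi> \<omega> = psi0 n m c \<omega>"
proof -
  have h0_add: "h0 n c (p + q) = h0 n c p + h0 n c q" and h0_mult: "h0 n c (p * q) = h0 n c p * h0 n c q"
    for p q by (rule h0_hom, rule z_nonzero, assumption)+
  note h0_hom = h0_hom[of m n c, OF z_nonzero]
  note psi0_hom = psi0_hom[of m n c, OF z_nonzero]
  have add: "\<psi> (x + y) = \<psi> x + \<psi> y" if "x \<in> forms_on {1..m}" "y \<in> forms_on {1..m}" for x y
    using ring_hom_add[OF psi, of x y] that by (simp add: form_ring_def loc_form_ring_def)
  have mult: "\<psi> (x * y) = \<psi> x * \<psi> y" if "x \<in> forms_on {1..m}" "y \<in> forms_on {1..m}" for x y
    using ring_hom_mult[OF psi, of x y] that by (simp add: form_ring_def loc_form_ring_def)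
  have scalar: "\<psi> (ext_scalar p) = ext_scalar (h0 n c p)" if "p \<in> poly_on {1..m}" for p
    using that
  proof (induction rule: poly_on_induct)
    case (add p q)
    then show ?case
      using \<open>\<And>x y. x \<in> forms_on {1..m} \<Longrightarrow> y \<in> forms_on {1..m} \<Longrightarrow> \<psi> (x + y) = \<psi> x + \<psi> y\<close>
      by (simp add: ext_scalar_add h0_add forms_on_scalar)
  next
    case (mult p q)
    then show ?case
      using \<open>\<And>x y. x \<in> forms_on {1..m} \<Longrightarrow> y \<in> forms_on {1..m} \<Longrightarrow> \<psi> (x * y) = \<psi> x * \<psi> y\<close>
      by (simp add: ext_scalar_mult h0_mult forms_on_scalar)
  qed (use Cst Var h0_hom in auto)
  show ?thesis using \<omega> finite_atLeastAtMost
  proof (induction rule: forms_on_induct)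
    case (gen i)
    then show ?case
      using assms(4)[of i] psi0_gen[of m n c, OF z_nonzero] v0_def[of m n c, OF z_nonzero] by simp
  qed (use add mult scalar psi0_hom in auto)
qed

end

theorem theorem7:
  fixes n m :: nat
    and c :: "nat \<Rightarrow> nat \<Rightarrow> 'f::field"
    and h :: "'f mpoly \<Rightarrow> 'f mpoly fract"
    and \<psi> :: "'f mpoly ext \<Rightarrow> 'f mpoly fract ext"
  assumes z_nonzero: "\<And>i. i \<in> {1..m} \<Longrightarrow> lin_form n (c i) \<noteq> 0"
    and h_hom: "h \<in> ring_hom (poly_ring {1..m}) (loc_poly_ring n m c)"
    and h_Cst: "\<And>a. h (Cst a) = to_fract (Cst a)"
    and h_Var: "\<And>i. i \<in> {1..m} \<Longrightarrow> h (Var i) = inverse (to_fract (lin_form n (c i)))"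
    and psi_hom: "\<psi> \<in> ring_hom (form_ring {1..m}) (loc_form_ring n m c)"
    and psi_Cst: "\<And>a. \<psi> (ext_scalar (Cst a)) = ext_scalar (to_fract (Cst a))"
    and psi_Var: "\<And>i. i \<in> {1..m} \<Longrightarrow>
      \<psi> (ext_scalar (Var i)) = ext_scalar (inverse (to_fract (lin_form n (c i))))"
    and psi_gen: "\<And>i. i \<in> {1..m} \<Longrightarrow>
      \<psi> (ext_gen i) = ext_scalar (inverse (to_fract (lin_form n (c i)))) *
        ext_fract (d_lin_form n (c i))"
  shows "a_kernel (poly_ring {1..m}) (loc_poly_ring n m c) h =
      genideal (poly_ring {1..m}) {P_rel L | L. minimal_relation n m c L} \<and>
    a_kernel (form_ring {1..m}) (loc_form_ring n m c) \<psi> =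
      genideal (form_ring {1..m}) {P_form L S | L S. minimal_relation n m c L \<and> S \<subseteq> supp L}"
proof -
  let ?V = "{1..m}"
  let ?A = "poly_ring ?V :: 'f mpoly ring" and ?B = "form_ring ?V :: 'f mpoly ext ring"
  let ?G = "{P_rel L | L. minimal_relation n m c L}"
  let ?H = "{P_form L S | L S. minimal_relation n m c L \<and> S \<subseteq> supp L}"
  let ?I = "a_kernel ?A (loc_poly_ring n m c) h"
  let ?K = "a_kernel ?B (loc_form_ring n m c) \<psi>"
  define IG where "IG = genideal ?A ?G"
  define IH where "IH = genideal ?B ?H"
  interpret A: ring ?A by (rule ring_poly_ring)
  interpret B: ring ?B by (rule ring_form_ring)
  note psi0_hom = psi0_hom[of m n c, OF z_nonzero]
  have I: "?I = {p \<in> poly_on ?V. h0 n c p = 0}"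
  proof -
    have "h p = h0 n c p" if "p \<in> poly_on ?V" for p
      by (rule hom_eq_h0[of m n c h]) (use assms that in auto)
    then show ?thesis
      by (auto simp: a_kernel_def' poly_ring_def loc_poly_ring_def)
  qed
  have K: "?K = {\<omega> \<in> forms_on ?V. psi0 n m c \<omega> = 0}"
  proof -
    have "\<psi> \<omega> = psi0 n m c \<omega>" if "\<omega> \<in> forms_on ?V" for \<omega>
      by (rule hom_eq_psi0[of m n c \<psi>]) (use assms that in auto)
    then show ?thesis
      by (auto simp: a_kernel_def' form_ring_def loc_form_ring_def)
  qed
  have idealI: "ideal ?I ?A"
    by (intro ring_hom_ring.kernel_is_ideal ring_hom_ringI2 ring_poly_ring h_hom
        ring_loc_poly_ring[of m n c, OF z_nonzero])
  have idealK: "ideal ?K ?B"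
    by (intro ring_hom_ring.kernel_is_ideal ring_hom_ringI2 ring_form_ring psi_hom
        ring_loc_form_ring[of m n c, OF z_nonzero])
  have supp: "supp L \<subseteq> ?V" "lin_relation n m c L" if "minimal_relation n m c L" for L
    using that by (auto simp: minimal_relation_def lin_relation_def)
  have P_form_K: "P_form L S \<in> ?K" if "minimal_relation n m c L" "S \<subseteq> supp L" for L S
  proof -
    have "psi0 n m c (P_form L S) = 0"
      by (rule psi0_P_form[OF _ supp(2)[OF that(1)] that(2)]) (rule z_nonzero)
    then show ?thesis
      unfolding K using that(2) supp(1)[OF that(1)] P_form_in_forms_on by blast
  qed
  have HK: "?H \<subseteq> ?K" using P_form_K by blast
  have H: "?H \<subseteq> carrier ?B" using HK K by (auto simp: form_ring_def)
  have h0_scalar: "h0 n c p = 0" if "psi0 n m c (ext_scalar p) = 0" for p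
    using that psi0_hom(3)[of p] by (metis ext_coeff_zero ext_scalar.rep_eq)
  have GI: "?G \<subseteq> ?I"
  proof
    fix p assume "p \<in> ?G"
    then obtain L where L: "p = P_rel L" "minimal_relation n m c L" by blast
    \<comment> \<open>Since P_L = P_{L,{}}, membership in I follows from the case of forms.\<close>
    then have "ext_scalar p \<in> ?K" using P_form_K[of L "{}"] by (simp add: P_form_empty)
    then have "p \<in> poly_on ?V" "h0 n c p = 0"
      unfolding K using h0_scalar by (auto simp: forms_on_def ext_scalar.rep_eq split: if_splits)
    then show "p \<in> ?I" unfolding I by blast
  qed
  have G: "?G \<subseteq> carrier ?A" using GI I by (auto simp: poly_ring_def)
  interpret IG: ideal IG ?A unfolding IG_def by (rule A.genideal_ideal[OF G])
  interpret IH: ideal IH ?B unfolding IH_def by (rule B.genideal_ideal[OF H])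
  have IHK: "IH \<subseteq> ?K" unfolding IH_def by (rule B.genideal_minimal[OF idealK HK])
  have IGI: "IG \<subseteq> ?I" unfolding IG_def by (rule A.genideal_minimal[OF idealI GI])
  have "?K \<subseteq> IH"
  proof
    fix \<omega> assume \<omega>: "\<omega> \<in> ?K"
    have "has_normal_form_mod n m c IH \<omega>"
    proof (rule has_normal_form_forms)
      show "0 \<in> IH" using IH.zero_closed by (simp add: form_ring_def)
      show "x + y \<in> IH" if "x \<in> IH" "y \<in> IH" for x y
        using IH.a_closed[OF that] by (simp add: form_ring_def)
      show "x * y \<in> IH" "y * x \<in> IH" if "x \<in> forms_on ?V" "y \<in> IH" for x y
        using IH.I_l_closed[of y x] IH.I_r_closed[of y x] that by (simp_all add: form_ring_def)
      show "P_form L S \<in> IH" if "minimal_relation n m c L" "S \<subseteq> supp L" for L S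
        unfolding IH_def using B.genideal_self[OF H] that by blast
      show "\<omega> \<in> forms_on ?V" using \<omega> K by simp
    qed
    then obtain \<nu> where \<nu>: "\<nu> \<in> forms_on ?V" "normal_form n m c \<nu>" "\<omega> - \<nu> \<in> IH"
      unfolding has_normal_form_mod_def by blast
    \<comment> \<open>\<psi> kills the ideal generated by the P_{L,S}, so the normal form \<nu> of
      \<omega> lies in the kernel as well and must be 0.\<close>
    then have "psi0 n m c (\<omega> - \<nu>) = 0" using IHK K by blast
    then have "psi0 n m c \<nu> = 0"
      using \<omega> K psi0_diff[of m n c \<omega> \<nu>, OF z_nonzero] by simp
    then have "\<nu> = 0" by (rule normal_form_psi0_eq_0[OF _ \<nu>(1,2), rotated]) (rule z_nonzero)
    then show "\<omega> \<in> IH" using \<nu> by simp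
  qed
  moreover have "?I \<subseteq> IG"
  proof
    fix p assume "p \<in> ?I"
    then have p: "p \<in> poly_on ?V" "h0 n c p = 0" using I by auto
    \<comment> \<open>The preimage of \<open>IG\<close> under the projection to degree 0. It
      contains all P_{L,S}, hence \<open>IH\<close>; and p \<in> I, viewed as a scalar in K, lies in
      \<open>IH\<close>, so p itself lies in \<open>IG\<close>.\<close>
    let ?J = "{\<omega> \<in> forms_on ?V. ext_coeff \<omega> {} \<in> IG}"
    have "ideal ?J (ring_on (forms_on ?V))"
    proof (rule ideal_ring_onI)
      show "ring (ring_on (forms_on ?V :: 'f mpoly ext set))"
        using ring_form_ring[of ?V] by (simp add: form_ring_def)
      show "0 \<in> ?J" using IG.zero_closed by (simp add: poly_ring_def)
      show "x + y \<in> ?J" if "x \<in> ?J" "y \<in> ?J" for x y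
        using IG.a_closed[of "ext_coeff x {}" "ext_coeff y {}"] that
        by (simp add: poly_ring_def ext_coeff_add forms_on_add)
      show "x * y \<in> ?J" "y * x \<in> ?J" if "x \<in> forms_on ?V" "y \<in> ?J" for x y
        using IG.I_l_closed[of "ext_coeff y {}" "ext_coeff x {}"]
          IG.I_r_closed[of "ext_coeff y {}" "ext_coeff x {}"] that
        by (simp_all add: poly_ring_def ext_coeff_mult_empty forms_on_mult) (auto simp: forms_on_def)
    qed auto
    moreover have "?H \<subseteq> ?J"
    proof
      fix \<omega> assume "\<omega> \<in> ?H"
      then obtain L S where L: "\<omega> = P_form L S" "minimal_relation n m c L" "S \<subseteq> supp L" by blast
      have "P_rel L \<in> IG" unfolding IG_def using A.genideal_self[OF G] L(2) by blast
      moreover have "0 \<in> IG" using IG.zero_closed by (simp add: poly_ring_def)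
      ultimately show "\<omega> \<in> ?J"
        using L supp(1)[OF L(2)] by (simp add: ext_coeff_P_form_empty P_form_in_forms_on)
    qed
    ultimately have "IH \<subseteq> ?J"
      unfolding IH_def by (intro B.genideal_minimal) (simp_all add: form_ring_def)
    moreover have "ext_scalar p \<in> IH"
    proof -
      have "ext_scalar p \<in> ?K" unfolding K using p psi0_hom(3)[of p] by (simp add: forms_on_scalar)
      then show ?thesis using \<open>?K \<subseteq> IH\<close> by blast
    qed
    ultimately show "p \<in> IG" by (auto simp: ext_scalar.rep_eq)
  qed
  ultimately show ?thesis using IHK IGI unfolding IG_def IH_def by blast
qed

end
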